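(* Assume the weight regularity condition and that the weight sequence satisfies either (i) $\frac1N\sum_{i\in[N]}w_i^4\to\mathbb E[W^4]<\infty$, in which case set $\boldsymbol\delta=3$, or (ii) $w_i=c_w(N/i)^{1/(\tau-1)}$ for $i\in[N]$, for some constant $c_w>0$ and $\tau\in(3,5)$, in which case set $\boldsymbol\delta=\tau-2$. Let $P_N$ be the annealed Ising measure on $\mathrm{GRG}_N(\boldsymbol w)$ at inverse temperature $\beta_{c,N}={\rm asinh}(1/\nu_N)$ and external field $B=0$, where $\nu_N=\mathbb E[W_N^2]/\mathbb E[W_N]$. Then $S_N/N^{\boldsymbol\delta/(\boldsymbol\delta+1)}$ converges in distribution under $P_N$ to a random variable $X$ with density proportional to $e^{-f(x)}$, where \[ f(x)=\frac1{12}\frac{\mathbb E[W^4]}{\mathbb E[W]^4}x^4\quad\text{in case (i)}, \] \[ f(x)=\sum_{i\ge1}\Big(\frac12\Big(\frac{\tau-2}{\tau-1}\,x\,i^{-1/(\tau-1)}\Big)^2-\log\cosh\Big(\frac{\tau-2}{\tau-1}\,x\,i^{-1/(\tau-1)}\Big)\Big)\quad\text{in case (ii)}. \] Moreover $\lim_{x\to\infty}f(x)/x^{1+\boldsymbol\delta}=C$ with $C=\frac1{12}\mathbb E[W^4]/\mathbb E[W]^4$ in case (i) and $C=\big(\frac{\tau-2}{\tau-1}\big)^{\tau-1}\int_0^\infty\big(\frac12y^{-2/(\tau-1)}-\log\cosh y^{-1/(\tau-1)}\big)\,dy\in(0,\infty)$ in case (ii). The same result holds for the rank-1 inhomogeneous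 Curie–Weiss model at inverse temperature $\beta_{c,N}=1/\nu_N$ and $B=0$.
   Context: Weights $w_i>0$, $\ell_N=\sum_iw_i$, $W_N=w_{U_N}$ with $U_N$ uniform on $[N]$, so $\mathbb E[W_N^k]=\frac1N\sum_iw_i^k$. Weight regularity condition: there is a random variable $W$ with $W_N\to W$ in distribution, $\mathbb E[W_N^2]\to\mathbb E[W^2]<\infty$, $\mathbb E[W]>0$. Generalized random graph $\mathrm{GRG}_N(\boldsymbol w)$: edges $ij$ independent, present with probability $w_iw_j/(\ell_N+w_iw_j)$, law $Q_N$. Annealed Ising measure: $P_N(\sigma)=Q_N(\exp[\beta\sum_{(i,j)\in E_N}\sigma_i\sigma_j+B\sum_i\sigma_i])/Q_N(Z_N(\beta,B))$ on $\sigma\in\{-1,1\}^N$. Rank-1 inhomogeneous Curie–Weiss model: measure proportional to $\exp(\frac12\sum_{i,j\in[N]}\beta\frac{w_iw_j}{\ell_N}\sigma_i\sigma_j+B\sum_i\sigma_i)$. $S_N=\sum_{i\in[N]}\sigma_i$. *)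

theory Defs
  imports "HOL-Probability.Probability"
begin

text \<open>Weights: w N i is the weight of vertex i in [N] = {1..N}.\<close>

definition moment :: "(nat \<Rightarrow> nat \<Rightarrow> real) \<Rightarrow> nat \<Rightarrow> nat \<Rightarrow> real" where
  "moment w N k = (\<Sum>i=1..N. w N i ^ k) / real N"

definition total_weight :: "(nat \<Rightarrow> nat \<Rightarrow> real) \<Rightarrow> nat \<Rightarrow> real" where
  "total_weight w N = (\<Sum>i=1..N. w N i)"

definition weight_law :: "(nat \<Rightarrow> nat \<Rightarrow> real) \<Rightarrow> nat \<Rightarrow> real measure" where
  "weight_law w N = measure_pmf (map_pmf (w N) (pmf_of_set {1..N}))"

definition weight_regular :: "(nat \<Rightarrow> nat \<Rightarrow> real) \<Rightarrow> real measure \<Rightarrow> bool" where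
  "weight_regular w \<mu> \<longleftrightarrow>
     real_distribution \<mu> \<and>
     weak_conv_m (weight_law w) \<mu> \<and>
     integrable \<mu> (\<lambda>x. x ^ 2) \<and>
     (\<lambda>N. moment w N 2) \<longlonglongrightarrow> (\<integral>x. x ^ 2 \<partial>\<mu>) \<and>
     (\<integral>x. x \<partial>\<mu>) > 0"

definition nu :: "(nat \<Rightarrow> nat \<Rightarrow> real) \<Rightarrow> nat \<Rightarrow> real" where
  "nu w N = moment w N 2 / moment w N 1"

definition edge_prob :: "(nat \<Rightarrow> nat \<Rightarrow> real) \<Rightarrow> nat \<Rightarrow> nat \<Rightarrow> nat \<Rightarrow> real" where
  "edge_prob w N i j = w N i * w N j / (total_weight w N + w N i * w N j)"

text \<open>Unordered pairs ij of distinct vertices, represented as (i,j) with i < j.\<close>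
definition vpairs :: "nat \<Rightarrow> (nat \<times> nat) set" where
  "vpairs N = {(i, j). 1 \<le> i \<and> i < j \<and> j \<le> N}"

text \<open>Law Q_N of GRG_N(w): a graph is the indicator of its edge set on vpairs N.\<close>
definition grg :: "(nat \<Rightarrow> nat \<Rightarrow> real) \<Rightarrow> nat \<Rightarrow> (nat \<times> nat \<Rightarrow> bool) pmf" where
  "grg w N = Pi_pmf (vpairs N) False (\<lambda>(i, j). bernoulli_pmf (edge_prob w N i j))"

definition configs :: "nat \<Rightarrow> (nat \<Rightarrow> real) set" where
  "configs N = {1..N} \<rightarrow>\<^sub>E {-1, 1}"

definition spin_sum :: "nat \<Rightarrow> (nat \<Rightarrow> real) \<Rightarrow> real" where
  "spin_sum N \<sigma> = (\<Sum>i=1..N. \<sigma> i)"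

definition ising_H :: "nat \<Rightarrow> real \<Rightarrow> real \<Rightarrow> (nat \<times> nat \<Rightarrow> bool) \<Rightarrow> (nat \<Rightarrow> real) \<Rightarrow> real" where
  "ising_H N \<beta> B e \<sigma> = \<beta> * (\<Sum>(i, j)\<in>{p \<in> vpairs N. e p}. \<sigma> i * \<sigma> j) + B * spin_sum N \<sigma>"

definition Z_graph :: "nat \<Rightarrow> real \<Rightarrow> real \<Rightarrow> (nat \<times> nat \<Rightarrow> bool) \<Rightarrow> real" where
  "Z_graph N \<beta> B e = (\<Sum>\<sigma>\<in>configs N. exp (ising_H N \<beta> B e \<sigma>))"

definition annealed_ising :: "(nat \<Rightarrow> nat \<Rightarrow> real) \<Rightarrow> nat \<Rightarrow> real \<Rightarrow> real \<Rightarrow> (nat \<Rightarrow> real) \<Rightarrow> real" where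
  "annealed_ising w N \<beta> B \<sigma> =
     measure_pmf.expectation (grg w N) (\<lambda>e. exp (ising_H N \<beta> B e \<sigma>)) /
     measure_pmf.expectation (grg w N) (\<lambda>e. Z_graph N \<beta> B e)"

definition cw_weight :: "(nat \<Rightarrow> nat \<Rightarrow> real) \<Rightarrow> nat \<Rightarrow> real \<Rightarrow> real \<Rightarrow> (nat \<Rightarrow> real) \<Rightarrow> real" where
  "cw_weight w N \<beta> B \<sigma> =
     exp (1/2 * (\<Sum>i=1..N. \<Sum>j=1..N. \<beta> * (w N i * w N j / total_weight w N) * \<sigma> i * \<sigma> j)
          + B * spin_sum N \<sigma>)"

definition cw_measure :: "(nat \<Rightarrow> nat \<Rightarrow> real) \<Rightarrow> nat \<Rightarrow> real \<Rightarrow> real \<Rightarrow> (nat \<Rightarrow> real) \<Rightarrow> real" where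
  "cw_measure w N \<beta> B \<sigma> = cw_weight w N \<beta> B \<sigma> / (\<Sum>\<tau>\<in>configs N. cw_weight w N \<beta> B \<tau>)"

definition scaled_sum_law :: "((nat \<Rightarrow> real) \<Rightarrow> real) \<Rightarrow> nat \<Rightarrow> real \<Rightarrow> real measure" where
  "scaled_sum_law P N a =
     distr (density (count_space (configs N)) (\<lambda>\<sigma>. ennreal (P \<sigma>))) borel
           (\<lambda>\<sigma>. spin_sum N \<sigma> / real N powr a)"

definition exp_density_law :: "(real \<Rightarrow> real) \<Rightarrow> real measure" where
  "exp_density_law f =
     density lborel (\<lambda>x. ennreal (exp (- f x) / (\<integral>y. exp (- f y) \<partial>lborel)))"

definition f_case1 :: "real measure \<Rightarrow> real \<Rightarrow> real" where
  "f_case1 \<mu> x = 1/12 * ((\<integral>y. y ^ 4 \<partial>\<mu>) / (\<integral>y. y \<partial>\<mu>) ^ 4) * x ^ 4"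

definition f_case2_term :: "real \<Rightarrow> real \<Rightarrow> nat \<Rightarrow> real" where
  "f_case2_term \<tau> x i =
     (let a = (\<tau> - 2) / (\<tau> - 1) * x * real i powr (- 1 / (\<tau> - 1))
      in 1/2 * a ^ 2 - ln (cosh a))"

definition f_case2 :: "real \<Rightarrow> real \<Rightarrow> real" where
  "f_case2 \<tau> x = (\<Sum>i. f_case2_term \<tau> x (Suc i))"

definition C_case2_integrand :: "real \<Rightarrow> real \<Rightarrow> real" where
  "C_case2_integrand \<tau> y = 1/2 * y powr (- 2 / (\<tau> - 1)) - ln (cosh (y powr (- 1 / (\<tau> - 1))))"

definition C_case2 :: "real \<Rightarrow> real" where
  "C_case2 \<tau> = ((\<tau> - 2) / (\<tau> - 1)) powr (\<tau> - 1) *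
     (LINT y:{0<..}|lborel. C_case2_integrand \<tau> y)"

text \<open>The conclusion for a model with spin pmf P N: S_N / N^(delta/(delta+1)) converges in
  distribution to the law with density proportional to exp(-f) (which exists, i.e.
  exp(-f) is Lebesgue integrable).\<close>
definition scaling_limit :: "(nat \<Rightarrow> (nat \<Rightarrow> real) \<Rightarrow> real) \<Rightarrow> real \<Rightarrow> (real \<Rightarrow> real) \<Rightarrow> bool" where
  "scaling_limit P \<delta> f \<longleftrightarrow>
     integrable lborel (\<lambda>x. exp (- f x)) \<and>
     weak_conv_m (\<lambda>N. scaled_sum_law (P N) N (\<delta> / (\<delta> + 1))) (exp_density_law f)"

end

theory Submission
  imports Defs
begin

text \<open>
  At criticality the Curie-Weiss weight is \<open>exp ((\<Sum>w\<^sub>i \<sigma>\<^sub>i)\<^sup>2 / (2 \<Sum>w\<^sub>i\<^sup>2))\<close>. By the Hubbard-Stratonovich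
  transform it is a mixture over \<open>z\<close> of independent spins with means \<open>tanh (t\<^sub>i z)\<close>, where
  \<open>t\<^sub>i = w\<^sub>i N\<^sup>a / \<Sum>w\<^sub>j\<close> and \<open>a = \<delta> / (\<delta> + 1)\<close>; the density of \<open>z\<close> is proportional to
  \<open>exp (- \<Sum>phi (t\<^sub>i z))\<close> with \<open>phi u = u\<^sup>2/2 - ln (cosh u)\<close>. Given \<open>z\<close>, the variable \<open>S\<^sub>N / N\<^sup>a\<close>
  concentrates at \<open>z\<close>. Hence the limit law has density proportional to \<open>exp (- f)\<close> as soon as
  \<open>\<Sum>phi (t\<^sub>i z)\<close> tends to \<open>f z\<close> pointwise: since \<open>phi\<close> is convex, convergence at \<open>z = 1\<close> alone
  gives an integrable majorant.

  Averaging over the graph yields an Ising model with pair couplings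
  \<open>sinh \<beta> x\<^sub>i\<^sub>j - O(x\<^sub>i\<^sub>j\<^sup>2)\<close>, \<open>x\<^sub>i\<^sub>j = w\<^sub>i w\<^sub>j / \<Sum>w\<^sub>k\<close>, that is, the Curie-Weiss measure at inverse
  temperature \<open>sinh \<beta>\<close> tilted by the exponential of a uniformly bounded quadratic form. By
  Griffiths' inequality the second moment of this form is at most a constant times that of
  \<open>\<Sum>x\<^sub>i\<^sub>j\<^sup>2 \<sigma>\<^sub>i \<sigma>\<^sub>j\<close>, which tends to \<open>0\<close> by uniform integrability of the squared weights.
\<close>

subsection \<open>The function \<open>u\<^sup>2/2 - ln cosh u\<close>\<close>

text \<open>The exponent \<open>\<delta> / (\<delta> + 1)\<close> is the scale on which the sum of
  the terms phi(t_i z) stays of order one. With four moments every t_i is small, phi acts as u^4/12,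
  and the t_i^4 sum to N^(4a-3) up to constants, so a = 3/4. For the power law t_i tends to a
  constant times i^(-1/(\<tau>-1)): the heaviest vertices keep slopes of order one, so phi enters
  whole and the limit is a series instead of a quartic. The obstacle in the annealed model is that
  the coefficients of the correction do not factorise over i and j, and that the limiting power law
  has no fourth moment. Griffiths' inequality, applied for fixed z, where the spins are independent
  with means of one sign, replaces these coefficients by multiples of x_ij^2. The latter do
  factorise, so the form becomes the square of a linear statistic minus a diagonal term, and both
  are controlled by the second moments of the weights alone.\<close>

definition phi :: "real \<Rightarrow> real" where
  "phi u = u\<^sup>2 / 2 - ln (cosh u)"

lemma phi_0 [simp]: "phi 0 = 0"
  by (simp add: phi_def)

lemma phi_minus [simp]: "phi (- u) = phi u"
  by (simp add: phi_def)

lemma phi_abs [simp]: "phi \<bar>u\<bar> = phi u"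
  by (simp add: abs_if)

lemma has_real_derivative_phi:
  "(phi has_real_derivative (u - tanh u)) (at u)"
  unfolding phi_def
  by (rule derivative_eq_intros refl | simp add: tanh_def)+

lemma continuous_on_phi [continuous_intros]:
  "continuous_on A g \<Longrightarrow> continuous_on A (\<lambda>x. phi (g x))"
  unfolding phi_def by (intro continuous_intros) auto

lemma borel_measurable_phi [measurable]: "phi \<in> borel_measurable borel"
  by (intro borel_measurable_continuous_onI continuous_intros)

text \<open>The Taylor bounds for tanh and the quartic ones for \<open>phi\<close> all come from
  here: both derivatives are expressed through tanh again, so each bound feeds the next.\<close>

lemma le_if_deriv_le:
  fixes f g :: "real \<Rightarrow> real"
  assumes "0 \<le> x"
    and "\<And>u. 0 \<le> u \<Longrightarrow> u \<le> x \<Longrightarrow> (f has_real_derivative f' u) (at u)"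
    and "\<And>u. 0 \<le> u \<Longrightarrow> u \<le> x \<Longrightarrow> (g has_real_derivative g' u) (at u)"
    and "\<And>u. 0 \<le> u \<Longrightarrow> u \<le> x \<Longrightarrow> f' u \<le> g' u"
    and "f 0 \<le> g 0"
  shows "f x \<le> g x"
proof -
  have "g 0 - f 0 \<le> g x - f x"
    by (rule DERIV_nonneg_imp_nondecreasing[OF assms(1)])
       (use assms in \<open>auto intro!: exI derivative_eq_intros\<close>)
  with assms(5) show ?thesis by simp
qed

lemma tanh_le_self: "0 \<le> x \<Longrightarrow> tanh x \<le> (x::real)"
  by (rule le_if_deriv_le[where f' = "\<lambda>u. 1 - (tanh u)\<^sup>2" and g' = "\<lambda>u. 1"])
     (auto intro!: derivative_eq_intros)

lemma abs_tanh_le: "\<bar>tanh x\<bar> \<le> \<bar>x::real\<bar>"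
  using tanh_le_self[of "\<bar>x\<bar>"] by simp

lemma tanh_ge_cubic:
  assumes "0 \<le> (x::real)"
  shows "x - x ^ 3 / 3 \<le> tanh x"
proof (rule le_if_deriv_le[OF assms])
  fix u :: real assume "0 \<le> u"
  then have "(tanh u)\<^sup>2 \<le> u\<^sup>2"
    using tanh_le_self[of u] by (intro power_mono) auto
  then show "1 - u\<^sup>2 \<le> 1 - (tanh u)\<^sup>2" by simp
qed (auto intro!: derivative_eq_intros)

text \<open>The cubic lower bound, inserted into tanh' = 1 - tanh^2, gives the next order. The range
  x \<le> 1 keeps the cubic minorant nonnegative, so that it can be squared; the surplus u^6/9 is
  dropped.\<close>

lemma tanh_le_quintic:
  assumes "0 \<le> (x::real)" "x \<le> 1"
  shows "tanh x \<le> x - x ^ 3 / 3 + 2 * x ^ 5 / 15"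
proof (rule le_if_deriv_le[OF assms(1)])
  fix u :: real assume u: "0 \<le> u" "u \<le> x"
  have "u * u\<^sup>2 \<le> u * 1"
    using u assms by (intro mult_left_mono) (auto simp: power_le_one)
  then have "0 \<le> u - u ^ 3 / 3"
    using u by (simp add: power3_eq_cube power2_eq_square)
  then have "(u - u ^ 3 / 3)\<^sup>2 \<le> (tanh u)\<^sup>2"
    using tanh_ge_cubic[of u] u by (intro power_mono) auto
  moreover have "(u - u ^ 3 / 3)\<^sup>2 = u\<^sup>2 - 2 * u ^ 4 / 3 + u ^ 6 / 9"
    by (simp add: power2_eq_square algebra_simps eval_nat_numeral)
  ultimately show "1 - (tanh u)\<^sup>2 \<le> 1 - u\<^sup>2 + 2 * u ^ 4 / 3"
    using zero_le_power[OF u(1), of 6] by linarith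
qed (auto intro!: derivative_eq_intros)

text \<open>For x \<ge> 0 the difference x - tanh x is at most both x^3/3 and x, hence at most x^2
  everywhere. Summed over the slopes, a quadratic bound involves only the second moment of the
  weights.\<close>

lemma abs_tanh_diff_le: "\<bar>tanh x - x\<bar> \<le> (x::real)\<^sup>2"
proof -
  have *: "\<bar>tanh y - y\<bar> \<le> y\<^sup>2" if "0 \<le> y" for y :: real
  proof -
    have "y - tanh y \<le> y\<^sup>2"
    proof (cases "y \<le> 1")
      case True
      then have "y\<^sup>2 * y \<le> y\<^sup>2 * 1" using that by (intro mult_left_mono) auto
      then have "y ^ 3 \<le> y\<^sup>2" by (simp add: power3_eq_cube power2_eq_square)
      then show ?thesis
        using tanh_ge_cubic[OF that] zero_le_power[OF that, of 2] by linarith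
    next
      case False
      then have "y * 1 \<le> y * y" by (intro mult_left_mono) auto
      moreover have "0 \<le> tanh y" using that by simp
      ultimately show ?thesis unfolding power2_eq_square by linarith
    qed
    then show ?thesis using tanh_le_self[OF that] by simp
  qed
  show ?thesis
  proof (cases "0 \<le> x")
    case False
    then show ?thesis using *[of "- x"] by (simp add: abs_minus_commute)
  qed (rule *)
qed

lemma phi_mono:
  assumes "0 \<le> u" "u \<le> v"
  shows "phi u \<le> phi v"
  by (rule DERIV_nonneg_imp_nondecreasing[OF assms(2)])
     (use assms(1) has_real_derivative_phi tanh_le_self in \<open>force intro!: exI\<close>)

lemma phi_mono_abs: "\<bar>u\<bar> \<le> \<bar>v\<bar> \<Longrightarrow> phi u \<le> phi v"
  using phi_mono[of "\<bar>u\<bar>" "\<bar>v\<bar>"] by simp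

lemma phi_nonneg [simp]: "0 \<le> phi u"
  using phi_mono_abs[of 0 u] by simp

lemma phi_le_square: "phi u \<le> u\<^sup>2 / 2"
  by (simp add: phi_def cosh_real_ge_1)

lemma phi_le_quartic: "phi u \<le> u ^ 4 / 12"
proof -
  have "phi x \<le> x ^ 4 / 12" if "0 \<le> x" for x
    by (rule le_if_deriv_le[OF that, where f' = "\<lambda>u. u - tanh u" and g' = "\<lambda>u. u ^ 3 / 3"])
       (use tanh_ge_cubic in \<open>auto intro!: has_real_derivative_phi derivative_eq_intros simp: field_simps\<close>)
  from this[of "\<bar>u\<bar>"] show ?thesis by simp
qed

text \<open>Integrates the quintic bound for tanh; 1/45 is 2/15 divided by 6.\<close>

lemma phi_ge_quartic:
  assumes "\<bar>u\<bar> \<le> 1"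
  shows "u ^ 4 / 12 - u ^ 6 / 45 \<le> phi u"
proof -
  have "x ^ 4 / 12 - x ^ 6 / 45 \<le> phi x" if "0 \<le> x" "x \<le> 1" for x :: real
    by (rule le_if_deriv_le[OF that(1), where g' = "\<lambda>u. u - tanh u" and f' = "\<lambda>u. u ^ 3 / 3 - 2 * u ^ 5 / 15"])
       (use tanh_le_quintic that in \<open>force intro!: has_real_derivative_phi derivative_eq_intros simp: field_simps\<close>)+
  from this[of "\<bar>u\<bar>"] assms show ?thesis by (simp add: power_even_abs)
qed

lemma phi_pos:
  assumes "u \<noteq> 0"
  shows "0 < phi u"
proof -
  \<comment> \<open>Capping at 1 enters the range of the quartic lower bound, where v^6 \<le> v^4
    and 1/45 < 1/12; monotonicity carries positivity outwards.\<close>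
  define v where "v = min \<bar>u\<bar> 1"
  have v: "0 < v" "v \<le> 1" "v \<le> \<bar>u\<bar>" using assms by (auto simp: v_def)
  have "v ^ 4 * v\<^sup>2 \<le> v ^ 4 * 1"
    using v by (intro mult_left_mono) (auto simp: power_le_one)
  then have "v ^ 6 \<le> v ^ 4" by (simp flip: power_add)
  moreover have "0 < v ^ 4" using v by simp
  ultimately have "0 < v ^ 4 / 12 - v ^ 6 / 45" by linarith
  also have "\<dots> \<le> phi v" using v by (intro phi_ge_quartic) auto
  also have "\<dots> \<le> phi u" using v by (intro phi_mono_abs) auto
  finally show ?thesis .
qed

lemma convex_on_phi: "convex_on UNIV phi"
proof (rule f''_ge0_imp_convex[where f' = "\<lambda>u. u - tanh u" and f'' = "\<lambda>u. (tanh u)\<^sup>2"])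
  show "((\<lambda>u. u - tanh u) has_real_derivative (tanh x)\<^sup>2) (at x)" for x :: real
    by (auto intro!: derivative_eq_intros)
qed (auto intro: has_real_derivative_phi)

text \<open>For k \<ge> 1, u is the convex combination of 0 and k u with weights 1 - 1/k and 1/k,
  and \<open>phi\<close> vanishes at 0.\<close>

lemma phi_superlinear:
  assumes "1 \<le> \<bar>c\<bar>"
  shows "\<bar>c\<bar> * phi u \<le> phi (c * u)"
proof -
  have *: "k * phi u \<le> phi (k * u)" if "1 \<le> k" for k
  proof -
    have "phi ((1 - 1 / k) *\<^sub>R 0 + (1 / k) *\<^sub>R (k * u)) \<le> (1 - 1 / k) * phi 0 + (1 / k) * phi (k * u)"
      by (rule convex_onD[OF convex_on_phi]) (use that in auto)
    then show ?thesis using that by (simp add: field_simps)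
  qed
  have "phi (\<bar>c\<bar> * u) = phi (c * u)"
    by (metis abs_mult abs_abs phi_abs)
  with *[OF assms] show ?thesis by simp
qed

subsection \<open>Independent spins\<close>

definition spin_prob :: "nat \<Rightarrow> (nat \<Rightarrow> real) \<Rightarrow> (nat \<Rightarrow> real) \<Rightarrow> real" where
  "spin_prob N m \<sigma> = (\<Prod>i=1..N. (1 + \<sigma> i * m i) / 2)"

lemma finite_configs [simp]: "finite (configs N)"
  by (auto simp: configs_def intro!: finite_PiE)

lemma configs_nonempty [simp]: "configs N \<noteq> {}"
  by (auto simp: configs_def PiE_eq_empty_iff)

lemma configs_cases: "\<sigma> \<in> configs N \<Longrightarrow> i \<in> {1..N} \<Longrightarrow> \<sigma> i = -1 \<or> \<sigma> i = 1"
  by (auto simp: configs_def PiE_iff)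

lemma configs_square [simp]: "\<sigma> \<in> configs N \<Longrightarrow> i \<in> {1..N} \<Longrightarrow> \<sigma> i * \<sigma> i = 1"
  using configs_cases by fastforce

lemma sum_configs_prod:
  fixes g :: "nat \<Rightarrow> real \<Rightarrow> real"
  shows "(\<Sum>\<sigma>\<in>configs N. \<Prod>i=1..N. g i (\<sigma> i)) = (\<Prod>i=1..N. g i (-1) + g i 1)"
  unfolding configs_def by (subst prod_sum_PiE[symmetric]) auto

lemma spin_prob_nonneg:
  assumes "\<sigma> \<in> configs N" "\<And>i. i \<in> {1..N} \<Longrightarrow> \<bar>m i\<bar> \<le> 1"
  shows "0 \<le> spin_prob N m \<sigma>"
  unfolding spin_prob_def
proof (rule prod_nonneg)
  fix i assume i: "i \<in> {1..N}"
  show "0 \<le> (1 + \<sigma> i * m i) / 2"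
    using configs_cases[OF assms(1) i] assms(2)[OF i] by auto
qed

text \<open>Padding the product over \<open>A\<close> by factors 1 lets the sum over configurations
  factorise over the vertices: those outside \<open>A\<close> contribute 1, those inside their
  mean.\<close>

lemma spin_prob_moment:
  assumes "A \<subseteq> {1..N}"
  shows "(\<Sum>\<sigma>\<in>configs N. spin_prob N m \<sigma> * (\<Prod>i\<in>A. \<sigma> i)) = (\<Prod>i\<in>A. m i)"
proof -
  have *: "(\<Prod>i\<in>A. h i) = (\<Prod>i=1..N. if i \<in> A then h i else 1)" for h :: "nat \<Rightarrow> real"
    using assms by (simp add: prod.If_cases Int_absorb1)
  have "(\<Sum>\<sigma>\<in>configs N. spin_prob N m \<sigma> * (\<Prod>i\<in>A. \<sigma> i)) =
      (\<Sum>\<sigma>\<in>configs N. \<Prod>i=1..N. (1 + \<sigma> i * m i) / 2 * (if i \<in> A then \<sigma> i else 1))"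
    unfolding spin_prob_def * prod.distrib[symmetric] ..
  also have "\<dots> = (\<Prod>i=1..N. (1 + - 1 * m i) / 2 * (if i \<in> A then - 1 else 1) +
      (1 + 1 * m i) / 2 * (if i \<in> A then 1 else 1))"
    by (rule sum_configs_prod[where g = "\<lambda>i s. (1 + s * m i) / 2 * (if i \<in> A then s else 1)"])
  also have "\<dots> = (\<Prod>i\<in>A. m i)"
    unfolding * by (intro prod.cong) (auto simp: field_simps)
  finally show ?thesis .
qed

lemma sum_spin_prob [simp]: "(\<Sum>\<sigma>\<in>configs N. spin_prob N m \<sigma>) = 1"
  using spin_prob_moment[of "{}" N m] by simp

lemma spin_prob_mean:
  "i \<in> {1..N} \<Longrightarrow> (\<Sum>\<sigma>\<in>configs N. spin_prob N m \<sigma> * \<sigma> i) = m i"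
  using spin_prob_moment[of "{i}" N m] by simp

lemma spin_prob_pair:
  "i \<in> {1..N} \<Longrightarrow> j \<in> {1..N} \<Longrightarrow> (\<Sum>\<sigma>\<in>configs N. spin_prob N m \<sigma> * (\<sigma> i * \<sigma> j)) =
    (if i = j then 1 else m i * m j)"
  using spin_prob_moment[of "{i, j}" N m] by auto

text \<open>Squared bias plus variance of a linear statistic. The coefficients stay free because two
  choices are needed: 1/N^a for the spin sum, and w_i^2 over the total weight for the annealed
  correction.\<close>

lemma spin_prob_second_moment:
  "(\<Sum>\<sigma>\<in>configs N. spin_prob N m \<sigma> * ((\<Sum>i=1..N. b i * \<sigma> i) - c)\<^sup>2) =
    ((\<Sum>i=1..N. b i * m i) - c)\<^sup>2 + (\<Sum>i=1..N. (b i)\<^sup>2 * (1 - (m i)\<^sup>2))"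
proof -
  let ?E = "\<lambda>h. \<Sum>\<sigma>\<in>configs N. spin_prob N m \<sigma> * h \<sigma>"
  have 1: "?E (\<lambda>\<sigma>. \<Sum>i=1..N. b i * \<sigma> i) = (\<Sum>i=1..N. b i * m i)"
  proof -
    have "?E (\<lambda>\<sigma>. \<Sum>i=1..N. b i * \<sigma> i) = (\<Sum>i=1..N. \<Sum>\<sigma>\<in>configs N. b i * (spin_prob N m \<sigma> * \<sigma> i))"
      unfolding sum_distrib_left by (subst sum.swap) (simp add: mult_ac)
    also have "\<dots> = (\<Sum>i=1..N. b i * m i)"
      by (intro sum.cong) (auto simp: spin_prob_mean simp flip: sum_distrib_left)
    finally show ?thesis .
  qed
  have 2: "?E (\<lambda>\<sigma>. (\<Sum>i=1..N. b i * \<sigma> i)\<^sup>2) =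
      (\<Sum>i=1..N. b i * m i)\<^sup>2 + (\<Sum>i=1..N. (b i)\<^sup>2 * (1 - (m i)\<^sup>2))"
  proof -
    have "?E (\<lambda>\<sigma>. (\<Sum>i=1..N. b i * \<sigma> i)\<^sup>2) =
        (\<Sum>\<sigma>\<in>configs N. \<Sum>i=1..N. \<Sum>j=1..N. b i * b j * (spin_prob N m \<sigma> * (\<sigma> i * \<sigma> j)))"
      by (simp add: power2_eq_square sum_product sum_distrib_left mult_ac)
    also have "\<dots> = (\<Sum>i=1..N. \<Sum>j=1..N. \<Sum>\<sigma>\<in>configs N. b i * b j * (spin_prob N m \<sigma> * (\<sigma> i * \<sigma> j)))"
      by (subst sum.swap, intro sum.cong refl, rule sum.swap)
    also have "\<dots> = (\<Sum>i=1..N. \<Sum>j=1..N. b i * m i * (b j * m j) +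
        (if i = j then (b i)\<^sup>2 * (1 - (m i)\<^sup>2) else 0))"
      by (intro sum.cong refl, simp only: sum_distrib_left[symmetric] spin_prob_pair)
         (simp add: power2_eq_square algebra_simps)
    also have "\<dots> = (\<Sum>i=1..N. b i * m i)\<^sup>2 + (\<Sum>i=1..N. (b i)\<^sup>2 * (1 - (m i)\<^sup>2))"
      unfolding sum.distrib power2_eq_square[of "\<Sum>i=1..N. b i * m i"] sum_product
      by (simp add: sum.delta)
    finally show ?thesis .
  qed
  have "?E (\<lambda>\<sigma>. ((\<Sum>i=1..N. b i * \<sigma> i) - c)\<^sup>2) =
      ?E (\<lambda>\<sigma>. (\<Sum>i=1..N. b i * \<sigma> i)\<^sup>2) - 2 * c * ?E (\<lambda>\<sigma>. \<Sum>i=1..N. b i * \<sigma> i) + c\<^sup>2 * ?E (\<lambda>\<sigma>. 1)"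
    by (simp add: power2_diff algebra_simps sum.distrib sum_subtractf sum_distrib_left
        del: sum_spin_prob)
  also have "\<dots> = ((\<Sum>i=1..N. b i * m i) - c)\<^sup>2 + (\<Sum>i=1..N. (b i)\<^sup>2 * (1 - (m i)\<^sup>2))"
    unfolding 1 2 by (simp add: power2_diff)
  finally show ?thesis .
qed

text \<open>The instance of Griffiths' inequality for two edges: after cancelling common
  vertices the correlation is a product of an even number of means of equal sign.\<close>
lemma spin_prob_griffiths:
  assumes m: "\<And>i j. i \<in> {1..N} \<Longrightarrow> j \<in> {1..N} \<Longrightarrow> 0 \<le> m i * m j"
    and "i \<in> {1..N}" "j \<in> {1..N}" "k \<in> {1..N}" "l \<in> {1..N}" "i \<noteq> j" "k \<noteq> l"
  shows "0 \<le> (\<Sum>\<sigma>\<in>configs N. spin_prob N m \<sigma> * (\<sigma> i * \<sigma> j * (\<sigma> k * \<sigma> l)))"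
proof -
  have pair: "0 \<le> (\<Sum>\<sigma>\<in>configs N. spin_prob N m \<sigma> * (\<sigma> a * \<sigma> b))"
    if "a \<in> {1..N}" "b \<in> {1..N}" for a b
    using spin_prob_pair[OF that, of m] m[OF that] by simp
  have cancel: "0 \<le> (\<Sum>\<sigma>\<in>configs N. spin_prob N m \<sigma> * h \<sigma>)"
    if "a \<in> {1..N}" "b \<in> {1..N}" "c \<in> {1..N}" "\<And>\<sigma>. h \<sigma> = \<sigma> c * \<sigma> c * (\<sigma> a * \<sigma> b)" for a b c h
    using pair[of a b] that by simp
  consider "i = k" | "i = l" | "j = k" | "j = l" | "card {i, j, k, l} = 4"
    using assms by (cases "i = k \<or> i = l \<or> j = k \<or> j = l") auto
  then show ?thesis
  proof cases
    case 5
    then have *: "i \<notin> {j, k, l}" "j \<notin> {k, l}" "k \<noteq> l"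
      by (auto simp: card_insert_if split: if_splits)
    have "(\<Sum>\<sigma>\<in>configs N. spin_prob N m \<sigma> * (\<sigma> i * \<sigma> j * (\<sigma> k * \<sigma> l))) = m i * m j * (m k * m l)"
      using spin_prob_moment[of "{i, j, k, l}" N m] assms * by (simp add: mult_ac)
    then show ?thesis using m assms(2-5) by simp
  qed (rule cancel[of j l i] cancel[of j k i] cancel[of i l j] cancel[of i k j];
       use assms in \<open>auto simp: mult_ac\<close>)+
qed

subsection \<open>The Hubbard-Stratonovich transform\<close>

text \<open>Completing the square: up to the constant, the integrand is the normal density of mean
  A/s and variance 1/s.\<close>

lemma has_bochner_integral_gaussian_linear:
  fixes s A :: real
  assumes "0 < s"
  shows "has_bochner_integral lborel (\<lambda>z. exp (- (s * z\<^sup>2 / 2) + z * A))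
    (sqrt (2 * pi / s) * exp (A\<^sup>2 / (2 * s)))"
proof -
  have "has_bochner_integral lborel (normal_density (A / s) (1 / sqrt s)) 1"
    using integrable_normal_density[of "1 / sqrt s" "A / s"] integral_normal_density[of "1 / sqrt s" "A / s"]
      assms by (simp add: has_bochner_integral_iff)
  from has_bochner_integral_mult_right[OF this, of "sqrt (2 * pi / s) * exp (A\<^sup>2 / (2 * s))"]
  show ?thesis
  proof (rule has_bochner_integral_cong[THEN iffD1, rotated -1])
    fix z :: real
    have "A\<^sup>2 / (2 * s) + - (z - A / s)\<^sup>2 / (2 * (1 / sqrt s)\<^sup>2) = - (s * z\<^sup>2 / 2) + z * A"
      using assms by (simp add: field_simps power2_eq_square)
    then have "exp (A\<^sup>2 / (2 * s)) * exp (- (z - A / s)\<^sup>2 / (2 * (1 / sqrt s)\<^sup>2)) =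
        exp (- (s * z\<^sup>2 / 2) + z * A)"
      by (simp only: exp_add[symmetric])
    then show "sqrt (2 * pi / s) * exp (A\<^sup>2 / (2 * s)) * normal_density (A / s) (1 / sqrt s) z =
        exp (- (s * z\<^sup>2 / 2) + z * A)"
      using assms by (simp add: normal_density_def power_divide)
  qed simp_all
qed

lemma exp_mult_spin:
  assumes "s = -1 \<or> s = (1::real)"
  shows "exp (x * s) = cosh x * (1 + s * tanh x)"
  using assms cosh_plus_sinh[of x] cosh_minus_sinh[of x]
  by (auto simp: tanh_def distrib_left right_diff_distrib)

text \<open>Factor by factor, exp (t_i z \<sigma>_i) is 2 cosh (t_i z) times the probability of
  \<sigma>_i for a spin of mean tanh (t_i z). The factors 2 give \<open>2 ^ N\<close>, and ln cosh
  merges with the Gaussian exponent into - phi.\<close>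

lemma exp_spin_sum_eq:
  assumes "\<sigma> \<in> configs N"
  shows "exp (- ((\<Sum>i=1..N. (t i)\<^sup>2) * z\<^sup>2 / 2) + z * (\<Sum>i=1..N. t i * \<sigma> i)) =
    2 ^ N * exp (- (\<Sum>i=1..N. phi (t i * z))) * spin_prob N (\<lambda>i. tanh (t i * z)) \<sigma>"
proof -
  have "exp (- ((\<Sum>i=1..N. (t i)\<^sup>2) * z\<^sup>2 / 2) + z * (\<Sum>i=1..N. t i * \<sigma> i)) =
      (\<Prod>i=1..N. exp (- ((t i * z)\<^sup>2 / 2) + t i * z * \<sigma> i))"
    by (simp add: exp_sum[symmetric] sum.distrib sum_negf sum_distrib_left sum_distrib_right
        sum_divide_distrib power_mult_distrib sum_subtractf mult_ac)
  also have "\<dots> = (\<Prod>i=1..N. 2 * (exp (- phi (t i * z)) * ((1 + \<sigma> i * tanh (t i * z)) / 2)))"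
  proof (intro prod.cong refl)
    fix i assume "i \<in> {1..N}"
    then have "exp (t i * z * \<sigma> i) = exp (ln (cosh (t i * z))) * (1 + \<sigma> i * tanh (t i * z))"
      using exp_mult_spin[OF configs_cases[OF assms]] by simp
    moreover have "exp (- phi (t i * z)) = exp (- ((t i * z)\<^sup>2 / 2)) * exp (ln (cosh (t i * z)))"
      by (simp only: exp_add[symmetric]) (simp add: phi_def)
    ultimately show "exp (- ((t i * z)\<^sup>2 / 2) + t i * z * \<sigma> i) =
        2 * (exp (- phi (t i * z)) * ((1 + \<sigma> i * tanh (t i * z)) / 2))"
      by (simp only: exp_add)
  qed
  also have "\<dots> = 2 ^ N * exp (- (\<Sum>i=1..N. phi (t i * z))) * spin_prob N (\<lambda>i. tanh (t i * z)) \<sigma>"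
    by (simp only: prod.distrib prod_constant spin_prob_def exp_sum[symmetric] sum_negf)
       (simp add: exp_sum[symmetric] sum_negf)
  finally show ?thesis .
qed

text \<open>The Gaussian factor cancels the quadratic part of \<open>\<Sum>ln (cosh (t\<^sub>i z))\<close>, so the mixing
  density is governed by \<open>phi\<close>, which vanishes to fourth order.\<close>
lemma has_bochner_integral_spin_mixture:
  fixes h :: "(nat \<Rightarrow> real) \<Rightarrow> 'a::{banach, second_countable_topology}"
  assumes "0 < (\<Sum>i=1..N. (t i)\<^sup>2)" (is "0 < ?s")
  shows "has_bochner_integral lborel
    (\<lambda>z. exp (- (\<Sum>i=1..N. phi (t i * z))) *\<^sub>R (\<Sum>\<sigma>\<in>configs N. spin_prob N (\<lambda>i. tanh (t i * z)) \<sigma> *\<^sub>R h \<sigma>))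
    ((sqrt (2 * pi / ?s) / 2 ^ N) *\<^sub>R (\<Sum>\<sigma>\<in>configs N. exp ((\<Sum>i=1..N. t i * \<sigma> i)\<^sup>2 / (2 * ?s)) *\<^sub>R h \<sigma>))"
proof -
  have *: "has_bochner_integral lborel
      (\<lambda>z. \<Sum>\<sigma>\<in>configs N. (exp (- (?s * z\<^sup>2 / 2) + z * (\<Sum>i=1..N. t i * \<sigma> i)) / 2 ^ N) *\<^sub>R h \<sigma>)
      (\<Sum>\<sigma>\<in>configs N. ((sqrt (2 * pi / ?s) * exp ((\<Sum>i=1..N. t i * \<sigma> i)\<^sup>2 / (2 * ?s))) / 2 ^ N) *\<^sub>R h \<sigma>)"
    by (intro has_bochner_integral_sum has_bochner_integral_scaleR_left
          has_bochner_integral_divide has_bochner_integral_gaussian_linear assms)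
  have eq: "(exp (- (?s * z\<^sup>2 / 2) + z * (\<Sum>i=1..N. t i * \<sigma> i)) / 2 ^ N) *\<^sub>R h \<sigma> =
      exp (- (\<Sum>i=1..N. phi (t i * z))) *\<^sub>R (spin_prob N (\<lambda>i. tanh (t i * z)) \<sigma> *\<^sub>R h \<sigma>)"
    if "\<sigma> \<in> configs N" for \<sigma> z
    unfolding exp_spin_sum_eq[OF that] by simp
  have "(\<Sum>\<sigma>\<in>configs N. (exp (- (?s * z\<^sup>2 / 2) + z * (\<Sum>i=1..N. t i * \<sigma> i)) / 2 ^ N) *\<^sub>R h \<sigma>) =
      exp (- (\<Sum>i=1..N. phi (t i * z))) *\<^sub>R (\<Sum>\<sigma>\<in>configs N. spin_prob N (\<lambda>i. tanh (t i * z)) \<sigma> *\<^sub>R h \<sigma>)" for z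
    unfolding scaleR_sum_right by (intro sum.cong refl eq)
  with * show ?thesis
    by (simp add: scaleR_sum_right)
qed

subsection \<open>Consequences of weight regularity\<close>

lemma weight_law_average_tendsto:
  fixes g :: "real \<Rightarrow> real"
  assumes "real_distribution \<mu>" "weak_conv_m (weight_law w) \<mu>"
    and g: "continuous_on UNIV g" "\<And>x. \<bar>g x\<bar> \<le> B"
  shows "(\<lambda>N. (\<Sum>i=1..N. g (w N i)) / real N) \<longlonglongrightarrow> (\<integral>x. g x \<partial>\<mu>)"
proof -
  \<comment> \<open>\<open>weight_law\<close> carries the discrete sigma-algebra of a pmf. Its image
    on \<open>borel\<close> is a real distribution with the same cdf, to which the convergence of
    bounded continuous integrals applies.\<close>
  define L where "L N = distr (weight_law w N) borel (\<lambda>x. x)" for N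
  have L: "real_distribution (L N)" for N
    unfolding L_def weight_law_def
    by (intro prob_space.real_distribution_distr measure_pmf.prob_space_axioms) auto
  have "cdf (L N) = cdf (weight_law w N)" for N
    by (auto simp: L_def cdf_def weight_law_def measure_distr fun_eq_iff)
  then have "weak_conv_m L \<mu>"
    using assms(2) by (simp add: weak_conv_m_def)
  then have "(\<lambda>N. \<integral>x. g x \<partial>L N) \<longlonglongrightarrow> (\<integral>x. g x \<partial>\<mu>)"
    using g by (intro weak_conv_imp_integral_bdd_continuous_conv[OF L assms(1)])
      (auto simp: continuous_on_eq_continuous_at)
  moreover have "eventually (\<lambda>N. (\<integral>x. g x \<partial>L N) = (\<Sum>i=1..N. g (w N i)) / real N) sequentially"
    using eventually_gt_at_top[of 0]
  proof eventually_elim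
    case (elim N)
    have [measurable]: "g \<in> borel_measurable borel"
      using g by (intro borel_measurable_continuous_onI)
    have "(\<integral>x. g x \<partial>L N) = (\<integral>x. g x \<partial>weight_law w N)"
      unfolding L_def weight_law_def by (subst integral_distr) auto
    also have "\<dots> = (\<Sum>i=1..N. g (w N i)) / real N"
      unfolding weight_law_def using elim by (subst integral_map_pmf, subst integral_pmf_of_set) auto
    finally show ?case .
  qed
  ultimately show ?thesis
    by (rule Lim_transform_eventually)
qed

text \<open>Dominated by x^k itself, as k is even. Truncating |x| avoids having to show that \<mu>
  lives on the nonnegative half-line.\<close>

lemma truncated_moment_tendsto:
  assumes "real_distribution \<mu>" "integrable \<mu> (\<lambda>x. x ^ k)" "even k"
  shows "(\<lambda>n. \<integral>x. (min \<bar>x\<bar> (real n)) ^ k \<partial>\<mu>) \<longlonglongrightarrow> (\<integral>x. x ^ k \<partial>\<mu>)"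
proof -
  interpret real_distribution \<mu> by fact
  show ?thesis
  proof (rule integral_dominated_convergence[where w = "\<lambda>x. x ^ k"])
    show "AE x in \<mu>. (\<lambda>n. min \<bar>x\<bar> (real n) ^ k) \<longlonglongrightarrow> x ^ k"
    proof (intro AE_I2)
      fix x :: real
      have "eventually (\<lambda>n. x ^ k = min \<bar>x\<bar> (real n) ^ k) sequentially"
        using eventually_ge_at_top[of "nat \<lceil>\<bar>x\<bar>\<rceil>"]
      proof eventually_elim
        case (elim n)
        then have "\<bar>x\<bar> \<le> real n" by linarith
        then show ?case using assms(3) by (simp add: power_even_abs)
      qed
      then show "(\<lambda>n. min \<bar>x\<bar> (real n) ^ k) \<longlonglongrightarrow> x ^ k"
        by (rule Lim_transform_eventually[rotated]) simp
    qed
    show "AE x in \<mu>. norm (min \<bar>x\<bar> (real n) ^ k) \<le> x ^ k" for n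
    proof (intro AE_I2)
      fix x :: real
      have "min \<bar>x\<bar> (real n) ^ k \<le> \<bar>x\<bar> ^ k" by (intro power_mono) auto
      then show "norm (min \<bar>x\<bar> (real n) ^ k) \<le> x ^ k"
        using assms(3) by (simp add: power_even_abs)
    qed
  qed (use assms in auto)
qed

text \<open>The excess of one vertex over the truncation is at most the total excess. With uniform
  integrability this makes the largest squared weight o(N).\<close>

lemma square_le_of_tail:
  fixes w :: "nat \<Rightarrow> nat \<Rightarrow> real"
  assumes "\<And>i. i \<in> {1..N} \<Longrightarrow> 0 < w N i" "0 \<le> K" "i \<in> {1..N}"
  shows "(w N i)\<^sup>2 \<le> (\<Sum>i=1..N. (w N i)\<^sup>2 - (min (w N i) K)\<^sup>2) + K\<^sup>2"
proof -
  have "0 \<le> (w N j)\<^sup>2 - (min (w N j) K)\<^sup>2" if "j \<in> {1..N}" for j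
    using assms(1)[OF that] assms(2) power_mono[of "min (w N j) K" "w N j" 2] by simp
  then have "(w N i)\<^sup>2 - (min (w N i) K)\<^sup>2 \<le> (\<Sum>i=1..N. (w N i)\<^sup>2 - (min (w N i) K)\<^sup>2)"
    using assms(3) by (intro member_le_sum) auto
  moreover have "(min (w N i) K)\<^sup>2 \<le> K\<^sup>2"
    using assms(1)[OF assms(3)] assms(2) by (intro power_mono) auto
  ultimately show ?thesis by linarith
qed

context
  fixes w :: "nat \<Rightarrow> nat \<Rightarrow> real" and \<mu> :: "real measure"
  assumes pos: "\<And>N i. i \<in> {1..N} \<Longrightarrow> 0 < w N i"
    and reg: "weight_regular w \<mu>"
begin

lemma truncated_average_tendsto:
  assumes "0 \<le> K"
  shows "(\<lambda>N. (\<Sum>i=1..N. min (w N i) K ^ k) / real N) \<longlonglongrightarrow> (\<integral>x. min \<bar>x\<bar> K ^ k \<partial>\<mu>)"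
proof -
  have "(\<lambda>N. (\<Sum>i=1..N. min \<bar>w N i\<bar> K ^ k) / real N) \<longlonglongrightarrow> (\<integral>x. min \<bar>x\<bar> K ^ k \<partial>\<mu>)"
    using reg assms unfolding weight_regular_def
    by (intro weight_law_average_tendsto[where B = "K ^ k"])
       (auto intro!: continuous_intros power_mono simp: power_abs)
  moreover have "(\<Sum>i=1..N. min \<bar>w N i\<bar> K ^ k) = (\<Sum>i=1..N. min (w N i) K ^ k)" for N
    using pos by (intro sum.cong) (auto simp: less_imp_le)
  ultimately show ?thesis by simp
qed

text \<open>Uniform integrability of the squared weights. K is chosen for the limit law; the
  truncated averages converge weakly and the full ones by regularity, so their difference inherits
  the bound.\<close>

lemma second_moment_tail:
  assumes "0 < \<epsilon>"
  obtains K where "0 \<le> K"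
    "eventually (\<lambda>N. (\<Sum>i=1..N. (w N i)\<^sup>2 - (min (w N i) K)\<^sup>2) / real N < \<epsilon>) sequentially"
proof -
  have "(\<lambda>n. \<integral>x. (min \<bar>x\<bar> (real n))\<^sup>2 \<partial>\<mu>) \<longlonglongrightarrow> (\<integral>x. x\<^sup>2 \<partial>\<mu>)"
    using reg unfolding weight_regular_def by (intro truncated_moment_tendsto) auto
  then have "eventually (\<lambda>n. (\<integral>x. x\<^sup>2 \<partial>\<mu>) - \<epsilon> < (\<integral>x. (min \<bar>x\<bar> (real n))\<^sup>2 \<partial>\<mu>)) sequentially"
    by (rule order_tendstoD) (use assms in simp)
  from eventually_happens'[OF sequentially_bot this]
  obtain n where n: "(\<integral>x. x\<^sup>2 \<partial>\<mu>) - (\<integral>x. (min \<bar>x\<bar> (real n))\<^sup>2 \<partial>\<mu>) < \<epsilon>"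
    by (auto simp: algebra_simps)
  have "(\<lambda>N. moment w N 2 - (\<Sum>i=1..N. (min (w N i) (real n))\<^sup>2) / real N)
      \<longlonglongrightarrow> (\<integral>x. x\<^sup>2 \<partial>\<mu>) - (\<integral>x. (min \<bar>x\<bar> (real n))\<^sup>2 \<partial>\<mu>)"
    using reg unfolding weight_regular_def
    by (intro tendsto_diff truncated_average_tendsto) auto
  then have "eventually (\<lambda>N. moment w N 2 - (\<Sum>i=1..N. (min (w N i) (real n))\<^sup>2) / real N < \<epsilon>) sequentially"
    using n by (rule order_tendstoD)
  then show ?thesis
    by (intro that[of "real n"]) (auto simp: moment_def sum_subtractf diff_divide_distrib)
qed

text \<open>Weak convergence alone does not control the mean; the second moments bound the
  truncation error, since |x - g x| \<le> x^2/K for the truncation g to [-K, K].\<close>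

lemma first_moment_tendsto: "(\<lambda>N. moment w N 1) \<longlonglongrightarrow> (\<integral>x. x \<partial>\<mu>)"
proof (rule LIMSEQ_I)
  fix \<epsilon> :: real assume "0 < \<epsilon>"
  interpret real_distribution \<mu> using reg by (simp add: weight_regular_def)
  have int2: "integrable \<mu> (\<lambda>x. x\<^sup>2)"
    and m2: "(\<lambda>N. moment w N 2) \<longlonglongrightarrow> (\<integral>x. x\<^sup>2 \<partial>\<mu>)"
    and weak: "weak_conv_m (weight_law w) \<mu>"
    and "0 < (\<integral>x. x \<partial>\<mu>)"
    using reg by (auto simp: weight_regular_def)
  \<comment> \<open>A non-integrable function has Bochner integral 0 by convention, so a positive
    mean entails integrability.\<close>
  then have int1: "integrable \<mu> (\<lambda>x. x)"
    using not_integrable_integral_eq by force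
  define S where "S = (\<integral>x. x\<^sup>2 \<partial>\<mu>) + 1"
  have "0 < S" unfolding S_def by (intro add_nonneg_pos integral_nonneg_AE) auto
  \<comment> \<open>Three errors of size S/K will arise: truncation under \<mu>, weak convergence,
    and truncation of the empirical mean. They add up to 3\<epsilon>/4.\<close>
  define K where "K = 4 * S / \<epsilon>"
  have "0 < K" using \<open>0 < S\<close> \<open>0 < \<epsilon>\<close> by (simp add: K_def)
  define g where "g x = max (- K) (min x K)" for x
  have g: "\<bar>g x\<bar> \<le> K" "\<bar>x - g x\<bar> \<le> x\<^sup>2 / K" for x
  proof -
    show "\<bar>g x\<bar> \<le> K" using \<open>0 < K\<close> by (auto simp: g_def)
    have "K * \<bar>x - g x\<bar> \<le> x\<^sup>2"
    proof (cases "\<bar>x\<bar> \<le> K")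
      case True
      then show ?thesis by (auto simp: g_def)
    next
      case False
      then have "\<bar>x - g x\<bar> \<le> \<bar>x\<bar>" using \<open>0 < K\<close> by (auto simp: g_def)
      then have "K * \<bar>x - g x\<bar> \<le> \<bar>x\<bar> * \<bar>x\<bar>"
        using False \<open>0 < K\<close> by (intro mult_mono) auto
      then show ?thesis by (simp add: power2_eq_square)
    qed
    then show "\<bar>x - g x\<bar> \<le> x\<^sup>2 / K" using \<open>0 < K\<close> by (simp add: field_simps)
  qed
  have cont: "continuous_on UNIV g" unfolding g_def by (intro continuous_intros)
  then have [measurable]: "g \<in> borel_measurable borel" by (rule borel_measurable_continuous_onI)
  have intg: "integrable \<mu> g"
    by (rule integrable_const_bound[where B = K]) (auto simp: g)
  have "\<bar>(\<integral>x. x \<partial>\<mu>) - (\<integral>x. g x \<partial>\<mu>)\<bar> = \<bar>\<integral>x. x - g x \<partial>\<mu>\<bar>"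
    using int1 intg by simp
  also have "\<dots> \<le> (\<integral>x. \<bar>x - g x\<bar> \<partial>\<mu>)" by (rule integral_abs_bound)
  also have "\<dots> \<le> (\<integral>x. x\<^sup>2 / K \<partial>\<mu>)"
    using int1 intg int2 g by (intro integral_mono) auto
  also have "\<dots> \<le> S / K" using \<open>0 < K\<close> by (simp add: S_def field_simps)
  finally have 1: "\<bar>(\<integral>x. x \<partial>\<mu>) - (\<integral>x. g x \<partial>\<mu>)\<bar> \<le> S / K" .
  have "(\<lambda>N. (\<Sum>i=1..N. g (w N i)) / real N) \<longlonglongrightarrow> (\<integral>x. g x \<partial>\<mu>)"
    using weak by (intro weight_law_average_tendsto[where B = K] cont g) unfold_locales
  then have "eventually (\<lambda>N. \<bar>(\<Sum>i=1..N. g (w N i)) / real N - (\<integral>x. g x \<partial>\<mu>)\<bar> < S / K) sequentially"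
    using \<open>0 < S\<close> \<open>0 < K\<close> by (auto simp: tendsto_iff dist_real_def)
  moreover have "eventually (\<lambda>N. moment w N 2 < S) sequentially"
    using m2 by (rule order_tendstoD) (simp add: S_def)
  ultimately have "eventually (\<lambda>N. norm (moment w N 1 - (\<integral>x. x \<partial>\<mu>)) < \<epsilon>) sequentially"
  proof eventually_elim
    case (elim N)
    have "\<bar>moment w N 1 - (\<Sum>i=1..N. g (w N i)) / real N\<bar> = \<bar>\<Sum>i=1..N. w N i - g (w N i)\<bar> / real N"
      by (simp add: moment_def sum_subtractf flip: diff_divide_distrib)
    also have "\<dots> \<le> (\<Sum>i=1..N. (w N i)\<^sup>2 / K) / real N"
      by (intro divide_right_mono order.trans[OF sum_abs] sum_mono g) auto
    also have "\<dots> = moment w N 2 / K" by (simp add: moment_def sum_divide_distrib mult_ac)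
    also have "\<dots> < S / K" using elim \<open>0 < K\<close> by (simp add: divide_strict_right_mono)
    finally have "\<bar>moment w N 1 - (\<integral>x. x \<partial>\<mu>)\<bar> < S / K + S / K + S / K"
      using elim 1 by linarith
    also have "\<dots> \<le> \<epsilon>" using \<open>0 < S\<close> \<open>0 < \<epsilon>\<close> by (simp add: K_def field_simps)
    finally show ?case by simp
  qed
  then show "\<exists>N0. \<forall>N\<ge>N0. norm (moment w N 1 - (\<integral>x. x \<partial>\<mu>)) < \<epsilon>"
    by (simp add: eventually_sequentially)
qed

end

subsection \<open>The critical rank-1 Curie-Weiss model as a mixture\<close>

text \<open>Nonnegativity of the variance of |X|.\<close>

lemma sum_abs_le_sqrt_sum_square:
  fixes p X :: "'a \<Rightarrow> real"
  assumes "\<And>x. x \<in> A \<Longrightarrow> 0 \<le> p x" "(\<Sum>x\<in>A. p x) = 1"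
  shows "(\<Sum>x\<in>A. p x * \<bar>X x\<bar>) \<le> sqrt (\<Sum>x\<in>A. p x * (X x)\<^sup>2)"
proof (rule real_le_rsqrt)
  define c where "c = (\<Sum>x\<in>A. p x * \<bar>X x\<bar>)"
  have "0 \<le> (\<Sum>x\<in>A. p x * (\<bar>X x\<bar> - c)\<^sup>2)"
    using assms(1) by (intro sum_nonneg) auto
  also have "\<dots> = (\<Sum>x\<in>A. p x * (X x)\<^sup>2) - 2 * c * (\<Sum>x\<in>A. p x * \<bar>X x\<bar>) + c\<^sup>2 * (\<Sum>x\<in>A. p x)"
    by (simp add: power2_diff algebra_simps sum.distrib sum_subtractf sum_distrib_left sum_distrib_right)
  also have "\<dots> = (\<Sum>x\<in>A. p x * (X x)\<^sup>2) - c\<^sup>2"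
    using assms(2) by (simp add: c_def[symmetric] power2_eq_square)
  finally show "(\<Sum>x\<in>A. p x * \<bar>X x\<bar>)\<^sup>2 \<le> (\<Sum>x\<in>A. p x * (X x)\<^sup>2)"
    by (simp add: c_def)
qed

lemma integrable_exp_minus_abs:
  fixes c :: real
  assumes "0 < c"
  shows "integrable lborel (\<lambda>z. exp (- (c * \<bar>z\<bar>)))"
proof -
  \<comment> \<open>This makes k (1 + z^2) \<le> 1 + c^2 z^2 / 2, which the quadratic Taylor bound
    compares with exp (c |z|); the majorant is then a multiple of 1/(1 + z^2).\<close>
  define k where "k = min 1 (c\<^sup>2 / 2)"
  have "0 < k" using assms by (simp add: k_def)
  have "set_integrable lborel UNIV (\<lambda>x::real. inverse (1 + x\<^sup>2))"
    using integrable_inverse_1_plus_square by simp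
  then have "integrable lborel (\<lambda>x::real. inverse (1 + x\<^sup>2) / k)"
    by (simp add: set_integrable_def)
  then show ?thesis
  proof (rule Bochner_Integration.integrable_bound, goal_cases)
    case 2
    show ?case
    proof (intro AE_I2)
      fix z :: real
      have "k * (1 + z\<^sup>2) \<le> 1 + c\<^sup>2 / 2 * z\<^sup>2"
        unfolding distrib_left by (intro add_mono mult_right_mono) (auto simp: k_def)
      also have "\<dots> \<le> 1 + c * \<bar>z\<bar> + (c * \<bar>z\<bar>)\<^sup>2 / 2"
        using assms by (simp add: power_mult_distrib)
      also have "\<dots> \<le> exp (c * \<bar>z\<bar>)"
        using assms by (intro exp_lower_Taylor_quadratic) auto
      finally have "inverse (exp (c * \<bar>z\<bar>)) \<le> inverse (k * (1 + z\<^sup>2))"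
        using \<open>0 < k\<close> by (intro le_imp_inverse_le) (auto intro!: mult_pos_pos add_pos_nonneg)
      then show "norm (exp (- (c * \<bar>z\<bar>))) \<le> norm (inverse (1 + z\<^sup>2) / k)"
        using \<open>0 < k\<close> by (simp add: exp_minus field_simps)
    qed
  qed simp
qed

lemma integral_exp_pos:
  fixes g :: "real \<Rightarrow> real"
  assumes "integrable lborel (\<lambda>x. exp (g x))"
  shows "0 < (\<integral>x. exp (g x) \<partial>lborel)"
proof -
  have "(\<integral>x. exp (g x) \<partial>lborel) \<noteq> 0"
  proof
    assume "(\<integral>x. exp (g x) \<partial>lborel) = 0"
    then have "AE x in lborel. exp (g x) = 0"
      using assms by (subst integral_nonneg_eq_0_iff_AE[symmetric]) auto
    then have "AE x::real in lborel. False" by simp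
    then show False by (simp add: AE_iff_measurable[where N = UNIV])
  qed
  moreover have "0 \<le> (\<integral>x. exp (g x) \<partial>lborel)"
    by (intro integral_nonneg_AE) auto
  ultimately show ?thesis by linarith
qed

text \<open>The mixing variable \<open>z\<close> is normalised so that \<open>S\<^sub>N / N\<^sup>a\<close> concentrates at \<open>z\<close>:
  the slopes sum to \<open>N\<^sup>a\<close>.\<close>
definition slope :: "(nat \<Rightarrow> nat \<Rightarrow> real) \<Rightarrow> real \<Rightarrow> nat \<Rightarrow> nat \<Rightarrow> real" where
  "slope w a N i = w N i * real N powr a / total_weight w N"

definition rate :: "(nat \<Rightarrow> nat \<Rightarrow> real) \<Rightarrow> real \<Rightarrow> nat \<Rightarrow> real \<Rightarrow> real" where
  "rate w a N z = (\<Sum>i=1..N. phi (slope w a N i * z))"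

text \<open>Expectation given the mixing variable z. It is vector-valued in order to serve real
  second moments and complex exponentials alike.\<close>

definition cond_exp ::
  "(nat \<Rightarrow> nat \<Rightarrow> real) \<Rightarrow> real \<Rightarrow> nat \<Rightarrow> real \<Rightarrow> ((nat \<Rightarrow> real) \<Rightarrow> 'a::real_normed_vector) \<Rightarrow> 'a" where
  "cond_exp w a N z h = (\<Sum>\<sigma>\<in>configs N. spin_prob N (\<lambda>i. tanh (slope w a N i * z)) \<sigma> *\<^sub>R h \<sigma>)"

definition cw_exp ::
  "(nat \<Rightarrow> nat \<Rightarrow> real) \<Rightarrow> nat \<Rightarrow> ((nat \<Rightarrow> real) \<Rightarrow> 'a::real_normed_vector) \<Rightarrow> 'a" where
  "cw_exp w N h = (\<Sum>\<sigma>\<in>configs N. cw_measure w N (1 / nu w N) 0 \<sigma> *\<^sub>R h \<sigma>)"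

lemma sum_cw_weight_pos: "0 < (\<Sum>\<tau>\<in>configs N. cw_weight w N \<beta> B \<tau>)"
  by (intro sum_pos) (auto simp: cw_weight_def)

lemma cw_measure_nonneg: "0 \<le> cw_measure w N \<beta> B \<sigma>"
  unfolding cw_measure_def using sum_cw_weight_pos[of w N \<beta> B]
  by (intro divide_nonneg_pos) (auto simp: cw_weight_def)

lemma sum_cw_measure: "(\<Sum>\<sigma>\<in>configs N. cw_measure w N \<beta> B \<sigma>) = 1"
  using sum_cw_weight_pos[of w N \<beta> B] by (simp add: cw_measure_def flip: sum_divide_distrib)

lemma norm_sum_prob_le:
  fixes h :: "'b \<Rightarrow> 'a::real_normed_vector"
  assumes "\<And>x. x \<in> A \<Longrightarrow> 0 \<le> p x" "(\<Sum>x\<in>A. p x) = 1" "\<And>x. x \<in> A \<Longrightarrow> norm (h x) \<le> B"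
  shows "norm (\<Sum>x\<in>A. p x *\<^sub>R h x) \<le> B"
proof -
  have "norm (\<Sum>x\<in>A. p x *\<^sub>R h x) \<le> (\<Sum>x\<in>A. p x * B)"
    using assms(1,3) by (intro order.trans[OF norm_sum] sum_mono) (auto intro!: mult_left_mono)
  also have "\<dots> = B" using assms(2) by (simp flip: sum_distrib_right)
  finally show ?thesis .
qed

lemma norm_cond_exp_le:
  assumes "\<And>\<sigma>. \<sigma> \<in> configs N \<Longrightarrow> norm (h \<sigma>) \<le> B"
  shows "norm (cond_exp w a N z h) \<le> B"
  unfolding cond_exp_def
  by (rule norm_sum_prob_le)
     (auto intro!: spin_prob_nonneg assms simp: less_imp_le[OF tanh_real_lt_1] abs_le_iff
        tanh_real_gt_neg1 less_imp_le minus_le_iff)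

lemma borel_measurable_cond_exp [measurable]:
  fixes h :: "(nat \<Rightarrow> real) \<Rightarrow> 'a::{real_normed_vector, second_countable_topology}"
  shows "(\<lambda>z. cond_exp w a N z h) \<in> borel_measurable borel"
  unfolding cond_exp_def spin_prob_def
  by (intro borel_measurable_continuous_onI continuous_intros) auto

lemma cw_weight_critical:
  assumes "0 < total_weight w N" "0 < (\<Sum>i=1..N. (w N i)\<^sup>2)"
  shows "cw_weight w N (1 / nu w N) 0 \<sigma> =
    exp ((\<Sum>i=1..N. w N i * \<sigma> i)\<^sup>2 / (2 * (\<Sum>i=1..N. (w N i)\<^sup>2)))"
proof -
  have "N \<noteq> 0" using assms(2) by (cases N) auto
  have "1 / nu w N * (w N i * w N j / total_weight w N) * \<sigma> i * \<sigma> j =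
      w N i * \<sigma> i * (w N j * \<sigma> j) / (\<Sum>i=1..N. (w N i)\<^sup>2)" for i j
    using assms \<open>N \<noteq> 0\<close> by (simp add: nu_def moment_def total_weight_def field_simps)
  then show ?thesis
    by (simp add: cw_weight_def power2_eq_square sum_product flip: sum_divide_distrib)
qed

text \<open>Numerator and denominator of the critical exponent scale alike when all weights are
  multiplied by \<kappa>, so the mixture exists for every \<open>a\<close>, whose choice only fixes
  the unit of z. The Gaussian constant cancels against the normalisation, which is the case h =
  1.\<close>

lemma cw_exp_eq_mixture:
  fixes h :: "(nat \<Rightarrow> real) \<Rightarrow> 'a::{banach, second_countable_topology}"
  assumes pos: "\<And>i. i \<in> {1..N} \<Longrightarrow> 0 < w N i" and "0 < N"
  shows "integrable lborel (\<lambda>z. exp (- rate w a N z))"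
    and "cw_exp w N h = (1 / (\<integral>z. exp (- rate w a N z) \<partial>lborel)) *\<^sub>R
      (\<integral>z. exp (- rate w a N z) *\<^sub>R cond_exp w a N z h \<partial>lborel)"
proof -
  define t where "t = slope w a N"
  define s where "s = (\<Sum>i=1..N. (t i)\<^sup>2)"
  define c where "c = sqrt (2 * pi / s) / 2 ^ N"
  have tw: "0 < total_weight w N"
    unfolding total_weight_def using assms by (intro sum_pos) auto
  have w2: "0 < (\<Sum>i=1..N. (w N i)\<^sup>2)"
    using \<open>0 < N\<close> by (intro sum_pos zero_less_power pos) auto
  have t: "t i = (real N powr a / total_weight w N) * w N i" for i
    by (simp add: t_def slope_def)
  define \<kappa> where "\<kappa> = real N powr a / total_weight w N"
  have "0 < \<kappa>" using tw \<open>0 < N\<close> by (simp add: \<kappa>_def)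
  have s: "s = \<kappa>\<^sup>2 * (\<Sum>i=1..N. (w N i)\<^sup>2)"
    by (simp add: s_def t \<kappa>_def[symmetric] power_mult_distrib sum_distrib_left)
  then have "0 < s" using w2 \<open>0 < \<kappa>\<close> by simp
  then have "0 < c" by (simp add: c_def)
  have cw: "cw_weight w N (1 / nu w N) 0 \<sigma> = exp ((\<Sum>i=1..N. t i * \<sigma> i)\<^sup>2 / (2 * s))" for \<sigma>
  proof -
    have "(\<Sum>i=1..N. t i * \<sigma> i) = \<kappa> * (\<Sum>i=1..N. w N i * \<sigma> i)"
      by (simp add: t \<kappa>_def[symmetric] sum_distrib_left mult_ac)
    then show ?thesis
      unfolding cw_weight_critical[OF tw w2] s using \<open>0 < \<kappa>\<close> by (simp add: power_mult_distrib)
  qed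
  have mix: "has_bochner_integral lborel
      (\<lambda>z. exp (- rate w a N z) *\<^sub>R cond_exp w a N z g)
      (c *\<^sub>R (\<Sum>\<sigma>\<in>configs N. cw_weight w N (1 / nu w N) 0 \<sigma> *\<^sub>R g \<sigma>))"
    for g :: "(nat \<Rightarrow> real) \<Rightarrow> 'b::{banach, second_countable_topology}"
    using has_bochner_integral_spin_mixture[where N = N and t = t and h = g, folded s_def, OF \<open>0 < s\<close>]
    unfolding c_def[symmetric] cw rate_def cond_exp_def t_def[symmetric] .
  have Z: "has_bochner_integral lborel (\<lambda>z. exp (- rate w a N z))
      (c * (\<Sum>\<sigma>\<in>configs N. cw_weight w N (1 / nu w N) 0 \<sigma>))"
    using mix[of "\<lambda>_. 1::real"] by (simp add: cond_exp_def)
  then show "integrable lborel (\<lambda>z. exp (- rate w a N z))"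
    by (simp add: has_bochner_integral_iff)
  show "cw_exp w N h = (1 / (\<integral>z. exp (- rate w a N z) \<partial>lborel)) *\<^sub>R
      (\<integral>z. exp (- rate w a N z) *\<^sub>R cond_exp w a N z h \<partial>lborel)"
    using mix[of h, THEN has_bochner_integral_integral_eq] Z[THEN has_bochner_integral_integral_eq] \<open>0 < c\<close>
    by (simp add: cw_exp_def cw_measure_def scaleR_sum_right)
qed

section \<open>Passage to the limit in the mixture\<close>

lemma exp_minus_le_exp_minus_abs:
  assumes "0 \<le> r" "0 \<le> c" "1 \<le> \<bar>z\<bar> \<Longrightarrow> \<bar>z\<bar> * c \<le> r"
  shows "exp (- r) \<le> exp c * exp (- (c * \<bar>z::real\<bar>))"
proof (cases "1 \<le> \<bar>z\<bar>")
  case True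
  then have "- r \<le> c + - (c * \<bar>z\<bar>)" using assms by (simp add: mult.commute)
  then show ?thesis by (simp only: exp_add[symmetric] exp_le_cancel_iff)
next
  case False
  then have "c * \<bar>z\<bar> \<le> c * 1" using assms(2) by (intro mult_left_mono) auto
  then have "- r \<le> c + - (c * \<bar>z\<bar>)" using assms(1) by simp
  then show ?thesis by (simp only: exp_add[symmetric] exp_le_cancel_iff)
qed

lemma powr_tendsto_0: "c < 0 \<Longrightarrow> (\<lambda>N. real N powr c) \<longlonglongrightarrow> 0"
  using tendsto_neg_powr[OF _ filterlim_real_sequentially] by simp

lemma norm_iexp_diff_le: "norm (iexp x - iexp y) \<le> \<bar>x - y\<bar>"
proof -
  have "iexp x - iexp y = iexp y * (iexp (x - y) - 1)"
    by (simp add: algebra_simps flip: exp_add)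
  then have "norm (iexp x - iexp y) = norm (iexp (x - y) - 1)"
    by (simp add: norm_mult)
  also have "\<dots> \<le> \<bar>x - y\<bar>"
    using iexp_approx1[of "x - y" 0] by simp
  finally show ?thesis .
qed

text \<open>What each of the two cases has to supply. The bounds on \<open>a\<close> make bias and
  variance of the rescaled spin sum vanish for fixed z; \<open>f1\<close> yields the exponential
  tail of the mixing density.\<close>

locale critical_scaling =
  fixes w :: "nat \<Rightarrow> nat \<Rightarrow> real" and \<mu> :: "real measure" and a :: real and f :: "real \<Rightarrow> real"
  assumes pos: "\<And>N i. i \<in> {1..N} \<Longrightarrow> 0 < w N i"
    and reg: "weight_regular w \<mu>"
    and a: "1/2 < a" "a < 1"
    and rate_tendsto: "\<And>z. (\<lambda>N. rate w a N z) \<longlonglongrightarrow> f z"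
    and f1: "0 < f 1"
begin

lemma total_weight_pos: "0 < N \<Longrightarrow> 0 < total_weight w N"
  unfolding total_weight_def by (intro sum_pos pos) auto

lemma total_weight_eq: "total_weight w N = real N * moment w N 1"
  by (simp add: total_weight_def moment_def)

lemma slope_pos: "i \<in> {1..N} \<Longrightarrow> 0 < slope w a N i"
  using total_weight_pos[of N] pos[of i N] by (auto simp: slope_def intro!: divide_pos_pos mult_pos_pos)

lemma sum_slope: "0 < N \<Longrightarrow> (\<Sum>i=1..N. slope w a N i) = real N powr a"
  using total_weight_pos[of N]
  by (simp add: slope_def total_weight_def flip: sum_divide_distrib sum_distrib_right)

lemma borel_measurable_rate [measurable]: "rate w a N \<in> borel_measurable borel"
  unfolding rate_def by measurable

lemma borel_measurable_limit_rate [measurable]: "f \<in> borel_measurable borel"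
  by (rule borel_measurable_LIMSEQ_real[OF rate_tendsto]) auto

text \<open>Convexity upgrades pointwise convergence at \<open>1\<close> to a uniform integrable bound.\<close>
lemma rate_superlinear:
  assumes "1 \<le> \<bar>z\<bar>"
  shows "\<bar>z\<bar> * rate w a N 1 \<le> rate w a N z"
  unfolding rate_def sum_distrib_left
proof (intro sum_mono)
  fix i
  show "\<bar>z\<bar> * phi (slope w a N i * 1) \<le> phi (slope w a N i * z)"
    using phi_superlinear[OF assms, of "slope w a N i"] by (simp add: mult.commute)
qed

lemma rate_nonneg: "0 \<le> rate w a N z"
  unfolding rate_def by (intro sum_nonneg) auto

text \<open>Dominated convergence in z. From some N on, the rate at 1 exceeds c = f 1 / 2, and
  superlinearity turns this into the majorant exp (c - c |z|) B.\<close>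

lemma mixture_integral_tendsto:
  fixes H :: "nat \<Rightarrow> real \<Rightarrow> 'b::{banach, second_countable_topology}"
  assumes [measurable]: "\<And>N. H N \<in> borel_measurable borel"
    and bound: "\<And>N z. norm (H N z) \<le> B"
    and lim: "\<And>z. (\<lambda>N. H N z) \<longlonglongrightarrow> H' z"
  shows "integrable lborel (\<lambda>z. exp (- f z) *\<^sub>R H' z)"
    and "(\<lambda>N. \<integral>z. exp (- rate w a N z) *\<^sub>R H N z \<partial>lborel) \<longlonglongrightarrow> (\<integral>z. exp (- f z) *\<^sub>R H' z \<partial>lborel)"
proof -
  define c where "c = f 1 / 2"
  have "0 < c" "c < f 1" using f1 by (auto simp: c_def)
  have [measurable]: "H' \<in> borel_measurable borel"
    by (rule borel_measurable_LIMSEQ_metric[OF _ lim]) auto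
  have "0 \<le> B" using bound[of 0 0] norm_ge_zero order.trans by blast
  have "eventually (\<lambda>N. c < rate w a N 1) sequentially"
    using rate_tendsto \<open>c < f 1\<close> by (rule order_tendstoD)
  then obtain N0 where N0: "\<And>N. N0 \<le> N \<Longrightarrow> c \<le> rate w a N 1"
    unfolding eventually_sequentially using less_imp_le by blast
  have dom: "norm (exp (- rate w a N z) *\<^sub>R H N z) \<le> exp c * exp (- (c * \<bar>z\<bar>)) * B" if "N0 \<le> N" for N z
  proof -
    have "\<bar>z\<bar> * c \<le> rate w a N z" if "1 \<le> \<bar>z\<bar>"
      using rate_superlinear[OF that, of N] mult_left_mono[OF N0[OF \<open>N0 \<le> N\<close>], of "\<bar>z\<bar>"] by linarith
    then have "exp (- rate w a N z) \<le> exp c * exp (- (c * \<bar>z\<bar>))"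
      using \<open>0 < c\<close> rate_nonneg by (intro exp_minus_le_exp_minus_abs) auto
    then show ?thesis
      using bound[of N z] \<open>0 \<le> B\<close> by (auto intro!: mult_mono)
  qed
  \<comment> \<open>The majorant holds only from N0 on, hence the shifted sequences. The premises
    are collected once because both conclusions rest on them.\<close>
  have prem: "(\<lambda>z. exp (- f z) *\<^sub>R H' z) \<in> borel_measurable lborel"
    "\<And>N. (\<lambda>z. exp (- rate w a (N + N0) z) *\<^sub>R H (N + N0) z) \<in> borel_measurable lborel"
    "integrable lborel (\<lambda>z. exp c * exp (- (c * \<bar>z\<bar>)) * B)"
    "AE z in lborel. (\<lambda>N. exp (- rate w a (N + N0) z) *\<^sub>R H (N + N0) z) \<longlonglongrightarrow> exp (- f z) *\<^sub>R H' z"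
    "\<And>N. AE z in lborel. norm (exp (- rate w a (N + N0) z) *\<^sub>R H (N + N0) z) \<le> exp c * exp (- (c * \<bar>z\<bar>)) * B"
    subgoal by measurable
    subgoal by measurable
    subgoal using integrable_exp_minus_abs[OF \<open>0 < c\<close>] by simp
    subgoal by (intro AE_I2 tendsto_intros LIMSEQ_ignore_initial_segment rate_tendsto lim)
    subgoal using dom by auto
    done
  show "integrable lborel (\<lambda>z. exp (- f z) *\<^sub>R H' z)"
    by (rule integrable_dominated_convergence[OF prem])
  show "(\<lambda>N. \<integral>z. exp (- rate w a N z) *\<^sub>R H N z \<partial>lborel) \<longlonglongrightarrow> (\<integral>z. exp (- f z) *\<^sub>R H' z \<partial>lborel)"
    by (rule LIMSEQ_offset[where k = N0]) (rule integral_dominated_convergence[OF prem])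
qed

lemma integrable_exp_limit: "integrable lborel (\<lambda>z. exp (- f z))"
  using mixture_integral_tendsto(1)[of "\<lambda>_ _. 1::real" 1 "\<lambda>_. 1"] by simp

lemma rate_integral_tendsto:
  "(\<lambda>N. \<integral>z. exp (- rate w a N z) \<partial>lborel) \<longlonglongrightarrow> (\<integral>z. exp (- f z) \<partial>lborel)"
  using mixture_integral_tendsto(2)[of "\<lambda>_ _. 1::real" 1 "\<lambda>_. 1"] by simp

text \<open>Reduces limits under the Curie-Weiss measure to limits for each fixed z, where the spins
  are independent.\<close>

lemma cw_exp_tendsto:
  fixes h :: "nat \<Rightarrow> (nat \<Rightarrow> real) \<Rightarrow> 'b::{banach, second_countable_topology}"
  assumes bound: "\<And>N \<sigma>. \<sigma> \<in> configs N \<Longrightarrow> norm (h N \<sigma>) \<le> B"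
    and lim: "\<And>z. (\<lambda>N. cond_exp w a N z (h N)) \<longlonglongrightarrow> H z"
  shows "(\<lambda>N. cw_exp w N (h N)) \<longlonglongrightarrow>
    (1 / (\<integral>z. exp (- f z) \<partial>lborel)) *\<^sub>R (\<integral>z. exp (- f z) *\<^sub>R H z \<partial>lborel)"
proof -
  have "0 < (\<integral>z. exp (- f z) \<partial>lborel)"
    using integrable_exp_limit by (rule integral_exp_pos)
  then have "(\<lambda>N. (1 / (\<integral>z. exp (- rate w a N z) \<partial>lborel)) *\<^sub>R
      (\<integral>z. exp (- rate w a N z) *\<^sub>R cond_exp w a N z (h N) \<partial>lborel)) \<longlonglongrightarrow>
    (1 / (\<integral>z. exp (- f z) \<partial>lborel)) *\<^sub>R (\<integral>z. exp (- f z) *\<^sub>R H z \<partial>lborel)"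
    by (intro tendsto_intros rate_integral_tendsto mixture_integral_tendsto(2)[where B = B] lim)
       (auto intro: norm_cond_exp_le bound)
  then show ?thesis
  proof (rule Lim_transform_eventually)
    show "eventually (\<lambda>N. (1 / (\<integral>z. exp (- rate w a N z) \<partial>lborel)) *\<^sub>R
      (\<integral>z. exp (- rate w a N z) *\<^sub>R cond_exp w a N z (h N) \<partial>lborel) = cw_exp w N (h N)) sequentially"
      using eventually_gt_at_top[of 0]
      by eventually_elim (rule cw_exp_eq_mixture(2)[OF pos, symmetric])
  qed
qed

lemma cond_exp_second_moment:
  "cond_exp w a N z (\<lambda>\<sigma>. ((\<Sum>i=1..N. b i * \<sigma> i) - c)\<^sup>2) =
    ((\<Sum>i=1..N. b i * tanh (slope w a N i * z)) - c)\<^sup>2 +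
    (\<Sum>i=1..N. (b i)\<^sup>2 * (1 - (tanh (slope w a N i * z))\<^sup>2))"
  unfolding cond_exp_def real_scaleR_def by (rule spin_prob_second_moment)

lemma spin_prob_slope_nonneg:
  "\<sigma> \<in> configs N \<Longrightarrow> 0 \<le> spin_prob N (\<lambda>i. tanh (slope w a N i * z)) \<sigma>"
  by (rule spin_prob_nonneg)
     (auto simp: abs_le_iff less_imp_le[OF tanh_real_lt_1] minus_le_iff less_imp_le[OF tanh_real_gt_neg1])

lemma cond_exp_mono:
  fixes g h :: "(nat \<Rightarrow> real) \<Rightarrow> real"
  assumes "\<And>\<sigma>. \<sigma> \<in> configs N \<Longrightarrow> g \<sigma> \<le> h \<sigma>"
  shows "cond_exp w a N z g \<le> cond_exp w a N z h"
  unfolding cond_exp_def real_scaleR_def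
  using assms by (intro sum_mono mult_left_mono spin_prob_slope_nonneg)

lemma moment1: "(\<lambda>N. moment w N 1) \<longlonglongrightarrow> (\<integral>x. x \<partial>\<mu>)" "0 < (\<integral>x. x \<partial>\<mu>)"
  using first_moment_tendsto[OF pos reg] reg by (auto simp: weight_regular_def)

lemma moment2: "(\<lambda>N. moment w N 2) \<longlonglongrightarrow> (\<integral>x. x\<^sup>2 \<partial>\<mu>)"
  using reg by (auto simp: weight_regular_def)

text \<open>The slopes sum to N^a, so the linear part of tanh reproduces z exactly; the remaining
  bias is at most z^2 times the sum of t_i^2 over N^a, of order N^(a-1). The variance is at most
  N^(1-2a). Both vanish because 1/2 < a < 1.\<close>

lemma cond_exp_deviation_tendsto:
  "(\<lambda>N. cond_exp w a N z (\<lambda>\<sigma>. (spin_sum N \<sigma> / real N powr a - z)\<^sup>2)) \<longlonglongrightarrow> 0"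
proof (rule tendsto_sandwich[OF _ _ tendsto_const])
  let ?u = "\<lambda>N. (z\<^sup>2 * (moment w N 2 / (moment w N 1)\<^sup>2 * real N powr (a - 1)))\<^sup>2 + real N powr (1 - 2 * a)"
  have "(\<lambda>N. ?u N) \<longlonglongrightarrow> (z\<^sup>2 * ((\<integral>x. x\<^sup>2 \<partial>\<mu>) / (\<integral>x. x \<partial>\<mu>)\<^sup>2 * 0))\<^sup>2 + 0"
    using moment1(2) a by (intro tendsto_intros moment1 moment2 powr_tendsto_0) auto
  then show "?u \<longlonglongrightarrow> 0" by simp
  show "eventually (\<lambda>N. cond_exp w a N z (\<lambda>\<sigma>. (spin_sum N \<sigma> / real N powr a - z)\<^sup>2) \<le> ?u N) sequentially"
    using eventually_gt_at_top[of 0]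
  proof eventually_elim
    case (elim N)
    let ?t = "slope w a N" and ?P = "real N powr a"
    have P: "0 < ?P" using elim by simp
    have L: "0 < total_weight w N" by (rule total_weight_pos[OF elim])
    have "(\<Sum>i=1..N. 1 / ?P * tanh (?t i * z)) - z = (\<Sum>i=1..N. tanh (?t i * z) - ?t i * z) / ?P"
    proof -
      have "(\<Sum>i=1..N. tanh (?t i * z) - ?t i * z) = (\<Sum>i=1..N. tanh (?t i * z)) - ?P * z"
        unfolding sum_subtractf sum_distrib_right[symmetric] sum_slope[OF elim] ..
      then show ?thesis using P by (simp add: diff_divide_distrib sum_divide_distrib)
    qed
    also have "\<bar>\<dots>\<bar> \<le> (\<Sum>i=1..N. (?t i * z)\<^sup>2) / ?P"
      unfolding abs_divide abs_of_pos[OF P] using P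
      by (intro divide_right_mono order.trans[OF sum_abs] sum_mono abs_tanh_diff_le) simp
    also have "\<dots> = z\<^sup>2 * (moment w N 2 / (moment w N 1)\<^sup>2 * real N powr (a - 1))"
    proof -
      have "(\<Sum>i=1..N. (?t i * z)\<^sup>2) = z\<^sup>2 * ?P\<^sup>2 * (real N * moment w N 2) / (total_weight w N)\<^sup>2"
      proof -
        have "(?t i * z)\<^sup>2 = z\<^sup>2 * ?P\<^sup>2 / (total_weight w N)\<^sup>2 * (w N i)\<^sup>2" for i
          by (simp add: slope_def power_mult_distrib power_divide)
        then show ?thesis
          using elim by (simp only: sum_distrib_left[symmetric]) (simp add: moment_def)
      qed
      also have "\<dots> / ?P = z\<^sup>2 * (moment w N 2 / (moment w N 1)\<^sup>2 * (?P / real N))"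
      proof -
        have "0 < moment w N 1"
          using L elim unfolding total_weight_eq by (simp add: zero_less_mult_iff)
        then show ?thesis
          unfolding total_weight_eq using elim P by (simp add: power2_eq_square mult_ac)
      qed
      also have "?P / real N = real N powr (a - 1)"
        using elim by (simp add: powr_diff)
      finally show ?thesis .
    qed
    finally have 1: "((\<Sum>i=1..N. 1 / ?P * tanh (?t i * z)) - z)\<^sup>2 \<le>
        (z\<^sup>2 * (moment w N 2 / (moment w N 1)\<^sup>2 * real N powr (a - 1)))\<^sup>2"
      by (rule abs_le_square_iff[THEN iffD1, OF order.trans[OF _ abs_ge_self]])
    have "(\<Sum>i=1..N. (1 / ?P)\<^sup>2 * (1 - (tanh (?t i * z))\<^sup>2)) \<le> (\<Sum>i=1..N. (1 / ?P)\<^sup>2 * 1)"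
      by (intro sum_mono mult_left_mono) auto
    also have "\<dots> = real N powr (1 - 2 * a)"
    proof -
      have "?P\<^sup>2 = real N powr (2 * a)"
        by (simp add: power2_eq_square flip: powr_add)
      then show ?thesis using elim by (simp add: powr_diff power_divide)
    qed
    finally have 2: "(\<Sum>i=1..N. (1 / ?P)\<^sup>2 * (1 - (tanh (?t i * z))\<^sup>2)) \<le> real N powr (1 - 2 * a)" .
    have "spin_sum N \<sigma> / ?P - z = (\<Sum>i=1..N. 1 / ?P * \<sigma> i) - z" for \<sigma>
      by (simp add: spin_sum_def sum_divide_distrib)
    with 1 2 show ?case
      by (simp only: cond_exp_second_moment)
  qed
  show "eventually (\<lambda>N. 0 \<le> cond_exp w a N z (\<lambda>\<sigma>. (spin_sum N \<sigma> / real N powr a - z)\<^sup>2)) sequentially"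
    unfolding cond_exp_def by (intro always_eventually allI sum_nonneg) (auto intro!: mult_nonneg_nonneg spin_prob_slope_nonneg)
qed

text \<open>The exponential is Lipschitz and the first absolute moment is at most the root of the
  second, so concentration at z in mean square suffices.\<close>

lemma cond_exp_iexp_tendsto:
  "(\<lambda>N. cond_exp w a N z (\<lambda>\<sigma>. iexp (\<theta> * (spin_sum N \<sigma> / real N powr a)))) \<longlonglongrightarrow> iexp (\<theta> * z)"
proof -
  let ?X = "\<lambda>N \<sigma>. spin_sum N \<sigma> / real N powr a"
  let ?p = "\<lambda>N. spin_prob N (\<lambda>i. tanh (slope w a N i * z))"
  have "(\<lambda>N. \<bar>\<theta>\<bar> * sqrt (cond_exp w a N z (\<lambda>\<sigma>. (?X N \<sigma> - z)\<^sup>2))) \<longlonglongrightarrow> \<bar>\<theta>\<bar> * sqrt 0"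
    by (rule tendsto_mult[OF tendsto_const tendsto_real_sqrt[OF cond_exp_deviation_tendsto]])
  then have lim: "(\<lambda>N. \<bar>\<theta>\<bar> * sqrt (cond_exp w a N z (\<lambda>\<sigma>. (?X N \<sigma> - z)\<^sup>2))) \<longlonglongrightarrow> 0" by simp
  have "eventually (\<lambda>N. norm (cond_exp w a N z (\<lambda>\<sigma>. iexp (\<theta> * ?X N \<sigma>)) - iexp (\<theta> * z)) \<le>
      \<bar>\<theta>\<bar> * sqrt (cond_exp w a N z (\<lambda>\<sigma>. (?X N \<sigma> - z)\<^sup>2))) sequentially"
  proof (intro always_eventually allI)
    fix N
    have eq: "cond_exp w a N z (\<lambda>\<sigma>. iexp (\<theta> * ?X N \<sigma>)) - iexp (\<theta> * z) =
        (\<Sum>\<sigma>\<in>configs N. ?p N \<sigma> *\<^sub>R (iexp (\<theta> * ?X N \<sigma>) - iexp (\<theta> * z)))"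
      unfolding cond_exp_def scaleR_diff_right sum_subtractf scaleR_sum_left[symmetric] sum_spin_prob
      by simp
    have "norm (cond_exp w a N z (\<lambda>\<sigma>. iexp (\<theta> * ?X N \<sigma>)) - iexp (\<theta> * z)) \<le>
        (\<Sum>\<sigma>\<in>configs N. ?p N \<sigma> * (\<bar>\<theta>\<bar> * \<bar>?X N \<sigma> - z\<bar>))"
      unfolding eq
    proof (intro order.trans[OF norm_sum] sum_mono)
      fix \<sigma> assume "\<sigma> \<in> configs N"
      have "norm (iexp (\<theta> * ?X N \<sigma>) - iexp (\<theta> * z)) \<le> \<bar>\<theta>\<bar> * \<bar>?X N \<sigma> - z\<bar>"
        using norm_iexp_diff_le[of "\<theta> * ?X N \<sigma>" "\<theta> * z"]
        by (metis abs_mult right_diff_distrib)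
      then show "norm (?p N \<sigma> *\<^sub>R (iexp (\<theta> * ?X N \<sigma>) - iexp (\<theta> * z))) \<le> ?p N \<sigma> * (\<bar>\<theta>\<bar> * \<bar>?X N \<sigma> - z\<bar>)"
        unfolding norm_scaleR abs_of_nonneg[OF spin_prob_slope_nonneg[OF \<open>\<sigma> \<in> configs N\<close>]]
        by (rule mult_left_mono) (rule spin_prob_slope_nonneg[OF \<open>\<sigma> \<in> configs N\<close>])
    qed
    also have "\<dots> = \<bar>\<theta>\<bar> * (\<Sum>\<sigma>\<in>configs N. ?p N \<sigma> * \<bar>?X N \<sigma> - z\<bar>)"
      unfolding sum_distrib_left by (intro sum.cong refl) (rule mult.left_commute)
    also have "\<dots> \<le> \<bar>\<theta>\<bar> * sqrt (cond_exp w a N z (\<lambda>\<sigma>. (?X N \<sigma> - z)\<^sup>2))"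
      unfolding cond_exp_def real_scaleR_def
    proof (rule mult_left_mono)
      show "(\<Sum>\<sigma>\<in>configs N. ?p N \<sigma> * \<bar>?X N \<sigma> - z\<bar>) \<le> sqrt (\<Sum>\<sigma>\<in>configs N. ?p N \<sigma> * (?X N \<sigma> - z)\<^sup>2)"
        using sum_abs_le_sqrt_sum_square[where A = "configs N" and p = "?p N" and X = "\<lambda>\<sigma>. ?X N \<sigma> - z"]
          spin_prob_slope_nonneg sum_spin_prob by blast
    qed simp
    finally show "norm (cond_exp w a N z (\<lambda>\<sigma>. iexp (\<theta> * ?X N \<sigma>)) - iexp (\<theta> * z)) \<le>
      \<bar>\<theta>\<bar> * sqrt (cond_exp w a N z (\<lambda>\<sigma>. (?X N \<sigma> - z)\<^sup>2))" .
  qed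
  from LIM_zero_cancel[OF Lim_null_comparison[OF this lim]] show ?thesis .
qed

end

section \<open>Characteristic functions and Levy continuity\<close>

lemma scaled_sum_law_basic:
  assumes P: "\<And>\<sigma>. \<sigma> \<in> configs N \<Longrightarrow> 0 \<le> P \<sigma>" "(\<Sum>\<sigma>\<in>configs N. P \<sigma>) = 1"
  shows real_distribution_scaled_sum_law: "real_distribution (scaled_sum_law P N a)"
    and char_scaled_sum_law: "char (scaled_sum_law P N a) \<theta> =
      (\<Sum>\<sigma>\<in>configs N. P \<sigma> *\<^sub>R iexp (\<theta> * (spin_sum N \<sigma> / real N powr a)))"
proof -
  let ?M = "density (count_space (configs N)) (\<lambda>\<sigma>. ennreal (P \<sigma>))"
  have "emeasure ?M (space ?M) = (\<Sum>\<sigma>\<in>configs N. ennreal (P \<sigma>))"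
    by (simp add: emeasure_density nn_integral_count_space_finite cong: nn_integral_cong)
  also have "\<dots> = 1" using P by (subst sum_ennreal) auto
  finally have "prob_space ?M" by (rule prob_spaceI)
  then show "real_distribution (scaled_sum_law P N a)"
    unfolding scaled_sum_law_def by (rule prob_space.real_distribution_distr) simp
  have "char (scaled_sum_law P N a) \<theta> = (\<integral>\<sigma>. iexp (\<theta> * (spin_sum N \<sigma> / real N powr a)) \<partial>?M)"
    unfolding char_def scaled_sum_law_def by (subst integral_distr) auto
  also have "\<dots> = (\<integral>\<sigma>. P \<sigma> *\<^sub>R iexp (\<theta> * (spin_sum N \<sigma> / real N powr a)) \<partial>count_space (configs N))"
    using P(1) by (intro integral_density) (auto simp: AE_count_space)
  also have "\<dots> = (\<Sum>\<sigma>\<in>configs N. P \<sigma> *\<^sub>R iexp (\<theta> * (spin_sum N \<sigma> / real N powr a)))"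
    by (rule lebesgue_integral_count_space_finite) simp
  finally show "char (scaled_sum_law P N a) \<theta> =
      (\<Sum>\<sigma>\<in>configs N. P \<sigma> *\<^sub>R iexp (\<theta> * (spin_sum N \<sigma> / real N powr a)))" .
qed

lemma exp_density_law_basic:
  assumes [measurable]: "f \<in> borel_measurable borel" and int: "integrable lborel (\<lambda>x. exp (- f x))"
  shows real_distribution_exp_density_law: "real_distribution (exp_density_law f)"
    and char_exp_density_law: "char (exp_density_law f) \<theta> =
      (1 / (\<integral>z. exp (- f z) \<partial>lborel)) *\<^sub>R (\<integral>z. exp (- f z) *\<^sub>R iexp (\<theta> * z) \<partial>lborel)"
proof -
  let ?Z = "\<integral>z. exp (- f z) \<partial>lborel"
  have Z: "0 < ?Z" by (rule integral_exp_pos[OF int])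
  have "emeasure (exp_density_law f) UNIV = (\<integral>\<^sup>+x. ennreal (exp (- f x) / ?Z) \<partial>lborel)"
    by (simp add: exp_density_law_def emeasure_density)
  also have "\<dots> = ennreal (\<integral>x. exp (- f x) / ?Z \<partial>lborel)"
    using int Z by (intro nn_integral_eq_integral) auto
  also have "\<dots> = 1" using Z by simp
  finally have "prob_space (exp_density_law f)"
    by (intro prob_spaceI) (simp add: exp_density_law_def)
  then show "real_distribution (exp_density_law f)"
    by (simp add: real_distribution_def real_distribution_axioms_def exp_density_law_def)
  have "char (exp_density_law f) \<theta> = (\<integral>z. (exp (- f z) / ?Z) *\<^sub>R iexp (\<theta> * z) \<partial>lborel)"
    unfolding char_def exp_density_law_def using Z by (intro integral_density) auto
  also have "\<dots> = (\<integral>z. (1 / ?Z) *\<^sub>R (exp (- f z) *\<^sub>R iexp (\<theta> * z)) \<partial>lborel)"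
    by simp
  also have "\<dots> = (1 / ?Z) *\<^sub>R (\<integral>z. exp (- f z) *\<^sub>R iexp (\<theta> * z) \<partial>lborel)"
    by (rule integral_scaleR_right)
  finally show "char (exp_density_law f) \<theta> = (1 / ?Z) *\<^sub>R (\<integral>z. exp (- f z) *\<^sub>R iexp (\<theta> * z) \<partial>lborel)" .
qed

lemma norm_iexp [simp]: "norm (iexp (x::real)) = 1"
  by simp

context critical_scaling
begin

lemma scaling_limitI:
  assumes "\<And>N \<sigma>. \<sigma> \<in> configs N \<Longrightarrow> 0 \<le> P N \<sigma>" "\<And>N. (\<Sum>\<sigma>\<in>configs N. P N \<sigma>) = 1"
    and "\<And>\<theta>. (\<lambda>N. \<Sum>\<sigma>\<in>configs N. P N \<sigma> *\<^sub>R iexp (\<theta> * (spin_sum N \<sigma> / real N powr a))) \<longlonglongrightarrow>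
      (1 / (\<integral>z. exp (- f z) \<partial>lborel)) *\<^sub>R (\<integral>z. exp (- f z) *\<^sub>R iexp (\<theta> * z) \<partial>lborel)"
    and "a = \<delta> / (\<delta> + 1)"
  shows "scaling_limit P \<delta> f"
  unfolding scaling_limit_def assms(4)[symmetric]
proof
  show "integrable lborel (\<lambda>x. exp (- f x))" by (rule integrable_exp_limit)
  then show "weak_conv_m (\<lambda>N. scaled_sum_law (P N) N a) (exp_density_law f)"
    using assms(1-3)
    by (intro levy_continuity)
       (auto simp: char_scaled_sum_law char_exp_density_law
         intro!: real_distribution_scaled_sum_law real_distribution_exp_density_law)
qed

lemma cw_exp_iexp_tendsto:
  "(\<lambda>N. cw_exp w N (\<lambda>\<sigma>. iexp (\<theta> * (spin_sum N \<sigma> / real N powr a)))) \<longlonglongrightarrow>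
    (1 / (\<integral>z. exp (- f z) \<partial>lborel)) *\<^sub>R (\<integral>z. exp (- f z) *\<^sub>R iexp (\<theta> * z) \<partial>lborel)"
  by (rule cw_exp_tendsto[where B = 1, OF _ cond_exp_iexp_tendsto]) (simp only: norm_iexp order_refl)

theorem scaling_limit_cw:
  assumes "a = \<delta> / (\<delta> + 1)"
  shows "scaling_limit (\<lambda>N. cw_measure w N (1 / nu w N) 0) \<delta> f"
  by (rule scaling_limitI[OF cw_measure_nonneg sum_cw_measure cw_exp_iexp_tendsto[unfolded cw_exp_def] assms])

end

subsection \<open>The annealed measure as a tilt of the Curie-Weiss measure\<close>

definition pair_spin :: "(nat \<Rightarrow> real) \<Rightarrow> nat \<times> nat \<Rightarrow> real" where
  "pair_spin \<sigma> p = \<sigma> (fst p) * \<sigma> (snd p)"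

definition pair_weight :: "(nat \<Rightarrow> nat \<Rightarrow> real) \<Rightarrow> nat \<Rightarrow> nat \<times> nat \<Rightarrow> real" where
  "pair_weight w N p = w N (fst p) * w N (snd p) / total_weight w N"

text \<open>The effective coupling left by averaging over one edge present with probability x/(1+x):
  half the logarithm of the ratio between the averages for aligned and for opposite spins.\<close>

definition annealed_coupling :: "real \<Rightarrow> real \<Rightarrow> real" where
  "annealed_coupling \<beta> x = ln ((1 + x * exp \<beta>) / (1 + x * exp (- \<beta>))) / 2"

lemma finite_vpairs [simp]: "finite (vpairs N)"
proof -
  have "vpairs N \<subseteq> {1..N} \<times> {1..N}" by (auto simp: vpairs_def)
  then show ?thesis by (rule finite_subset) simp
qed

lemma vpairsD:
  assumes "p \<in> vpairs N"
  shows "fst p \<in> {1..N}" "snd p \<in> {1..N}" "fst p \<noteq> snd p"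
  using assms by (auto simp: vpairs_def)

lemma sum_square_eq_vpairs:
  fixes g :: "nat \<Rightarrow> nat \<Rightarrow> real"
  assumes "\<And>i j. g i j = g j i"
  shows "(\<Sum>i=1..N. \<Sum>j=1..N. g i j) = (\<Sum>i=1..N. g i i) + 2 * (\<Sum>p\<in>vpairs N. g (fst p) (snd p))"
proof -
  let ?D = "{(i, j). i \<in> {1..N} \<and> j \<in> {1..N} \<and> i = j}"
  let ?V = "{(i, j). (j, i) \<in> vpairs N}"
  let ?g = "\<lambda>p. g (fst p) (snd p)"
  have V: "?V = prod.swap ` vpairs N" by (auto intro: rev_image_eqI)
  have eq: "{1..N} \<times> {1..N} = ?D \<union> (vpairs N \<union> ?V)"
    by (auto simp: vpairs_def)
  have fin: "finite ?V" "finite ?D"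
    unfolding V by (auto intro: finite_subset[of _ "{1..N} \<times> {1..N}"])
  have "(\<Sum>p\<in>{1..N} \<times> {1..N}. ?g p) = (\<Sum>p\<in>?D. ?g p) + (\<Sum>p\<in>vpairs N \<union> ?V. ?g p)"
    unfolding eq by (rule sum.union_disjoint) (use fin finite_vpairs[of N] in \<open>auto simp: vpairs_def\<close>)
  moreover have "(\<Sum>p\<in>vpairs N \<union> ?V. ?g p) = (\<Sum>p\<in>vpairs N. ?g p) + (\<Sum>p\<in>?V. ?g p)"
    by (rule sum.union_disjoint) (use fin finite_vpairs[of N] in \<open>auto simp: vpairs_def\<close>)
  moreover have "(\<Sum>p\<in>?D. ?g p) = (\<Sum>i=1..N. g i i)"
    by (rule sum.reindex_bij_witness[of _ "\<lambda>i. (i, i)" fst]) auto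
  moreover have "(\<Sum>p\<in>?V. ?g p) = (\<Sum>p\<in>vpairs N. ?g p)"
    by (rule sum.reindex_bij_witness[of _ prod.swap prod.swap]) (auto intro: assms)
  moreover have "(\<Sum>i=1..N. \<Sum>j=1..N. g i j) = (\<Sum>p\<in>{1..N} \<times> {1..N}. ?g p)"
    by (simp add: sum.cartesian_product split_def)
  ultimately show ?thesis by linarith
qed

text \<open>With A = x e^\<beta> and B = x e^(-\<beta>) the two terms are (A - B)/2 and (ln (1+A) -
  ln (1+B))/2. Both bounds matter: the sign makes the coefficients admissible for Griffiths'
  inequality, the quadratic order makes them small.\<close>

lemma annealed_coupling_bounds:
  assumes "0 \<le> x" "0 \<le> \<beta>"
  shows "0 \<le> sinh \<beta> * x - annealed_coupling \<beta> x"
    and "sinh \<beta> * x - annealed_coupling \<beta> x \<le> exp (2 * \<beta>) / 4 * x\<^sup>2"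
proof -
  define A B where "A = x * exp \<beta>" and "B = x * exp (- \<beta>)"
  have AB: "0 \<le> B" "B \<le> A" using assms by (auto simp: A_def B_def mult_left_mono)
  have s: "sinh \<beta> * x = (A - B) / 2" by (simp add: sinh_def A_def B_def algebra_simps)
  have c: "annealed_coupling \<beta> x = ln ((1 + A) / (1 + B)) / 2"
    by (simp add: annealed_coupling_def A_def B_def)
  \<comment> \<open>After cross-multiplication the two sides differ by B (A - B).\<close>
  have "(1 + A) / (1 + B) \<le> 1 + (A - B)"
  proof -
    have "1 + A \<le> (1 + (A - B)) * (1 + B)"
      using mult_nonneg_nonneg[of B "A - B"] AB by (simp add: algebra_simps)
    then show ?thesis using AB by (simp add: divide_le_eq)
  qed
  then have "ln ((1 + A) / (1 + B)) \<le> ln (1 + (A - B))"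
    using AB by (intro ln_mono) auto
  also have "\<dots> \<le> A - B" using AB by (intro ln_add_one_self_le_self) auto
  finally show "0 \<le> sinh \<beta> * x - annealed_coupling \<beta> x" unfolding s c by simp
  have "ln (1 + A) \<ge> A - A\<^sup>2 / 2"
  proof -
    have "x - x\<^sup>2 / 2 \<le> ln (1 + x)" if "0 \<le> x" for x :: real
    proof (rule le_if_deriv_le[OF that, where f' = "\<lambda>u. 1 - u" and g' = "\<lambda>u. 1 / (1 + u)"])
      show "1 - u \<le> 1 / (1 + u)" if "0 \<le> u" for u :: real
      proof -
        have "(1 - u) * (1 + u) \<le> 1" by (simp add: algebra_simps)
        then show ?thesis using that by (simp add: le_divide_eq)
      qed
    qed (auto intro!: derivative_eq_intros)
    then show ?thesis using AB by auto
  qed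
  moreover have "ln (1 + B) \<le> B" using AB by (intro ln_add_one_self_le_self) auto
  moreover have L: "ln ((1 + A) / (1 + B)) = ln (1 + A) - ln (1 + B)"
    using AB by (simp add: ln_div)
  ultimately have "sinh \<beta> * x - annealed_coupling \<beta> x \<le> A\<^sup>2 / 4"
    unfolding s c L by (simp add: field_simps)
  also have "A\<^sup>2 = exp (2 * \<beta>) * x\<^sup>2"
    by (simp add: A_def power_mult_distrib exp_double)
  finally show "sinh \<beta> * x - annealed_coupling \<beta> x \<le> exp (2 * \<beta>) / 4 * x\<^sup>2" by simp
qed

text \<open>Any positive function of s = \<plusminus>1 has the form C exp (c s), with C the
  geometric mean of its two values and c half the logarithm of their ratio.\<close>

lemma edge_factor_eq:
  assumes "0 \<le> x" "s = -1 \<or> s = (1::real)"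
  shows "1 - x / (1 + x) + x / (1 + x) * exp (\<beta> * s) =
    sqrt ((1 + x * exp \<beta>) * (1 + x * exp (- \<beta>))) / (1 + x) * exp (annealed_coupling \<beta> x * s)"
proof -
  define A B where "A = sqrt (1 + x * exp \<beta>)" and "B = sqrt (1 + x * exp (- \<beta>))"
  have nn: "0 < 1 + x * exp u" for u :: real using assms(1) by (intro add_pos_nonneg) auto
  have AB: "0 < A" "0 < B" using nn by (auto simp: A_def B_def)
  have sq: "1 + x * exp \<beta> = A * A" "1 + x * exp (- \<beta>) = B * B"
    unfolding A_def B_def using nn[of \<beta>] nn[of "- \<beta>"] by simp_all
  have "annealed_coupling \<beta> x = ln ((A / B)\<^sup>2) / 2"
    unfolding annealed_coupling_def sq by (simp add: power2_eq_square)
  also have "\<dots> = ln (A / B)" using AB by (simp add: ln_realpow)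
  finally have c: "annealed_coupling \<beta> x = ln (A / B)" .
  have "1 + x * exp (\<beta> * s) = A * B * exp (annealed_coupling \<beta> x * s)"
    using assms(2)
  proof
    assume "s = 1"
    then show ?thesis unfolding c using AB sq(1) by simp
  next
    assume "s = -1"
    moreover have "exp (- ln (A / B)) = B / A"
      using AB by (simp add: exp_minus)
    ultimately show ?thesis unfolding c using AB sq(2) by simp
  qed
  moreover have "sqrt ((1 + x * exp \<beta>) * (1 + x * exp (- \<beta>))) = A * B"
    by (simp add: real_sqrt_mult A_def B_def)
  moreover have "1 - x / (1 + x) + x / (1 + x) * exp (\<beta> * s) = (1 + x * exp (\<beta> * s)) / (1 + x)"
    using assms(1) by (simp add: field_simps)
  ultimately show ?thesis by simp
qed

text \<open>Independence of the edges turns the average into a product over pairs. The first product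
  does not involve \<sigma> and will cancel in the normalised measure.\<close>

lemma expectation_ising_weight:
  assumes pos: "\<And>i. i \<in> {1..N} \<Longrightarrow> 0 < w N i" and \<sigma>: "\<sigma> \<in> configs N"
  shows "measure_pmf.expectation (grg w N) (\<lambda>e. exp (ising_H N \<beta> 0 e \<sigma>)) =
    (\<Prod>p\<in>vpairs N. sqrt ((1 + pair_weight w N p * exp \<beta>) * (1 + pair_weight w N p * exp (- \<beta>))) / (1 + pair_weight w N p)) *
    exp (\<Sum>p\<in>vpairs N. annealed_coupling \<beta> (pair_weight w N p) * pair_spin \<sigma> p)"
proof -
  let ?x = "pair_weight w N" and ?s = "pair_spin \<sigma>"
  have H: "exp (ising_H N \<beta> 0 e \<sigma>) = (\<Prod>p\<in>vpairs N. exp (if e p then \<beta> * ?s p else 0))" for e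
    by (simp add: ising_H_def exp_sum[symmetric] sum.inter_filter[symmetric] sum_distrib_left
        pair_spin_def split_def)
  have "measure_pmf.expectation (grg w N) (\<lambda>e. exp (ising_H N \<beta> 0 e \<sigma>)) =
      (\<Prod>p\<in>vpairs N. measure_pmf.expectation (bernoulli_pmf (edge_prob w N (fst p) (snd p)))
        (\<lambda>b. exp (if b then \<beta> * ?s p else 0)))"
    unfolding H grg_def split_def
    by (rule expectation_prod_Pi_pmf[where f = "\<lambda>p b. exp (if b then \<beta> * ?s p else 0)"])
       (auto intro!: integrable_measure_pmf_finite)
  also have "\<dots> = (\<Prod>p\<in>vpairs N. sqrt ((1 + ?x p * exp \<beta>) * (1 + ?x p * exp (- \<beta>))) / (1 + ?x p) *
      exp (annealed_coupling \<beta> (?x p) * ?s p))"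
  proof (intro prod.cong refl)
    fix p assume p: "p \<in> vpairs N"
    note i = vpairsD[OF p]
    have w: "0 < w N (fst p)" "0 < w N (snd p)" using pos i by auto
    have "0 < total_weight w N" unfolding total_weight_def using i pos by (intro sum_pos) auto
    then have x: "0 \<le> ?x p" "edge_prob w N (fst p) (snd p) = ?x p / (1 + ?x p)"
      using w by (auto simp: pair_weight_def edge_prob_def field_simps)
    have s: "?s p = -1 \<or> ?s p = 1"
      using configs_cases[OF \<sigma> i(1)] configs_cases[OF \<sigma> i(2)] by (auto simp: pair_spin_def)
    have E: "measure_pmf.expectation (bernoulli_pmf (edge_prob w N (fst p) (snd p)))
        (\<lambda>b. exp (if b then \<beta> * ?s p else 0)) = 1 - ?x p / (1 + ?x p) + ?x p / (1 + ?x p) * exp (\<beta> * ?s p)"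
      unfolding x using x(1) by (subst integral_bernoulli_pmf) (auto simp: divide_le_eq)
    show "measure_pmf.expectation (bernoulli_pmf (edge_prob w N (fst p) (snd p)))
        (\<lambda>b. exp (if b then \<beta> * ?s p else 0)) = sqrt ((1 + ?x p * exp \<beta>) * (1 + ?x p * exp (- \<beta>))) / (1 + ?x p) *
        exp (annealed_coupling \<beta> (?x p) * ?s p)"
      unfolding E by (rule edge_factor_eq[OF x(1) s])
  qed
  also have "\<dots> = (\<Prod>p\<in>vpairs N. sqrt ((1 + ?x p * exp \<beta>) * (1 + ?x p * exp (- \<beta>))) / (1 + ?x p)) *
      exp (\<Sum>p\<in>vpairs N. annealed_coupling \<beta> (?x p) * ?s p)"
    unfolding prod.distrib exp_sum[OF finite_vpairs] ..
  finally show ?thesis .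
qed

lemma expectation_Z_graph:
  "measure_pmf.expectation (grg w N) (Z_graph N \<beta> B) =
    (\<Sum>\<sigma>\<in>configs N. measure_pmf.expectation (grg w N) (\<lambda>e. exp (ising_H N \<beta> B e \<sigma>)))"
proof -
  have "finite (set_pmf (grg w N))"
    unfolding grg_def by (subst set_Pi_pmf) (auto intro!: finite_PiE_dflt)
  then show ?thesis
    unfolding Z_graph_def by (intro Bochner_Integration.integral_sum integrable_measure_pmf_finite)
qed

text \<open>On configurations the diagonal factor is constant, as \<sigma>_i^2 = 1, so only the pair
  couplings \<beta> x_ij survive normalisation and can be compared with the annealed ones.\<close>

lemma cw_weight_eq_pairs:
  "cw_weight w N \<beta> 0 \<sigma> = exp (\<beta> / 2 * (\<Sum>i=1..N. w N i * w N i / total_weight w N * (\<sigma> i * \<sigma> i))) *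
    exp (\<Sum>p\<in>vpairs N. \<beta> * pair_weight w N p * pair_spin \<sigma> p)"
proof -
  have "(\<Sum>i=1..N. \<Sum>j=1..N. \<beta> * (w N i * w N j / total_weight w N) * \<sigma> i * \<sigma> j) =
      (\<Sum>i=1..N. \<beta> * (w N i * w N i / total_weight w N) * \<sigma> i * \<sigma> i) +
      2 * (\<Sum>p\<in>vpairs N. \<beta> * (w N (fst p) * w N (snd p) / total_weight w N) * \<sigma> (fst p) * \<sigma> (snd p))"
    by (rule sum_square_eq_vpairs[where g = "\<lambda>i j. \<beta> * (w N i * w N j / total_weight w N) * \<sigma> i * \<sigma> j"]) simp
  then show ?thesis
    by (simp add: cw_weight_def pair_weight_def pair_spin_def sum_distrib_left mult_ac distrib_left flip: exp_add)
qed

definition annealed_correction :: "(nat \<Rightarrow> nat \<Rightarrow> real) \<Rightarrow> nat \<Rightarrow> real \<Rightarrow> (nat \<Rightarrow> real) \<Rightarrow> real" where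
  "annealed_correction w N \<beta> \<sigma> =
    (\<Sum>p\<in>vpairs N. (sinh \<beta> * pair_weight w N p - annealed_coupling \<beta> (pair_weight w N p)) * pair_spin \<sigma> p)"

text \<open>The inverse temperature \<open>sinh \<beta>\<close> on the right is the reason why criticality means
  \<open>\<beta> = arsinh (1 / \<nu>)\<close> in the annealed model.\<close>
lemma annealed_ising_eq:
  assumes pos: "\<And>i. i \<in> {1..N} \<Longrightarrow> 0 < w N i" and \<sigma>: "\<sigma> \<in> configs N"
  shows "annealed_ising w N \<beta> 0 \<sigma> =
    cw_measure w N (sinh \<beta>) 0 \<sigma> * exp (- annealed_correction w N \<beta> \<sigma>) /
    (\<Sum>\<tau>\<in>configs N. cw_measure w N (sinh \<beta>) 0 \<tau> * exp (- annealed_correction w N \<beta> \<tau>))"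
proof -
  define C where "C = (\<Prod>p\<in>vpairs N. sqrt ((1 + pair_weight w N p * exp \<beta>) * (1 + pair_weight w N p * exp (- \<beta>))) / (1 + pair_weight w N p))"
  define D where "D = exp (sinh \<beta> / 2 * (\<Sum>i=1..N. w N i * w N i / total_weight w N))"
  define Z where "Z = (\<Sum>\<tau>\<in>configs N. cw_weight w N (sinh \<beta>) 0 \<tau>)"
  define A where "A \<tau> = exp (\<Sum>p\<in>vpairs N. annealed_coupling \<beta> (pair_weight w N p) * pair_spin \<tau> p)" for \<tau>
  have pw: "0 \<le> pair_weight w N p" if "p \<in> vpairs N" for p
    using vpairsD[OF that] pos unfolding pair_weight_def total_weight_def
    by (intro divide_nonneg_nonneg mult_nonneg_nonneg sum_nonneg) (auto intro: less_imp_le)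
  have "0 < C" unfolding C_def
    by (intro prod_pos ballI divide_pos_pos real_sqrt_gt_zero mult_pos_pos add_pos_nonneg mult_nonneg_nonneg)
       (auto intro: pw)
  have "0 < D" by (simp add: D_def)
  have "0 < Z" unfolding Z_def by (rule sum_cw_weight_pos)
  have 1: "measure_pmf.expectation (grg w N) (\<lambda>e. exp (ising_H N \<beta> 0 e \<tau>)) = C * A \<tau>"
    if "\<tau> \<in> configs N" for \<tau>
    using expectation_ising_weight[where w = w, OF pos that] by (simp add: C_def A_def)
  have 2: "cw_measure w N (sinh \<beta>) 0 \<tau> * exp (- annealed_correction w N \<beta> \<tau>) = D / Z * A \<tau>"
    if "\<tau> \<in> configs N" for \<tau>
  proof -
    have "cw_weight w N (sinh \<beta>) 0 \<tau> = D * exp (\<Sum>p\<in>vpairs N. sinh \<beta> * pair_weight w N p * pair_spin \<tau> p)"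
      unfolding cw_weight_eq_pairs D_def using that by simp
    moreover have "exp (\<Sum>p\<in>vpairs N. sinh \<beta> * pair_weight w N p * pair_spin \<tau> p) *
        exp (- annealed_correction w N \<beta> \<tau>) = A \<tau>"
      by (simp add: A_def annealed_correction_def left_diff_distrib sum_subtractf flip: exp_add)
    ultimately show ?thesis
      by (simp add: cw_measure_def Z_def)
  qed
  have "annealed_ising w N \<beta> 0 \<sigma> = C * A \<sigma> / (\<Sum>\<tau>\<in>configs N. C * A \<tau>)"
    unfolding annealed_ising_def expectation_Z_graph using 1 \<sigma> by simp
  also have "\<dots> = D / Z * A \<sigma> / (\<Sum>\<tau>\<in>configs N. D / Z * A \<tau>)"
    using \<open>0 < C\<close> \<open>0 < D\<close> \<open>0 < Z\<close> by (simp only: sum_distrib_left[symmetric]) simp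
  also have "\<dots> = cw_measure w N (sinh \<beta>) 0 \<sigma> * exp (- annealed_correction w N \<beta> \<sigma>) /
    (\<Sum>\<tau>\<in>configs N. cw_measure w N (sinh \<beta>) 0 \<tau> * exp (- annealed_correction w N \<beta> \<tau>))"
    using 2 \<sigma> by simp
  finally show ?thesis .
qed

section \<open>Vanishing of the annealed correction\<close>

lemma integral_even_power_pos:
  assumes "real_distribution \<mu>" "integrable \<mu> (\<lambda>x. x ^ k)" "even k" "0 < k" "0 < (\<integral>x. x \<partial>\<mu>)"
  shows "0 < (\<integral>x. x ^ k \<partial>\<mu>)"
proof -
  interpret real_distribution \<mu> by fact
  have "(\<integral>x. x ^ k \<partial>\<mu>) \<noteq> 0"
  proof
    assume "(\<integral>x. x ^ k \<partial>\<mu>) = 0"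
    then have "AE x in \<mu>. x ^ k = 0"
      using assms(2,3) by (subst integral_nonneg_eq_0_iff_AE[symmetric]) auto
    then have "AE x in \<mu>. x = 0"
      using assms(4) by simp
    then have "(\<integral>x. x \<partial>\<mu>) = 0"
      by (rule integral_eq_zero_AE)
    with assms(5) show False by simp
  qed
  moreover have "0 \<le> (\<integral>x. x ^ k \<partial>\<mu>)"
    using assms(3) by (intro integral_nonneg_AE) auto
  ultimately show ?thesis by linarith
qed

text \<open>A limit in two scales: \<open>v\<close> may depend on \<epsilon>, typically through a
  truncation level, while \<open>u\<close> may not.\<close>

lemma tendsto_zero_by_splitting:
  fixes X u :: "nat \<Rightarrow> real"
  assumes u: "u \<longlonglongrightarrow> U"
    and split: "\<And>\<epsilon>. 0 < \<epsilon> \<Longrightarrow>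
      \<exists>v. v \<longlonglongrightarrow> 0 \<and> eventually (\<lambda>N. \<bar>X N\<bar> \<le> \<epsilon> * u N + v N) sequentially"
  shows "X \<longlonglongrightarrow> 0"
proof (rule LIMSEQ_I)
  fix r :: real assume "0 < r"
  \<comment> \<open>Adding 1 covers U = 0; the factor 2 leaves strict room below r for the limits of
    u and v.\<close>
  define \<epsilon> where "\<epsilon> = r / (2 * (\<bar>U\<bar> + 1))"
  have "0 < \<epsilon>" using \<open>0 < r\<close> by (simp add: \<epsilon>_def add_nonneg_pos)
  from split[OF this] obtain v where v: "v \<longlonglongrightarrow> 0"
    and X: "eventually (\<lambda>N. \<bar>X N\<bar> \<le> \<epsilon> * u N + v N) sequentially" by blast
  have "(\<lambda>N. \<epsilon> * u N + v N) \<longlonglongrightarrow> \<epsilon> * U + 0"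
    using u v by (intro tendsto_intros)
  moreover have "\<epsilon> * U + 0 < r"
  proof -
    have "\<epsilon> * U \<le> \<epsilon> * (\<bar>U\<bar> + 1)" using \<open>0 < \<epsilon>\<close> by (intro mult_left_mono) auto
    also have "\<dots> = r / 2"
      using add_nonneg_pos[OF abs_ge_zero[of U] zero_less_one] by (simp add: \<epsilon>_def divide_simps)
    finally show ?thesis using \<open>0 < r\<close> by simp
  qed
  ultimately have "eventually (\<lambda>N. \<epsilon> * u N + v N < r) sequentially"
    by (rule order_tendstoD)
  with X have "eventually (\<lambda>N. norm (X N - 0) < r) sequentially"
    by eventually_elim simp
  then show "\<exists>N0. \<forall>N\<ge>N0. norm (X N - 0) < r"
    by (simp add: eventually_sequentially)
qed

lemma abs_exp_minus_one_le: "\<bar>exp x - 1\<bar> \<le> exp \<bar>x\<bar> * \<bar>x::real\<bar>"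
proof (cases "0 \<le> x")
  case True
  have "exp x * (1 + - x) \<le> exp x * exp (- x)"
    by (intro mult_left_mono exp_ge_add_one_self) auto
  then have "exp x - 1 \<le> exp x * x"
    by (simp add: algebra_simps flip: exp_add)
  with True show ?thesis by simp
next
  case False
  have "1 - exp x \<le> - x" using exp_ge_add_one_self[of x] by linarith
  also have "\<dots> = 1 * \<bar>x\<bar>" using False by simp
  also have "\<dots> \<le> exp \<bar>x\<bar> * \<bar>x\<bar>" by (intro mult_right_mono) auto
  finally show ?thesis using False by simp
qed

text \<open>The squares x_ij^2 factorise over i and j, so the full double sum is the square of a
  linear statistic; its diagonal is constant because \<sigma>_i^2 = 1.\<close>

lemma sum_pair_weight_square_eq:
  assumes "\<sigma> \<in> configs N"
  shows "(\<Sum>p\<in>vpairs N. (pair_weight w N p)\<^sup>2 * pair_spin \<sigma> p) =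
    (((\<Sum>i=1..N. (w N i)\<^sup>2 * \<sigma> i) / total_weight w N)\<^sup>2 - (\<Sum>i=1..N. w N i ^ 4) / (total_weight w N)\<^sup>2) / 2"
proof -
  let ?g = "\<lambda>i j. (w N i)\<^sup>2 * \<sigma> i * ((w N j)\<^sup>2 * \<sigma> j) / (total_weight w N)\<^sup>2"
  have 1: "((\<Sum>i=1..N. (w N i)\<^sup>2 * \<sigma> i) / total_weight w N)\<^sup>2 = (\<Sum>i=1..N. \<Sum>j=1..N. ?g i j)"
    by (simp add: power_divide power2_eq_square[of "sum _ _"] sum_product flip: sum_divide_distrib)
  have 2: "(\<Sum>i=1..N. ?g i i) = (\<Sum>i=1..N. w N i ^ 4) / (total_weight w N)\<^sup>2"
    unfolding sum_divide_distrib
  proof (intro sum.cong refl)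
    fix i assume "i \<in> {1..N}"
    have "(w N i)\<^sup>2 * \<sigma> i * ((w N i)\<^sup>2 * \<sigma> i) = w N i ^ 4 * (\<sigma> i * \<sigma> i)"
      by (simp add: power2_eq_square power4_eq_xxxx)
    then show "?g i i = w N i ^ 4 / (total_weight w N)\<^sup>2"
      using configs_square[OF assms \<open>i \<in> {1..N}\<close>] by simp
  qed
  have 3: "(\<Sum>p\<in>vpairs N. ?g (fst p) (snd p)) = (\<Sum>p\<in>vpairs N. (pair_weight w N p)\<^sup>2 * pair_spin \<sigma> p)"
    by (intro sum.cong refl) (simp add: pair_weight_def pair_spin_def power_mult_distrib power_divide)
  have "(\<Sum>i=1..N. \<Sum>j=1..N. ?g i j) = (\<Sum>i=1..N. ?g i i) + 2 * (\<Sum>p\<in>vpairs N. ?g (fst p) (snd p))"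
    by (rule sum_square_eq_vpairs[where g = ?g]) (simp add: mult.commute)
  then show ?thesis unfolding 1 2 3 by simp
qed

lemma sum_pair_weight_square_le:
  "(\<Sum>p\<in>vpairs N. (pair_weight w N p)\<^sup>2) \<le> ((\<Sum>i=1..N. (w N i)\<^sup>2) / total_weight w N)\<^sup>2"
proof -
  let ?g = "\<lambda>i j. (w N i)\<^sup>2 * (w N j)\<^sup>2 / (total_weight w N)\<^sup>2"
  have 1: "((\<Sum>i=1..N. (w N i)\<^sup>2) / total_weight w N)\<^sup>2 = (\<Sum>i=1..N. \<Sum>j=1..N. ?g i j)"
    by (simp add: power_divide power2_eq_square[of "sum _ _"] sum_product flip: sum_divide_distrib)
  have 2: "(\<Sum>p\<in>vpairs N. ?g (fst p) (snd p)) = (\<Sum>p\<in>vpairs N. (pair_weight w N p)\<^sup>2)"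
    by (intro sum.cong refl) (simp add: pair_weight_def power_mult_distrib power_divide)
  have "(\<Sum>i=1..N. \<Sum>j=1..N. ?g i j) = (\<Sum>i=1..N. ?g i i) + 2 * (\<Sum>p\<in>vpairs N. ?g (fst p) (snd p))"
    by (rule sum_square_eq_vpairs[where g = ?g]) (simp add: mult.commute)
  moreover have "0 \<le> (\<Sum>i=1..N. ?g i i)" "0 \<le> (\<Sum>p\<in>vpairs N. ?g (fst p) (snd p))"
    by (intro sum_nonneg, simp)+
  ultimately show ?thesis unfolding 1 2[symmetric] by linarith
qed

lemma abs_pair_spin: "\<sigma> \<in> configs N \<Longrightarrow> p \<in> vpairs N \<Longrightarrow> \<bar>pair_spin \<sigma> p\<bar> = 1"
  using configs_cases[OF _ vpairsD(1)] configs_cases[OF _ vpairsD(2)]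
  by (fastforce simp: pair_spin_def)

context critical_scaling
begin

text \<open>In the expanded square every correlation E p q is nonnegative by Griffiths' inequality,
  since all means tanh (t_i z) share the sign of z; so the square grows with nonnegative
  coefficients.\<close>

lemma cond_exp_pair_square_mono:
  assumes "\<And>p. p \<in> vpairs N \<Longrightarrow> 0 \<le> r p" "\<And>p. p \<in> vpairs N \<Longrightarrow> r p \<le> s p"
  shows "cond_exp w a N z (\<lambda>\<sigma>. (\<Sum>p\<in>vpairs N. r p * pair_spin \<sigma> p)\<^sup>2) \<le>
    cond_exp w a N z (\<lambda>\<sigma>. (\<Sum>p\<in>vpairs N. s p * pair_spin \<sigma> p)\<^sup>2)"
proof -
  define E where "E p q = cond_exp w a N z (\<lambda>\<sigma>. pair_spin \<sigma> p * pair_spin \<sigma> q)" for p q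
  have expand: "cond_exp w a N z (\<lambda>\<sigma>. (\<Sum>p\<in>vpairs N. c p * pair_spin \<sigma> p)\<^sup>2) =
      (\<Sum>p\<in>vpairs N. \<Sum>q\<in>vpairs N. c p * c q * E p q)" for c
  proof -
    let ?h = "\<lambda>\<sigma> p q. c p * c q * (spin_prob N (\<lambda>i. tanh (slope w a N i * z)) \<sigma> * (pair_spin \<sigma> p * pair_spin \<sigma> q))"
    have "cond_exp w a N z (\<lambda>\<sigma>. (\<Sum>p\<in>vpairs N. c p * pair_spin \<sigma> p)\<^sup>2) =
        (\<Sum>\<sigma>\<in>configs N. \<Sum>p\<in>vpairs N. \<Sum>q\<in>vpairs N. ?h \<sigma> p q)"
      by (simp add: cond_exp_def power2_eq_square sum_product sum_distrib_left mult_ac)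
    also have "\<dots> = (\<Sum>p\<in>vpairs N. \<Sum>\<sigma>\<in>configs N. \<Sum>q\<in>vpairs N. ?h \<sigma> p q)"
      by (rule sum.swap)
    also have "\<dots> = (\<Sum>p\<in>vpairs N. \<Sum>q\<in>vpairs N. \<Sum>\<sigma>\<in>configs N. ?h \<sigma> p q)"
      by (intro sum.cong refl sum.swap)
    also have "\<dots> = (\<Sum>p\<in>vpairs N. \<Sum>q\<in>vpairs N. c p * c q * E p q)"
      by (simp only: sum_distrib_left[symmetric] E_def cond_exp_def real_scaleR_def)
    finally show ?thesis .
  qed
  have sign: "0 \<le> tanh (slope w a N i * z) * tanh (slope w a N j * z)"
    if "i \<in> {1..N}" "j \<in> {1..N}" for i j
    using slope_pos[OF that(1)] slope_pos[OF that(2)]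
    by (cases "0 \<le> z") (auto intro!: mult_nonneg_nonneg mult_nonpos_nonpos simp: mult_le_0_iff)
  have E: "0 \<le> E p q" if "p \<in> vpairs N" "q \<in> vpairs N" for p q
    unfolding E_def cond_exp_def real_scaleR_def pair_spin_def
    by (rule spin_prob_griffiths) (use vpairsD[OF that(1)] vpairsD[OF that(2)] sign in auto)
  have s: "0 \<le> s p" if "p \<in> vpairs N" for p
    using assms(1,2)[OF that] by linarith
  show ?thesis
    unfolding expand
    by (intro sum_mono mult_mono mult_nonneg_nonneg assms E s order_refl)
qed

lemma moment1_pos: "0 < N \<Longrightarrow> 0 < moment w N 1"
  using total_weight_pos[of N] by (simp add: total_weight_eq zero_less_mult_iff)

text \<open>No fourth moment is assumed: the largest squared weight is at most \<epsilon> N + K^2,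
  and pulling it out leaves a second moment.\<close>

lemma fourth_moment_negligible: "(\<lambda>N. (\<Sum>i=1..N. w N i ^ 4) / (total_weight w N)\<^sup>2) \<longlonglongrightarrow> 0"
proof (rule tendsto_zero_by_splitting)
  show "(\<lambda>N. moment w N 2 / (moment w N 1)\<^sup>2) \<longlonglongrightarrow> (\<integral>x. x\<^sup>2 \<partial>\<mu>) / (\<integral>x. x \<partial>\<mu>)\<^sup>2"
    using moment1(2) by (intro tendsto_intros moment1 moment2) simp
  then have lim: "(\<lambda>N. moment w N 2 / (moment w N 1)\<^sup>2) \<longlonglongrightarrow> (\<integral>x. x\<^sup>2 \<partial>\<mu>) / (\<integral>x. x \<partial>\<mu>)\<^sup>2" .
  fix \<epsilon> :: real assume "0 < \<epsilon>"
  from second_moment_tail[OF pos reg this] obtain K where K: "0 \<le> K"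
    and tail: "eventually (\<lambda>N. (\<Sum>i=1..N. (w N i)\<^sup>2 - (min (w N i) K)\<^sup>2) / real N < \<epsilon>) sequentially" by blast
  define v where "v N = K\<^sup>2 / real N * (moment w N 2 / (moment w N 1)\<^sup>2)" for N
  have "v \<longlonglongrightarrow> 0 * ((\<integral>x. x\<^sup>2 \<partial>\<mu>) / (\<integral>x. x \<partial>\<mu>)\<^sup>2)"
    unfolding v_def by (intro tendsto_mult lim lim_const_over_n)
  then have "v \<longlonglongrightarrow> 0" by simp
  moreover have "eventually (\<lambda>N. \<bar>(\<Sum>i=1..N. w N i ^ 4) / (total_weight w N)\<^sup>2\<bar> \<le>
      \<epsilon> * (moment w N 2 / (moment w N 1)\<^sup>2) + v N) sequentially"
    using tail eventually_gt_at_top[of 0]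
  proof eventually_elim
    case (elim N)
    have "(\<Sum>i=1..N. w N i ^ 4) \<le> (\<Sum>i=1..N. (real N * \<epsilon> + K\<^sup>2) * (w N i)\<^sup>2)"
    proof (rule sum_mono)
      fix i assume i: "i \<in> {1..N}"
      have "(w N i)\<^sup>2 \<le> real N * \<epsilon> + K\<^sup>2"
        using square_le_of_tail[where w = w, OF pos K i] elim by (simp add: divide_less_eq mult.commute)
      then have "(w N i)\<^sup>2 * (w N i)\<^sup>2 \<le> (real N * \<epsilon> + K\<^sup>2) * (w N i)\<^sup>2"
        by (intro mult_right_mono) auto
      then show "w N i ^ 4 \<le> (real N * \<epsilon> + K\<^sup>2) * (w N i)\<^sup>2"
        by (simp flip: power_add)
    qed
    also have "\<dots> = (real N * \<epsilon> + K\<^sup>2) * (real N * moment w N 2)"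
      using elim by (simp add: moment_def flip: sum_distrib_left)
    finally have "(\<Sum>i=1..N. w N i ^ 4) / (total_weight w N)\<^sup>2 \<le>
        (real N * \<epsilon> + K\<^sup>2) * (real N * moment w N 2) / (total_weight w N)\<^sup>2"
      by (intro divide_right_mono) auto
    also have "\<dots> = \<epsilon> * (moment w N 2 / (moment w N 1)\<^sup>2) + v N"
      unfolding total_weight_eq v_def using elim moment1_pos[of N] by (simp add: field_simps power2_eq_square)
    finally show ?case
      by (simp add: sum_nonneg)
  qed
  ultimately show "\<exists>v. v \<longlonglongrightarrow> 0 \<and> eventually (\<lambda>N. \<bar>(\<Sum>i=1..N. w N i ^ 4) / (total_weight w N)\<^sup>2\<bar> \<le>
      \<epsilon> * (moment w N 2 / (moment w N 1)\<^sup>2) + v N) sequentially" by blast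
qed

text \<open>Split w_i^2 at the truncation level. On the excess, |tanh| \<le> 1 and uniform
  integrability applies; on the truncated part, |tanh| \<le> t_i |z| and the slopes sum to N^a =
  o(N).\<close>

lemma weighted_tanh_negligible:
  "(\<lambda>N. (\<Sum>i=1..N. (w N i)\<^sup>2 * tanh (slope w a N i * z)) / total_weight w N) \<longlonglongrightarrow> 0"
proof (rule tendsto_zero_by_splitting)
  show "(\<lambda>N. 1 / moment w N 1) \<longlonglongrightarrow> 1 / (\<integral>x. x \<partial>\<mu>)"
    using moment1(2) by (intro tendsto_intros moment1) simp
  then have lim: "(\<lambda>N. 1 / moment w N 1) \<longlonglongrightarrow> 1 / (\<integral>x. x \<partial>\<mu>)" .
  fix \<epsilon> :: real assume "0 < \<epsilon>"
  from second_moment_tail[OF pos reg this] obtain K where K: "0 \<le> K"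
    and tail: "eventually (\<lambda>N. (\<Sum>i=1..N. (w N i)\<^sup>2 - (min (w N i) K)\<^sup>2) / real N < \<epsilon>) sequentially" by blast
  define v where "v N = K\<^sup>2 * \<bar>z\<bar> * real N powr (a - 1) * (1 / moment w N 1)" for N
  have "v \<longlonglongrightarrow> K\<^sup>2 * \<bar>z\<bar> * 0 * (1 / (\<integral>x. x \<partial>\<mu>))"
    unfolding v_def using a by (intro tendsto_mult lim tendsto_const powr_tendsto_0) simp
  then have "v \<longlonglongrightarrow> 0" by simp
  moreover have "eventually (\<lambda>N. \<bar>(\<Sum>i=1..N. (w N i)\<^sup>2 * tanh (slope w a N i * z)) / total_weight w N\<bar> \<le>
      \<epsilon> * (1 / moment w N 1) + v N) sequentially"
    using tail eventually_gt_at_top[of 0]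
  proof eventually_elim
    case (elim N)
    let ?t = "slope w a N"
    have L: "0 < total_weight w N" using elim total_weight_pos by blast
    have "\<bar>\<Sum>i=1..N. (w N i)\<^sup>2 * tanh (?t i * z)\<bar> \<le>
        (\<Sum>i=1..N. ((w N i)\<^sup>2 - (min (w N i) K)\<^sup>2) + K\<^sup>2 * \<bar>z\<bar> * ?t i)"
    proof (intro order.trans[OF sum_abs] sum_mono)
      fix i assume i: "i \<in> {1..N}"
      have T: "\<bar>tanh (?t i * z)\<bar> \<le> \<bar>z\<bar> * ?t i" "\<bar>tanh (?t i * z)\<bar> \<le> 1"
        using abs_tanh_le[of "?t i * z"] slope_pos[OF i] tanh_real_bounds[of "?t i * z"]
        by (auto simp: abs_mult mult.commute)
      have m: "(min (w N i) K)\<^sup>2 \<le> K\<^sup>2" "(min (w N i) K)\<^sup>2 \<le> (w N i)\<^sup>2"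
        using pos[OF i] K by (auto intro!: power_mono)
      have "\<bar>(w N i)\<^sup>2 * tanh (?t i * z)\<bar> =
          ((w N i)\<^sup>2 - (min (w N i) K)\<^sup>2) * \<bar>tanh (?t i * z)\<bar> + (min (w N i) K)\<^sup>2 * \<bar>tanh (?t i * z)\<bar>"
        by (simp add: abs_mult algebra_simps)
      also have "\<dots> \<le> ((w N i)\<^sup>2 - (min (w N i) K)\<^sup>2) * 1 + K\<^sup>2 * (\<bar>z\<bar> * ?t i)"
        using m T by (intro add_mono mult_mono) auto
      finally show "\<bar>(w N i)\<^sup>2 * tanh (?t i * z)\<bar> \<le> ((w N i)\<^sup>2 - (min (w N i) K)\<^sup>2) + K\<^sup>2 * \<bar>z\<bar> * ?t i"
        by (simp add: mult.assoc)
    qed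
    also have "\<dots> = (\<Sum>i=1..N. (w N i)\<^sup>2 - (min (w N i) K)\<^sup>2) + K\<^sup>2 * \<bar>z\<bar> * real N powr a"
      unfolding sum.distrib sum_distrib_left[symmetric] using sum_slope elim by simp
    also have "\<dots> \<le> real N * \<epsilon> + K\<^sup>2 * \<bar>z\<bar> * real N powr a"
      using elim by (simp add: divide_less_eq mult.commute)
    finally have "\<bar>\<Sum>i=1..N. (w N i)\<^sup>2 * tanh (?t i * z)\<bar> / total_weight w N \<le>
        (real N * \<epsilon> + K\<^sup>2 * \<bar>z\<bar> * real N powr a) / total_weight w N"
      using L by (intro divide_right_mono) auto
    also have "\<dots> = \<epsilon> * (1 / moment w N 1) + v N"
      unfolding total_weight_eq v_def using elim moment1_pos[of N] by (simp add: powr_diff field_simps)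
    finally show ?case
      using L by simp
  qed
  ultimately show "\<exists>v. v \<longlonglongrightarrow> 0 \<and> eventually (\<lambda>N. \<bar>(\<Sum>i=1..N. (w N i)\<^sup>2 * tanh (slope w a N i * z)) / total_weight w N\<bar> \<le>
      \<epsilon> * (1 / moment w N 1) + v N) sequentially" by blast
qed

lemma moment2_pos: "0 < (\<integral>x. x\<^sup>2 \<partial>\<mu>)"
  using reg by (intro integral_even_power_pos) (auto simp: weight_regular_def)

definition crit_beta :: "nat \<Rightarrow> real" where
  "crit_beta N = arsinh (1 / nu w N)"

definition correction :: "nat \<Rightarrow> (nat \<Rightarrow> real) \<Rightarrow> real" where
  "correction N = annealed_correction w N (crit_beta N)"

lemma nu_tendsto: "(\<lambda>N. nu w N) \<longlonglongrightarrow> (\<integral>x. x\<^sup>2 \<partial>\<mu>) / (\<integral>x. x \<partial>\<mu>)"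
  unfolding nu_def using moment1(2) by (intro tendsto_intros moment1 moment2) simp

lemma crit_beta_nonneg: "0 \<le> crit_beta N"
proof -
  have "0 \<le> moment w N k" for k
    unfolding moment_def by (intro divide_nonneg_nonneg sum_nonneg zero_le_power of_nat_0_le_iff)
       (rule less_imp_le[OF pos])
  then have "0 \<le> 1 / nu w N" by (simp add: nu_def)
  then show ?thesis
    unfolding crit_beta_def using arsinh_real_neg_iff[of "1 / nu w N"] by linarith
qed

lemma crit_beta_tendsto: "crit_beta \<longlonglongrightarrow> arsinh (1 / ((\<integral>x. x\<^sup>2 \<partial>\<mu>) / (\<integral>x. x \<partial>\<mu>)))"
  unfolding crit_beta_def[abs_def]
  using moment1(2) moment2_pos by (intro tendsto_intros nu_tendsto) simp

lemma sum_pair_weight_square_bound: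
  "(\<Sum>p\<in>vpairs N. (pair_weight w N p)\<^sup>2) \<le> (nu w N)\<^sup>2"
proof (cases "N = 0")
  case False
  have "(\<Sum>i=1..N. (w N i)\<^sup>2) / total_weight w N = nu w N"
    using False by (simp add: nu_def moment_def total_weight_def)
  then show ?thesis using sum_pair_weight_square_le[of w N] by simp
next
  case True
  then have "vpairs N = {}" by (auto simp: vpairs_def)
  then show ?thesis by simp
qed

lemma correction_coeff_bounds:
  assumes "p \<in> vpairs N"
  shows "0 \<le> sinh (crit_beta N) * pair_weight w N p - annealed_coupling (crit_beta N) (pair_weight w N p)"
    and "sinh (crit_beta N) * pair_weight w N p - annealed_coupling (crit_beta N) (pair_weight w N p)
      \<le> exp (2 * crit_beta N) / 4 * (pair_weight w N p)\<^sup>2"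
proof -
  have "0 < N" using vpairsD(1)[OF assms] by auto
  then have "0 \<le> pair_weight w N p"
    unfolding pair_weight_def
    by (intro divide_nonneg_nonneg mult_nonneg_nonneg less_imp_le total_weight_pos pos vpairsD[OF assms])
  from annealed_coupling_bounds[OF this crit_beta_nonneg]
  show "0 \<le> sinh (crit_beta N) * pair_weight w N p - annealed_coupling (crit_beta N) (pair_weight w N p)"
    and "sinh (crit_beta N) * pair_weight w N p - annealed_coupling (crit_beta N) (pair_weight w N p)
      \<le> exp (2 * crit_beta N) / 4 * (pair_weight w N p)\<^sup>2" by auto
qed

text \<open>Each coefficient is O(x_ij^2), and the x_ij^2 sum to at most \<nu>_N^2, which converges.
  The uniform bound is what permits linearising exp (- correction).\<close>

lemma correction_bounded: "\<exists>B. \<forall>N. \<forall>\<sigma>\<in>configs N. \<bar>correction N \<sigma>\<bar> \<le> B"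
proof -
  let ?B = "\<lambda>N. exp (2 * crit_beta N) / 4 * (nu w N)\<^sup>2"
  have "?B \<longlonglongrightarrow> exp (2 * arsinh (1 / ((\<integral>x. x\<^sup>2 \<partial>\<mu>) / (\<integral>x. x \<partial>\<mu>)))) / 4 * ((\<integral>x. x\<^sup>2 \<partial>\<mu>) / (\<integral>x. x \<partial>\<mu>))\<^sup>2"
    by (intro tendsto_intros crit_beta_tendsto nu_tendsto) simp
  then have "Bseq ?B" by (intro convergent_imp_Bseq) (auto simp: convergent_def)
  then obtain B where B: "\<And>N. \<bar>?B N\<bar> \<le> B" unfolding Bseq_def by auto
  have "\<bar>correction N \<sigma>\<bar> \<le> B" if "\<sigma> \<in> configs N" for N \<sigma>
  proof -
    have "\<bar>correction N \<sigma>\<bar> \<le> (\<Sum>p\<in>vpairs N. exp (2 * crit_beta N) / 4 * (pair_weight w N p)\<^sup>2)"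
      unfolding correction_def annealed_correction_def
    proof (intro order.trans[OF sum_abs] sum_mono)
      fix p assume p: "p \<in> vpairs N"
      show "\<bar>(sinh (crit_beta N) * pair_weight w N p - annealed_coupling (crit_beta N) (pair_weight w N p)) *
          pair_spin \<sigma> p\<bar> \<le> exp (2 * crit_beta N) / 4 * (pair_weight w N p)\<^sup>2"
        unfolding abs_mult abs_pair_spin[OF that p] using correction_coeff_bounds[OF p] by simp
    qed
    also have "\<dots> \<le> ?B N"
      unfolding sum_distrib_left[symmetric]
      by (intro mult_left_mono sum_pair_weight_square_bound) auto
    also have "\<dots> \<le> B" using B[of N] by linarith
    finally show ?thesis .
  qed
  then show ?thesis by blast
qed

text \<open>Griffiths' inequality raises the coefficients to C x_ij^2, whose form S without the
  factor C is (Q - D)/2, with Q the square of a linear statistic and D the diagonal. D enters the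
  bound twice: as the diagonal, and as a bound for the variance hidden in the expectation of
  Q.\<close>

lemma cond_exp_correction_tendsto:
  "(\<lambda>N. cond_exp w a N z (\<lambda>\<sigma>. (correction N \<sigma>)\<^sup>2)) \<longlonglongrightarrow> 0"
proof -
  define C where "C N = exp (2 * crit_beta N) / 4" for N
  define D where "D N = (\<Sum>i=1..N. w N i ^ 4) / (total_weight w N)\<^sup>2" for N
  define M where "M N = (\<Sum>i=1..N. (w N i)\<^sup>2 * tanh (slope w a N i * z)) / total_weight w N" for N
  define Q where "Q N \<sigma> = ((\<Sum>i=1..N. (w N i)\<^sup>2 * \<sigma> i) / total_weight w N)\<^sup>2" for N \<sigma>
  let ?u = "\<lambda>N. (C N)\<^sup>2 * ((nu w N)\<^sup>2 * ((M N)\<^sup>2 + D N + D N))"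
  have D0: "0 \<le> D N" for N unfolding D_def by (intro divide_nonneg_nonneg sum_nonneg) auto
  have EQ: "cond_exp w a N z (Q N) \<le> (M N)\<^sup>2 + D N" for N
  proof -
    have Q: "Q N = (\<lambda>\<sigma>. ((\<Sum>i=1..N. (w N i)\<^sup>2 / total_weight w N * \<sigma> i) - 0)\<^sup>2)"
      by (simp add: Q_def fun_eq_iff sum_divide_distrib)
    have "cond_exp w a N z (Q N) = ((\<Sum>i=1..N. (w N i)\<^sup>2 / total_weight w N * tanh (slope w a N i * z)) - 0)\<^sup>2 +
        (\<Sum>i=1..N. ((w N i)\<^sup>2 / total_weight w N)\<^sup>2 * (1 - (tanh (slope w a N i * z))\<^sup>2))"
      unfolding Q by (rule cond_exp_second_moment)
    also have "\<dots> \<le> (M N)\<^sup>2 + (\<Sum>i=1..N. ((w N i)\<^sup>2 / total_weight w N)\<^sup>2 * 1)"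
      by (intro add_mono sum_mono mult_left_mono) (auto simp: M_def sum_divide_distrib)
    also have "(\<Sum>i=1..N. ((w N i)\<^sup>2 / total_weight w N)\<^sup>2 * 1) = D N"
      by (simp add: D_def power_divide sum_divide_distrib flip: power_mult)
    finally show ?thesis .
  qed
  have bound: "cond_exp w a N z (\<lambda>\<sigma>. (correction N \<sigma>)\<^sup>2) \<le> ?u N" for N
  proof -
    let ?S = "\<lambda>\<sigma>. \<Sum>p\<in>vpairs N. (pair_weight w N p)\<^sup>2 * pair_spin \<sigma> p"
    have S: "(\<Sum>p\<in>vpairs N. C N * (pair_weight w N p)\<^sup>2 * pair_spin \<sigma> p)\<^sup>2 \<le>
        (C N)\<^sup>2 * (nu w N)\<^sup>2 * (Q N \<sigma> + D N)" if "\<sigma> \<in> configs N" for \<sigma>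
    proof -
      have "\<bar>?S \<sigma>\<bar> \<le> (\<Sum>p\<in>vpairs N. (pair_weight w N p)\<^sup>2)"
        by (intro order.trans[OF sum_abs] sum_mono) (simp add: abs_mult abs_pair_spin[OF that])
      also have "\<dots> \<le> (nu w N)\<^sup>2" by (rule sum_pair_weight_square_bound)
      finally have 1: "\<bar>?S \<sigma>\<bar> \<le> (nu w N)\<^sup>2" .
      have "?S \<sigma> = (Q N \<sigma> - D N) / 2"
        unfolding Q_def D_def by (rule sum_pair_weight_square_eq[OF that])
      moreover have "0 \<le> Q N \<sigma>" by (simp add: Q_def)
      ultimately have 2: "\<bar>?S \<sigma>\<bar> \<le> Q N \<sigma> + D N" using D0[of N] by (simp add: abs_le_iff)
      \<comment> \<open>S^2 is of fourth order in the linear statistic. Bounding one factor by the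
        constant \<nu>^2 leaves a second moment, which is computable.\<close>
      have "\<bar>?S \<sigma>\<bar> * \<bar>?S \<sigma>\<bar> \<le> (nu w N)\<^sup>2 * (Q N \<sigma> + D N)"
        using 1 2 by (intro mult_mono) auto
      then have "(C N)\<^sup>2 * (?S \<sigma>)\<^sup>2 \<le> (C N)\<^sup>2 * ((nu w N)\<^sup>2 * (Q N \<sigma> + D N))"
        by (intro mult_left_mono) (auto simp: power2_eq_square abs_mult_self_eq)
      moreover have "(\<Sum>p\<in>vpairs N. C N * (pair_weight w N p)\<^sup>2 * pair_spin \<sigma> p) = C N * ?S \<sigma>"
        by (simp add: sum_distrib_left mult.assoc)
      ultimately show ?thesis by (simp add: power_mult_distrib mult.assoc)
    qed
    have "cond_exp w a N z (\<lambda>\<sigma>. (correction N \<sigma>)\<^sup>2) \<le>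
        cond_exp w a N z (\<lambda>\<sigma>. (\<Sum>p\<in>vpairs N. C N * (pair_weight w N p)\<^sup>2 * pair_spin \<sigma> p)\<^sup>2)"
      unfolding correction_def annealed_correction_def C_def
      by (intro cond_exp_pair_square_mono correction_coeff_bounds)
    also have "\<dots> \<le> cond_exp w a N z (\<lambda>\<sigma>. (C N)\<^sup>2 * (nu w N)\<^sup>2 * (Q N \<sigma> + D N))"
      by (intro cond_exp_mono S)
    also have "\<dots> = (C N)\<^sup>2 * (nu w N)\<^sup>2 * (cond_exp w a N z (Q N) + D N)"
    proof -
      have "cond_exp w a N z (Q N) + D N = cond_exp w a N z (\<lambda>\<sigma>. Q N \<sigma> + D N)"
        by (simp add: cond_exp_def distrib_left sum.distrib flip: sum_distrib_right)
      then show ?thesis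
        by (simp add: cond_exp_def sum_distrib_left mult_ac)
    qed
    also have "\<dots> \<le> (C N)\<^sup>2 * (nu w N)\<^sup>2 * ((M N)\<^sup>2 + D N + D N)"
      using EQ[of N] by (intro mult_left_mono) auto
    finally show ?thesis by (simp add: mult.assoc)
  qed
  have nonneg: "0 \<le> cond_exp w a N z (\<lambda>\<sigma>. (correction N \<sigma>)\<^sup>2)" for N
    unfolding cond_exp_def
    by (intro sum_nonneg) (auto intro!: mult_nonneg_nonneg spin_prob_slope_nonneg)
  define c where "c = (\<integral>x. x\<^sup>2 \<partial>\<mu>) / (\<integral>x. x \<partial>\<mu>)"
  have M: "M \<longlonglongrightarrow> 0" unfolding M_def by (rule weighted_tanh_negligible)
  have D: "D \<longlonglongrightarrow> 0" unfolding D_def by (rule fourth_moment_negligible)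
  have C: "C \<longlonglongrightarrow> exp (2 * arsinh (1 / c)) / 4"
    unfolding C_def c_def by (intro tendsto_intros crit_beta_tendsto) simp
  have "?u \<longlonglongrightarrow> (exp (2 * arsinh (1 / c)) / 4)\<^sup>2 * (c\<^sup>2 * (0\<^sup>2 + 0 + 0))"
    by (intro tendsto_mult tendsto_power tendsto_add C M D nu_tendsto[folded c_def])
  then have u: "?u \<longlonglongrightarrow> 0" by simp
  show ?thesis
    by (rule tendsto_sandwich[OF _ _ tendsto_const u]) (use bound nonneg in auto)
qed

lemma cw_exp_correction_tendsto: "(\<lambda>N. cw_exp w N (\<lambda>\<sigma>. \<bar>correction N \<sigma>\<bar>)) \<longlonglongrightarrow> 0"
proof -
  from correction_bounded obtain B where B: "\<And>N \<sigma>. \<sigma> \<in> configs N \<Longrightarrow> \<bar>correction N \<sigma>\<bar> \<le> B" by blast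
  have "norm ((correction N \<sigma>)\<^sup>2) \<le> B\<^sup>2" if "\<sigma> \<in> configs N" for N \<sigma>
    using power_mono[OF B[OF that] abs_ge_zero, of 2] by simp
  from cw_exp_tendsto[OF this cond_exp_correction_tendsto]
  have "(\<lambda>N. cw_exp w N (\<lambda>\<sigma>. (correction N \<sigma>)\<^sup>2)) \<longlonglongrightarrow> 0" by simp
  from tendsto_real_sqrt[OF this]
  have lim: "(\<lambda>N. sqrt (cw_exp w N (\<lambda>\<sigma>. (correction N \<sigma>)\<^sup>2))) \<longlonglongrightarrow> 0" by simp
  have le: "cw_exp w N (\<lambda>\<sigma>. \<bar>correction N \<sigma>\<bar>) \<le> sqrt (cw_exp w N (\<lambda>\<sigma>. (correction N \<sigma>)\<^sup>2))" for N
    unfolding cw_exp_def real_scaleR_def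
    using sum_abs_le_sqrt_sum_square[where A = "configs N" and p = "cw_measure w N (1 / nu w N) 0" and X = "correction N"]
      cw_measure_nonneg sum_cw_measure by blast
  have ge: "0 \<le> cw_exp w N (\<lambda>\<sigma>. \<bar>correction N \<sigma>\<bar>)" for N
    unfolding cw_exp_def by (intro sum_nonneg) (simp add: cw_measure_nonneg)
  show ?thesis
    by (rule tendsto_sandwich[OF _ _ tendsto_const lim]) (use le ge in auto)
qed

text \<open>A bounded correction makes |exp (- correction) - 1| at most a constant times its
  modulus, so smallness in mean suffices.\<close>

lemma cw_exp_tilt_tendsto:
  fixes h :: "nat \<Rightarrow> (nat \<Rightarrow> real) \<Rightarrow> 'b::{banach, second_countable_topology}"
  assumes h: "\<And>N \<sigma>. \<sigma> \<in> configs N \<Longrightarrow> norm (h N \<sigma>) \<le> 1"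
    and lim: "(\<lambda>N. cw_exp w N (h N)) \<longlonglongrightarrow> L"
  shows "(\<lambda>N. cw_exp w N (\<lambda>\<sigma>. exp (- correction N \<sigma>) *\<^sub>R h N \<sigma>)) \<longlonglongrightarrow> L"
proof -
  from correction_bounded obtain B where B: "\<And>N \<sigma>. \<sigma> \<in> configs N \<Longrightarrow> \<bar>correction N \<sigma>\<bar> \<le> B" by blast
  have bound: "norm (cw_exp w N (\<lambda>\<sigma>. exp (- correction N \<sigma>) *\<^sub>R h N \<sigma>) - cw_exp w N (h N)) \<le>
      exp B * cw_exp w N (\<lambda>\<sigma>. \<bar>correction N \<sigma>\<bar>)" for N
  proof -
    let ?P = "cw_measure w N (1 / nu w N) 0"
    have eq: "cw_exp w N (\<lambda>\<sigma>. exp (- correction N \<sigma>) *\<^sub>R h N \<sigma>) - cw_exp w N (h N) =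
        (\<Sum>\<sigma>\<in>configs N. ?P \<sigma> *\<^sub>R ((exp (- correction N \<sigma>) - 1) *\<^sub>R h N \<sigma>))"
      unfolding cw_exp_def sum_subtractf[symmetric] by (simp add: algebra_simps)
    have "norm (cw_exp w N (\<lambda>\<sigma>. exp (- correction N \<sigma>) *\<^sub>R h N \<sigma>) - cw_exp w N (h N)) \<le>
        (\<Sum>\<sigma>\<in>configs N. ?P \<sigma> * (exp B * \<bar>correction N \<sigma>\<bar>))"
      unfolding eq
    proof (intro order.trans[OF norm_sum] sum_mono)
      fix \<sigma> assume \<sigma>: "\<sigma> \<in> configs N"
      have "\<bar>exp (- correction N \<sigma>) - 1\<bar> \<le> exp \<bar>correction N \<sigma>\<bar> * \<bar>correction N \<sigma>\<bar>"
        using abs_exp_minus_one_le[of "- correction N \<sigma>"] by simp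
      also have "\<dots> \<le> exp B * \<bar>correction N \<sigma>\<bar>"
        using B[OF \<sigma>] by (intro mult_right_mono) auto
      finally have "\<bar>exp (- correction N \<sigma>) - 1\<bar> * norm (h N \<sigma>) \<le> exp B * \<bar>correction N \<sigma>\<bar> * 1"
        using h[OF \<sigma>] by (intro mult_mono) auto
      then have "?P \<sigma> * (\<bar>exp (- correction N \<sigma>) - 1\<bar> * norm (h N \<sigma>)) \<le> ?P \<sigma> * (exp B * \<bar>correction N \<sigma>\<bar>)"
        by (intro mult_left_mono cw_measure_nonneg) simp
      then show "norm (?P \<sigma> *\<^sub>R ((exp (- correction N \<sigma>) - 1) *\<^sub>R h N \<sigma>)) \<le> ?P \<sigma> * (exp B * \<bar>correction N \<sigma>\<bar>)"
        unfolding norm_scaleR abs_of_nonneg[OF cw_measure_nonneg] .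
    qed
    also have "\<dots> = exp B * cw_exp w N (\<lambda>\<sigma>. \<bar>correction N \<sigma>\<bar>)"
      unfolding cw_exp_def real_scaleR_def sum_distrib_left by (intro sum.cong refl) simp
    finally show ?thesis .
  qed
  have "(\<lambda>N. exp B * cw_exp w N (\<lambda>\<sigma>. \<bar>correction N \<sigma>\<bar>)) \<longlonglongrightarrow> exp B * 0"
    by (rule tendsto_mult[OF tendsto_const cw_exp_correction_tendsto])
  then have "(\<lambda>N. exp B * cw_exp w N (\<lambda>\<sigma>. \<bar>correction N \<sigma>\<bar>)) \<longlonglongrightarrow> 0" by simp
  from Lim_null_comparison[OF always_eventually this, rule_format, OF bound]
  have "(\<lambda>N. cw_exp w N (\<lambda>\<sigma>. exp (- correction N \<sigma>) *\<^sub>R h N \<sigma>) - cw_exp w N (h N)) \<longlonglongrightarrow> 0" .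
  from tendsto_add[OF this lim] show ?thesis by simp
qed

lemma annealed_sum_eq:
  fixes h :: "(nat \<Rightarrow> real) \<Rightarrow> 'b::real_normed_vector"
  shows "(\<Sum>\<sigma>\<in>configs N. annealed_ising w N (crit_beta N) 0 \<sigma> *\<^sub>R h \<sigma>) =
    (1 / cw_exp w N (\<lambda>\<sigma>. exp (- correction N \<sigma>))) *\<^sub>R cw_exp w N (\<lambda>\<sigma>. exp (- correction N \<sigma>) *\<^sub>R h \<sigma>)"
proof -
  have "annealed_ising w N (crit_beta N) 0 \<sigma> =
      cw_measure w N (1 / nu w N) 0 \<sigma> * exp (- correction N \<sigma>) / cw_exp w N (\<lambda>\<sigma>. exp (- correction N \<sigma>))"
    if "\<sigma> \<in> configs N" for \<sigma>
  proof -
    have "sinh (crit_beta N) = 1 / nu w N" unfolding crit_beta_def by (rule sinh_arsinh_real)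
    then show ?thesis
      using annealed_ising_eq[where w = w and \<beta> = "crit_beta N", OF pos that]
      unfolding cw_exp_def correction_def real_scaleR_def by simp
  qed
  then have "(\<Sum>\<sigma>\<in>configs N. annealed_ising w N (crit_beta N) 0 \<sigma> *\<^sub>R h \<sigma>) =
      (\<Sum>\<sigma>\<in>configs N. (1 / cw_exp w N (\<lambda>\<sigma>. exp (- correction N \<sigma>))) *\<^sub>R
        (cw_measure w N (1 / nu w N) 0 \<sigma> *\<^sub>R (exp (- correction N \<sigma>) *\<^sub>R h \<sigma>)))"
    by (intro sum.cong refl) simp
  also have "\<dots> = (1 / cw_exp w N (\<lambda>\<sigma>. exp (- correction N \<sigma>))) *\<^sub>R cw_exp w N (\<lambda>\<sigma>. exp (- correction N \<sigma>) *\<^sub>R h \<sigma>)"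
    unfolding scaleR_sum_right[symmetric] cw_exp_def ..
  finally show ?thesis .
qed

lemma cw_exp_tilt_pos: "0 < cw_exp w N (\<lambda>\<sigma>. exp (- correction N \<sigma>))"
  unfolding cw_exp_def cw_measure_def using sum_cw_weight_pos[of w N "1 / nu w N" 0]
  by (intro sum_pos) (auto simp: cw_weight_def)

theorem scaling_limit_annealed:
  assumes "a = \<delta> / (\<delta> + 1)"
  shows "scaling_limit (\<lambda>N. annealed_ising w N (arsinh (1 / nu w N)) 0) \<delta> f"
  unfolding crit_beta_def[symmetric]
proof (rule scaling_limitI[OF _ _ _ assms])
  show "0 \<le> annealed_ising w N (crit_beta N) 0 \<sigma>" for N \<sigma>
    unfolding annealed_ising_def
    by (intro divide_nonneg_nonneg integral_nonneg_AE) (auto simp: Z_graph_def intro!: sum_nonneg)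
  show "(\<Sum>\<sigma>\<in>configs N. annealed_ising w N (crit_beta N) 0 \<sigma>) = 1" for N
    using annealed_sum_eq[of N "\<lambda>_. 1::real"] cw_exp_tilt_pos[of N] by simp
  fix \<theta> :: real
  let ?h = "\<lambda>N \<sigma>. iexp (\<theta> * (spin_sum N \<sigma> / real N powr a))"
  have 1: "(\<lambda>N. cw_exp w N (\<lambda>\<sigma>. exp (- correction N \<sigma>) *\<^sub>R ?h N \<sigma>)) \<longlonglongrightarrow>
      (1 / (\<integral>z. exp (- f z) \<partial>lborel)) *\<^sub>R (\<integral>z. exp (- f z) *\<^sub>R iexp (\<theta> * z) \<partial>lborel)"
    by (rule cw_exp_tilt_tendsto[where h = ?h, OF _ cw_exp_iexp_tendsto]) (simp only: norm_iexp order_refl)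
  \<comment> \<open>The normaliser of the tilted measure is the tilt applied to the constant
    1.\<close>
  have "(\<lambda>N. cw_exp w N (\<lambda>\<sigma>. 1::real)) \<longlonglongrightarrow> 1"
    by (simp add: cw_exp_def sum_cw_measure)
  from cw_exp_tilt_tendsto[where h = "\<lambda>_ _. 1::real", OF _ this]
  have "(\<lambda>N. cw_exp w N (\<lambda>\<sigma>. exp (- correction N \<sigma>))) \<longlonglongrightarrow> 1" by simp
  from tendsto_scaleR[OF tendsto_divide[OF tendsto_const[of 1] this] 1]
  show "(\<lambda>N. \<Sum>\<sigma>\<in>configs N. annealed_ising w N (crit_beta N) 0 \<sigma> *\<^sub>R ?h N \<sigma>) \<longlonglongrightarrow>
      (1 / (\<integral>z. exp (- f z) \<partial>lborel)) *\<^sub>R (\<integral>z. exp (- f z) *\<^sub>R iexp (\<theta> * z) \<partial>lborel)"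
    unfolding annealed_sum_eq by simp
qed

end

subsection \<open>Finite fourth moment\<close>

text \<open>The upper quartic bound for \<open>phi\<close> is global and uses the full fourth
  moment. The lower one needs |u| \<le> 1, so the weights are truncated at K, which by monotonicity
  only lowers the rate; K is removed at the end through the limit law.\<close>

lemma rate_tendsto_f_case1:
  assumes pos: "\<And>N i. i \<in> {1..N} \<Longrightarrow> 0 < w N i" and reg: "weight_regular w \<mu>"
    and int4: "integrable \<mu> (\<lambda>x. x ^ 4)" and m4: "(\<lambda>N. moment w N 4) \<longlonglongrightarrow> (\<integral>x. x ^ 4 \<partial>\<mu>)"
  shows "(\<lambda>N. rate w (3/4) N z) \<longlonglongrightarrow> f_case1 \<mu> z"
proof -
  have dist: "real_distribution \<mu>" and EW: "0 < (\<integral>x. x \<partial>\<mu>)"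
    using reg by (auto simp: weight_regular_def)
  note m1 = first_moment_tendsto[OF pos reg]
  define \<kappa> where "\<kappa> N = real N powr (3/4) / total_weight w N" for N
  have slope: "slope w (3/4) N i = w N i * \<kappa> N" for N i
    by (simp add: slope_def \<kappa>_def)
  have tw: "total_weight w N = real N * moment w N 1" for N
    by (simp add: total_weight_def moment_def)
  have twpos: "0 < total_weight w N" if "0 < N" for N
    unfolding total_weight_def using that by (intro sum_pos pos) auto
  have \<kappa>_pos: "0 < \<kappa> N" if "0 < N" for N
    using twpos[OF that] that by (simp add: \<kappa>_def)
  \<comment> \<open>This is where 3/4 comes from: \<kappa>^4 is 1/N up to the mean, which turns the
    sum of fourth powers into a moment.\<close>
  have \<kappa>4: "\<kappa> N ^ 4 = 1 / (real N * moment w N 1 ^ 4)" if "0 < N" for N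
  proof -
    have "(real N powr (3/4)) ^ 4 = real N ^ 3"
    proof -
      have "(real N powr (3/4)) ^ 4 = (real N powr (3/4)) powr real 4"
        by (rule powr_realpow[symmetric]) (use that in simp)
      also have "\<dots> = real N powr (3/4 * real 4)" by (rule powr_powr)
      also have "\<dots> = real N ^ 3" by simp
      finally show ?thesis .
    qed
    then show ?thesis
      using that by (simp add: \<kappa>_def tw power_divide power_mult_distrib eval_nat_numeral)
  qed
  have \<kappa>0: "\<kappa> \<longlonglongrightarrow> 0"
  proof -
    have "(\<lambda>N. real N powr (- 1/4) / moment w N 1) \<longlonglongrightarrow> 0 / (\<integral>x. x \<partial>\<mu>)"
      using EW by (intro tendsto_divide m1 tendsto_neg_powr filterlim_real_sequentially) auto
    moreover have "eventually (\<lambda>N. real N powr (- 1/4) / moment w N 1 = \<kappa> N) sequentially"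
      using eventually_gt_at_top[of 0]
    proof eventually_elim
      case (elim N)
      have "real N powr (3/4) = real N * real N powr (- 1/4)"
        using elim powr_add[of "real N" 1 "- 1/4"] by simp
      then show ?case using elim by (simp add: \<kappa>_def tw)
    qed
    ultimately show ?thesis by (simp add: Lim_transform_eventually)
  qed
  define U where "U N = z ^ 4 / 12 * (moment w N 4 / moment w N 1 ^ 4)" for N
  have "U \<longlonglongrightarrow> z ^ 4 / 12 * ((\<integral>x. x ^ 4 \<partial>\<mu>) / (\<integral>x. x \<partial>\<mu>) ^ 4)"
    unfolding U_def using EW by (intro tendsto_intros m1 m4) auto
  then have U: "U \<longlonglongrightarrow> f_case1 \<mu> z"
    by (simp add: f_case1_def mult_ac)
  have le_U: "rate w (3/4) N z \<le> U N" if "0 < N" for N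
  proof -
    have "rate w (3/4) N z \<le> (\<Sum>i=1..N. (slope w (3/4) N i * z) ^ 4 / 12)"
      unfolding rate_def by (intro sum_mono phi_le_quartic)
    also have "\<dots> = z ^ 4 / 12 * (\<kappa> N ^ 4 * (\<Sum>i=1..N. w N i ^ 4))"
      by (simp add: slope power_mult_distrib sum_distrib_left mult_ac)
    also have "\<dots> = U N"
      using that by (simp add: U_def \<kappa>4[OF that] moment_def)
    finally show ?thesis .
  qed
  \<comment> \<open>In the lower bound u^6/45 is absorbed through u^2 \<le> (K \<kappa> z)^2,
    leaving a multiple of u^4 whose factor tends to 1/12.\<close>
  define L where "L K N = (1/12 - (K * \<kappa> N * z)\<^sup>2 / 45) * z ^ 4 *
      ((\<Sum>i=1..N. min (w N i) K ^ 4) / real N / moment w N 1 ^ 4)" for K N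
  have L: "L K \<longlonglongrightarrow> z ^ 4 / 12 * ((\<integral>x. min \<bar>x\<bar> K ^ 4 \<partial>\<mu>) / (\<integral>x. x \<partial>\<mu>) ^ 4)" if "0 \<le> K" for K
  proof -
    have "L K \<longlonglongrightarrow> (1/12 - (K * 0 * z)\<^sup>2 / 45) * z ^ 4 * ((\<integral>x. min \<bar>x\<bar> K ^ 4 \<partial>\<mu>) / (\<integral>x. x \<partial>\<mu>) ^ 4)"
      unfolding L_def using EW that
      by (intro tendsto_mult tendsto_diff tendsto_divide tendsto_power tendsto_const \<kappa>0 m1
            truncated_average_tendsto[OF pos reg]) auto
    then show ?thesis by simp
  qed
  have L_le: "eventually (\<lambda>N. L K N \<le> rate w (3/4) N z) sequentially" if K: "0 \<le> K" for K
  proof -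
    have "(\<lambda>N. K * \<kappa> N * \<bar>z\<bar>) \<longlonglongrightarrow> K * 0 * \<bar>z\<bar>"
      by (intro tendsto_mult tendsto_const \<kappa>0)
    then have "eventually (\<lambda>N. K * \<kappa> N * \<bar>z\<bar> < 1) sequentially"
      by (rule order_tendstoD) simp
    then show ?thesis
      using eventually_gt_at_top[of 0]
    proof eventually_elim
      case (elim N)
      have \<kappa>: "0 < \<kappa> N" using elim \<kappa>_pos by blast
      have "L K N = (1/12 - (K * \<kappa> N * z)\<^sup>2 / 45) * z ^ 4 * (\<kappa> N ^ 4 * (\<Sum>i=1..N. min (w N i) K ^ 4))"
        using elim \<kappa>4[of N] by (simp add: L_def mult_ac)
      also have "\<dots> = (\<Sum>i=1..N. (1/12 - (K * \<kappa> N * z)\<^sup>2 / 45) * (min (w N i) K * \<kappa> N * z) ^ 4)"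
        unfolding sum_distrib_left by (intro sum.cong refl) (simp add: power_mult_distrib mult_ac)
      also have "\<dots> \<le> rate w (3/4) N z"
        unfolding rate_def
      proof (rule sum_mono)
        fix i assume i: "i \<in> {1..N}"
        define u where "u = min (w N i) K * \<kappa> N * z"
        have m: "0 \<le> min (w N i) K" "min (w N i) K \<le> K" "min (w N i) K \<le> w N i"
          using pos[OF i] K by auto
        have u: "\<bar>u\<bar> \<le> K * \<kappa> N * \<bar>z\<bar>" "\<bar>u\<bar> \<le> \<bar>slope w (3/4) N i * z\<bar>"
          using m \<kappa> pos[OF i] by (auto simp: u_def slope abs_mult intro!: mult_right_mono)
        have "u\<^sup>2 \<le> (K * \<kappa> N * \<bar>z\<bar>)\<^sup>2"
          using power_mono[OF u(1), of 2] by simp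
        then have "u\<^sup>2 * u ^ 4 \<le> (K * \<kappa> N * z)\<^sup>2 * u ^ 4"
          by (intro mult_right_mono) (auto simp: power_mult_distrib)
        then have "(1/12 - (K * \<kappa> N * z)\<^sup>2 / 45) * u ^ 4 \<le> u ^ 4 / 12 - u ^ 6 / 45"
          by (simp add: left_diff_distrib flip: power_add)
        also have "\<dots> \<le> phi u" using u(1) elim by (intro phi_ge_quartic) simp
        also have "\<dots> \<le> phi (slope w (3/4) N i * z)" using u(2) by (rule phi_mono_abs)
        finally show "(1/12 - (K * \<kappa> N * z)\<^sup>2 / 45) * (min (w N i) K * \<kappa> N * z) ^ 4 \<le> phi (slope w (3/4) N i * z)"
          unfolding u_def .
      qed
      finally show ?case .
    qed
  qed
  show ?thesis
  proof (rule order_tendstoI)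
    fix y assume "f_case1 \<mu> z < y"
    with U have "eventually (\<lambda>N. U N < y) sequentially" by (rule order_tendstoD)
    then show "eventually (\<lambda>N. rate w (3/4) N z < y) sequentially"
      using eventually_gt_at_top[of 0] by eventually_elim (rule le_less_trans[OF le_U])
  next
    fix y assume y: "y < f_case1 \<mu> z"
    have "(\<lambda>n. z ^ 4 / 12 * ((\<integral>x. min \<bar>x\<bar> (real n) ^ 4 \<partial>\<mu>) / (\<integral>x. x \<partial>\<mu>) ^ 4)) \<longlonglongrightarrow>
        z ^ 4 / 12 * ((\<integral>x. x ^ 4 \<partial>\<mu>) / (\<integral>x. x \<partial>\<mu>) ^ 4)"
      using EW by (intro tendsto_mult tendsto_divide tendsto_const truncated_moment_tendsto dist int4) auto
    moreover have "y < z ^ 4 / 12 * ((\<integral>x. x ^ 4 \<partial>\<mu>) / (\<integral>x. x \<partial>\<mu>) ^ 4)"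
      using y by (simp add: f_case1_def mult_ac)
    ultimately have "eventually (\<lambda>n. y < z ^ 4 / 12 * ((\<integral>x. min \<bar>x\<bar> (real n) ^ 4 \<partial>\<mu>) / (\<integral>x. x \<partial>\<mu>) ^ 4)) sequentially"
      by (rule order_tendstoD)
    from eventually_happens'[OF sequentially_bot this] obtain n :: nat
      where n: "y < z ^ 4 / 12 * ((\<integral>x. min \<bar>x\<bar> (real n) ^ 4 \<partial>\<mu>) / (\<integral>x. x \<partial>\<mu>) ^ 4)" by blast
    have "eventually (\<lambda>N. y < L (real n) N) sequentially"
      by (rule order_tendstoD(1)[OF L[OF of_nat_0_le_iff] n])
    with L_le[OF of_nat_0_le_iff[of n]] show "eventually (\<lambda>N. y < rate w (3/4) N z) sequentially"
      by eventually_elim linarith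
  qed
qed

lemma critical_scaling_case1:
  assumes pos: "\<And>N i. i \<in> {1..N} \<Longrightarrow> 0 < w N i" and reg: "weight_regular w \<mu>"
    and int4: "integrable \<mu> (\<lambda>x. x ^ 4)" and m4: "(\<lambda>N. moment w N 4) \<longlonglongrightarrow> (\<integral>x. x ^ 4 \<partial>\<mu>)"
  shows "critical_scaling w \<mu> (3/4) (f_case1 \<mu>)"
proof
  show "0 < f_case1 \<mu> 1"
    using reg int4 integral_even_power_pos[of \<mu> 4] by (auto simp: weight_regular_def f_case1_def)
qed (use assms rate_tendsto_f_case1[OF assms] in auto)

lemma f_case1_asymptotics:
  "((\<lambda>x. f_case1 \<mu> x / x powr (1 + 3)) \<longlongrightarrow> 1/12 * (\<integral>y. y ^ 4 \<partial>\<mu>) / (\<integral>y. y \<partial>\<mu>) ^ 4) at_top"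
proof (rule tendsto_eventually)
  show "eventually (\<lambda>x. f_case1 \<mu> x / x powr (1 + 3) = 1/12 * (\<integral>y. y ^ 4 \<partial>\<mu>) / (\<integral>y. y \<partial>\<mu>) ^ 4) at_top"
    using eventually_gt_at_top[of 0]
    by eventually_elim (simp add: f_case1_def powr_numeral)
qed

subsection \<open>Power-law weights\<close>

text \<open>Telescoping i^(1-s) with the mean value theorem, a discrete comparison with the integral
  of y^(-s).\<close>

lemma powr_sum_bounds:
  assumes "0 < s" "s < 1"
  shows "(1 - s) * (\<Sum>i=1..N. real i powr (- s)) \<le> real N powr (1 - s)"
    and "real N powr (1 - s) - 1 \<le> (1 - s) * (\<Sum>i=1..N. real i powr (- s))"
proof -
  have mvt: "(1 - s) * real (Suc i) powr (- s) \<le> real (Suc i) powr (1 - s) - real i powr (1 - s)" for i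
  \<comment> \<open>The derivative is singular at 0; there the claim reads 1 - s \<le> 1, because
    \<open>0 powr (1 - s)\<close> is 0.\<close>
  proof (cases "i = 0")
    case False
    have "\<exists>y. real i < y \<and> y < real (Suc i) \<and>
        real (Suc i) powr (1 - s) - real i powr (1 - s) = (real (Suc i) - real i) * ((1 - s) * y powr (- s))"
      using False by (intro MVT2) (auto intro!: derivative_eq_intros)
    then obtain y where y: "real i < y" "y < real (Suc i)"
      "real (Suc i) powr (1 - s) - real i powr (1 - s) = (1 - s) * y powr (- s)" by auto
    have "real (Suc i) powr (- s) \<le> y powr (- s)"
      using y assms by (intro powr_mono2') auto
    then show ?thesis using y(3) assms by simp
  qed (use assms in simp)
  show "(1 - s) * (\<Sum>i=1..N. real i powr (- s)) \<le> real N powr (1 - s)"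
  proof (induction N)
    case (Suc N)
    then show ?case using mvt[of N] by (simp add: distrib_left)
  qed simp
  have mvt': "real (Suc i) powr (1 - s) - real i powr (1 - s) \<le> (1 - s) * real i powr (- s)" if "0 < i" for i
  proof -
    have "\<exists>y. real i < y \<and> y < real (Suc i) \<and>
        real (Suc i) powr (1 - s) - real i powr (1 - s) = (real (Suc i) - real i) * ((1 - s) * y powr (- s))"
      using that by (intro MVT2) (auto intro!: derivative_eq_intros)
    then obtain y where y: "real i < y" "y < real (Suc i)"
      "real (Suc i) powr (1 - s) - real i powr (1 - s) = (1 - s) * y powr (- s)" by auto
    have "y powr (- s) \<le> real i powr (- s)"
      using y assms that by (intro powr_mono2') auto
    then show ?thesis using y(3) assms by simp
  qed
  \<comment> \<open>The comparison with the left endpoint is available only for i > 0, so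
    telescoping starts at 1, which is the origin of the - 1.\<close>
  have "real (Suc N) powr (1 - s) - 1 \<le> (1 - s) * (\<Sum>i=1..N. real i powr (- s))"
  proof (induction N)
    case (Suc N)
    then show ?case using mvt'[of "Suc N"] by (simp add: distrib_left)
  qed simp
  moreover have "real N powr (1 - s) \<le> real (Suc N) powr (1 - s)"
    using assms by (intro powr_mono2) auto
  ultimately show "real N powr (1 - s) - 1 \<le> (1 - s) * (\<Sum>i=1..N. real i powr (- s))"
    by linarith
qed

lemma powr_sum_tendsto:
  assumes "0 < s" "s < 1"
  shows "(\<lambda>N. (\<Sum>i=1..N. real i powr (- s)) / real N powr (1 - s)) \<longlonglongrightarrow> 1 / (1 - s)"
proof -
  let ?X = "\<lambda>N. (1 - s) * (\<Sum>i=1..N. real i powr (- s)) / real N powr (1 - s)"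
  have "(\<lambda>N. 1 - real N powr (- (1 - s))) \<longlonglongrightarrow> 1 - 0"
    using assms by (intro tendsto_diff tendsto_const tendsto_neg_powr filterlim_real_sequentially) auto
  then have low: "(\<lambda>N. 1 - real N powr (- (1 - s))) \<longlonglongrightarrow> 1"
    by (simp only: diff_zero)
  have "?X \<longlonglongrightarrow> 1"
  proof (rule tendsto_sandwich[OF _ _ low tendsto_const])
    show "eventually (\<lambda>N. 1 - real N powr (- (1 - s)) \<le> ?X N) sequentially"
      using eventually_gt_at_top[of 0]
    proof eventually_elim
      case (elim N)
      have "1 - real N powr (- (1 - s)) = (real N powr (1 - s) - 1) / real N powr (1 - s)"
        using elim by (simp only: powr_minus) (simp add: diff_divide_distrib inverse_eq_divide)
      also have "\<dots> \<le> ?X N"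
        using powr_sum_bounds(2)[OF assms] by (intro divide_right_mono) auto
      finally show ?case .
    qed
    show "eventually (\<lambda>N. ?X N \<le> 1) sequentially"
      using eventually_gt_at_top[of 0]
      by eventually_elim (use powr_sum_bounds(1)[OF assms] in \<open>simp add: divide_le_eq\<close>)
  qed
  from tendsto_divide[OF this tendsto_const[of "1 - s"]] assms show ?thesis by simp
qed

lemma f_case2_term_eq: "f_case2_term \<tau> x i = phi ((\<tau> - 2) / (\<tau> - 1) * x * real i powr (- 1 / (\<tau> - 1)))"
  by (simp add: f_case2_term_def phi_def Let_def)

text \<open>Fourth powers give the exponent 4/(\<tau> - 1), which exceeds 1 because \<tau> <
  5.\<close>

lemma summable_quartic_powr:
  assumes "3 < \<tau>" "\<tau> < 5"
  shows "summable (\<lambda>k. (c * real (Suc k) powr (- 1 / (\<tau> - 1))) ^ 4 / 12)"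
proof -
  have "summable (\<lambda>k. real k powr (- 4 / (\<tau> - 1)))"
    using assms by (subst summable_real_powr_iff) (simp add: field_simps)
  then have "summable (\<lambda>k. c ^ 4 / 12 * real (Suc k) powr (- 4 / (\<tau> - 1)))"
    by (intro summable_mult) (subst summable_Suc_iff)
  then show ?thesis
    by (simp add: power_mult_distrib powr_power)
qed

lemma summable_f_case2:
  assumes "3 < \<tau>" "\<tau> < 5"
  shows "summable (\<lambda>k. f_case2_term \<tau> x (Suc k))"
  unfolding f_case2_term_eq
  by (rule summable_comparison_test'[OF summable_quartic_powr[OF assms, of "(\<tau> - 2) / (\<tau> - 1) * x"]])
     (simp only: real_norm_def abs_of_nonneg[OF phi_nonneg] phi_le_quartic)

lemma f_case2_pos:
  assumes "3 < \<tau>" "\<tau> < 5" "0 < x"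
  shows "0 < f_case2 \<tau> x"
  unfolding f_case2_def
  by (rule suminf_pos[OF summable_f_case2[OF assms(1,2)]])
     (use assms in \<open>auto simp: f_case2_term_eq intro!: phi_pos\<close>)

text \<open>The constant c cancels from the slopes, which equal \<kappa>_N i^(-1/(\<tau>-1)) with
  \<kappa>_N tending to (\<tau>-2)/(\<tau>-1). Each term of the rate converges, and the quartic
  bound for \<open>phi\<close> supplies a summable majorant for Tannery's theorem.\<close>

lemma rate_tendsto_f_case2:
  assumes c: "0 < c" and \<tau>: "3 < \<tau>" "\<tau> < 5"
    and w: "\<And>N i. i \<in> {1..N} \<Longrightarrow> w N i = c * (real N / real i) powr (1 / (\<tau> - 1))"
  shows "(\<lambda>N. rate w ((\<tau> - 2) / (\<tau> - 1)) N z) \<longlonglongrightarrow> f_case2 \<tau> z"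
proof -
  define s where "s = 1 / (\<tau> - 1)"
  define a where "a = (\<tau> - 2) / (\<tau> - 1)"
  have s: "0 < s" "s < 1" and as: "a = 1 - s" using \<tau> by (auto simp: s_def a_def field_simps)
  have w': "w N i = c * real N powr s * real i powr (- s)" if "i \<in> {1..N}" for N i
    unfolding w[OF that] s_def[symmetric] by (simp add: powr_divide powr_minus field_simps)
  have tw: "total_weight w N = c * real N powr s * (\<Sum>i=1..N. real i powr (- s))" for N
    by (simp add: total_weight_def w' sum_distrib_left)
  define \<kappa> where "\<kappa> N = real N powr (1 - s) / (\<Sum>i=1..N. real i powr (- s))" for N
  have "(\<lambda>N. inverse ((\<Sum>i=1..N. real i powr (- s)) / real N powr (1 - s))) \<longlonglongrightarrow> inverse (1 / (1 - s))"
    using s by (intro tendsto_inverse powr_sum_tendsto) auto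
  then have \<kappa>: "\<kappa> \<longlonglongrightarrow> a" by (simp add: \<kappa>_def[abs_def] as)
  have slope: "slope w a N i = \<kappa> N * real i powr (- s)" if "i \<in> {1..N}" for N i
    using that c by (simp add: slope_def tw w' \<kappa>_def as)
  \<comment> \<open>Extension by zero beyond N makes the finite sums series over a fixed index
    set.\<close>
  define g where "g k N = (if k < N then phi (\<kappa> N * real (Suc k) powr (- s) * z) else 0)" for k N
  have rate: "rate w a N z = (\<Sum>k. g k N)" for N
  proof -
    have "rate w a N z = (\<Sum>i=1..N. phi (\<kappa> N * real i powr (- s) * z))"
      unfolding rate_def by (intro sum.cong refl) (simp add: slope)
    also have "\<dots> = (\<Sum>k<N. phi (\<kappa> N * real (Suc k) powr (- s) * z))"
      by (rule sum.reindex_bij_witness[of _ Suc "\<lambda>i. i - 1"]) auto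
    also have "\<dots> = (\<Sum>k<N. g k N)" by (simp add: g_def)
    also have "\<dots> = (\<Sum>k. g k N)"
      by (rule suminf_finite[symmetric]) (auto simp: g_def)
    finally show ?thesis .
  qed
  obtain M where M: "\<And>N. \<bar>\<kappa> N\<bar> \<le> M"
    using convergent_imp_Bseq[of \<kappa>] \<kappa> by (auto simp: convergent_def Bseq_def)
  have "0 \<le> M" using M[of 0] by linarith
  have bound: "norm (g k N) \<le> (M * \<bar>z\<bar> * real (Suc k) powr (- 1 / (\<tau> - 1))) ^ 4 / 12" for k N
  proof (cases "k < N")
    case True
    have "phi (\<kappa> N * real (Suc k) powr (- s) * z) \<le> (\<kappa> N * real (Suc k) powr (- s) * z) ^ 4 / 12"
      by (rule phi_le_quartic)
    also have "\<dots> = \<bar>\<kappa> N * real (Suc k) powr (- s) * z\<bar> ^ 4 / 12" by simp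
    also have "\<dots> \<le> (M * \<bar>z\<bar> * real (Suc k) powr (- s)) ^ 4 / 12"
      using mult_right_mono[OF M[of N], of "\<bar>z\<bar> * real (Suc k) powr (- s)"]
      by (intro divide_right_mono power_mono) (auto simp: abs_mult mult_ac)
    finally show ?thesis using True by (simp add: g_def s_def)
  qed (simp add: g_def \<open>0 \<le> M\<close>)
  have lim: "(\<lambda>N. g k N) \<longlonglongrightarrow> f_case2_term \<tau> z (Suc k)" for k
  proof -
    have "(\<lambda>N. phi (\<kappa> N * real (Suc k) powr (- s) * z)) \<longlonglongrightarrow> phi (a * real (Suc k) powr (- s) * z)"
      by (rule isCont_tendsto_compose[OF DERIV_isCont[OF has_real_derivative_phi]])
         (intro tendsto_mult tendsto_const \<kappa>)
    moreover have "eventually (\<lambda>N. phi (\<kappa> N * real (Suc k) powr (- s) * z) = g k N) sequentially"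
      using eventually_gt_at_top[of k] by eventually_elim (simp add: g_def)
    moreover have "phi (a * real (Suc k) powr (- s) * z) = f_case2_term \<tau> z (Suc k)"
      by (simp add: f_case2_term_eq a_def s_def mult_ac)
    ultimately show ?thesis by (simp add: Lim_transform_eventually)
  qed
  have "(\<lambda>N. \<Sum>k. g k N) \<longlonglongrightarrow> (\<Sum>k. f_case2_term \<tau> z (Suc k))"
  proof -
    have "eventually (\<lambda>(k, N). norm (g k N) \<le> (M * \<bar>z\<bar> * real (Suc k) powr (- 1 / (\<tau> - 1))) ^ 4 / 12)
        (at_top \<times>\<^sub>F sequentially)"
      unfolding case_prod_unfold by (intro always_eventually allI bound)
    from tannerys_theorem[OF lim this summable_quartic_powr[OF \<tau>] sequentially_bot]
    show ?thesis by blast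
  qed
  then show ?thesis unfolding rate[symmetric] a_def f_case2_def .
qed

lemma critical_scaling_case2:
  assumes pos: "\<And>N i. i \<in> {1..N} \<Longrightarrow> 0 < w N i" and reg: "weight_regular w \<mu>"
    and c: "0 < c" and \<tau>: "3 < \<tau>" "\<tau> < 5"
    and w: "\<And>N i. i \<in> {1..N} \<Longrightarrow> w N i = c * (real N / real i) powr (1 / (\<tau> - 1))"
  shows "critical_scaling w \<mu> ((\<tau> - 2) / (\<tau> - 1)) (f_case2 \<tau>)"
proof
  show "0 < f_case2 \<tau> 1" using \<tau> by (intro f_case2_pos) auto
  \<comment> \<open>The lower bound is equivalent to \<tau> > 3.\<close>
  show "1/2 < (\<tau> - 2) / (\<tau> - 1)" "(\<tau> - 2) / (\<tau> - 1) < 1"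
    using \<tau> by (auto simp: field_simps)
qed (use pos reg rate_tendsto_f_case2[OF c \<tau> w] in auto)

section \<open>Growth of the power-law rate function at infinity\<close>

lemma powr_tendsto_0_at_right:
  fixes c p :: real
  assumes "0 < p" "0 \<le> c"
  shows "((\<lambda>h. (c * h) powr p) \<longlongrightarrow> 0) (at_right 0)"
proof (rule tendsto_zero_powrI[OF _ tendsto_const])
  show "((\<lambda>h. c * h) \<longlongrightarrow> 0) (at_right 0)"
    by (auto intro!: tendsto_eq_intros)
  show "eventually (\<lambda>h. 0 \<le> c * h) (at_right 0)"
    using eventually_at_right_less by eventually_elim (use assms in auto)
qed (fact assms(1))

lemma powr_integral_near_0:
  fixes r b :: real
  assumes "- 1 < r" "0 < b"
  shows "set_integrable lborel {0<..<b} (\<lambda>y. y powr r)"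
    and "(LINT y:{0<..<b}|lborel. y powr r) = b powr (r + 1) / (r + 1)"
proof -
  let ?F = "\<lambda>y. y powr (r + 1) / (r + 1)"
  have deriv: "DERIV ?F y :> y powr r" if "0 < y" for y
    using that assms by (auto intro!: derivative_eq_intros)
  have A: "(?F \<longlongrightarrow> 0) (at_right 0)"
    using tendsto_divide[OF powr_tendsto_0_at_right[of "r + 1" 1] tendsto_const[of "r + 1"]] assms by simp
  have B: "(?F \<longlongrightarrow> ?F b) (at_left b)"
    using assms by (intro tendsto_intros) auto
  note FTC = interval_integral_FTC_nonneg[of "ereal 0" "ereal b" ?F "\<lambda>y. y powr r" 0 "?F b"]
  show "set_integrable lborel {0<..<b} (\<lambda>y. y powr r)"
    using FTC(1) deriv A B assms by (simp add: ereal_tendsto_simps continuous_intros)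
  show "(LINT y:{0<..<b}|lborel. y powr r) = b powr (r + 1) / (r + 1)"
    using FTC(2) deriv A B assms
    by (simp add: ereal_tendsto_simps continuous_intros interval_lebesgue_integral_def)
qed

lemma set_integrable_powr_at_top:
  fixes r :: real
  assumes "r < - 1"
  shows "set_integrable lborel {1<..} (\<lambda>y. y powr r)"
proof -
  let ?F = "\<lambda>y. y powr (r + 1) / (r + 1)"
  have deriv: "DERIV ?F y :> y powr r" if "1 < y" for y
    using that assms by (auto intro!: derivative_eq_intros)
  have A: "(?F \<longlongrightarrow> ?F 1) (at_right 1)"
    using assms by (intro tendsto_intros) auto
  have "((\<lambda>y. y powr (r + 1)) \<longlongrightarrow> 0) at_top"
    using assms by (intro tendsto_neg_powr filterlim_ident) auto
  from tendsto_divide[OF this tendsto_const[of "r + 1"]]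
  have B: "(?F \<longlongrightarrow> 0) at_top" using assms by simp
  show ?thesis
    using interval_integral_FTC_nonneg(1)[of "ereal 1" \<infinity> ?F "\<lambda>y. y powr r" "?F 1" 0] deriv A B
    by (simp add: ereal_tendsto_simps continuous_intros)
qed

text \<open>The right-endpoint value lies below the average over its cell and above the average over
  the next one. \<open>F\<close> may blow up at 0, so the first cell has no upper comparison and its
  integral is the error term.\<close>

lemma decreasing_riemann_sum:
  fixes F :: "real \<Rightarrow> real"
  assumes nonneg: "\<And>y. 0 \<le> F y"
    and decr: "\<And>x y. 0 < x \<Longrightarrow> x \<le> y \<Longrightarrow> F y \<le> F x"
    and int: "set_integrable lborel {0<..} F" and h: "0 < h"
  shows "summable (\<lambda>k. F (real (Suc k) * h))"
    and "h * (\<Sum>k. F (real (Suc k) * h)) \<le> (LINT y:{0<..}|lborel. F y)"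
    and "(LINT y:{0<..}|lborel. F y) - (LINT y:{0<..h}|lborel. F y) \<le> h * (\<Sum>k. F (real (Suc k) * h))"
proof -
  \<comment> \<open>Half-open cells, closed on the right, partition the positive half-line
    exactly.\<close>
  define A where "A k = {real k * h<..real (Suc k) * h}" for k
  define J where "J k = (LINT y:A k|lborel. F y)" for k
  have A0: "A k \<subseteq> {0<..}" for k
  proof -
    have "0 \<le> real k * h" using h by simp
    then show ?thesis unfolding A_def by (auto intro: le_less_trans)
  qed
  have intA: "set_integrable lborel (A k) F" for k
    by (rule set_integrable_subset[OF int _ A0]) (simp add: A_def)
  have un: "(\<Union>k. A k) = {0<..}"
  proof (intro equalityI subsetI)
    fix x :: real assume "x \<in> {0<..}"
    then have "0 < x / h" using h by simp
    define k where "k = nat (\<lceil>x / h\<rceil> - 1)"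
    have "real k < x / h" "x / h \<le> real (Suc k)"
      using \<open>0 < x / h\<close> unfolding k_def by linarith+
    then have "x \<in> A k" using h by (simp add: A_def field_simps)
    then show "x \<in> (\<Union>k. A k)" by blast
  qed (use A0 in blast)
  have disj: "A i \<inter> A j = {}" if "i \<noteq> j" for i j
  proof -
    have *: "A i \<inter> A j = {}" if "i < j" for i j
    proof -
      have "real (Suc i) * h \<le> real j * h"
        using that h by (intro mult_right_mono) auto
      then show ?thesis by (auto simp: A_def)
    qed
    show ?thesis using *[of i j] *[of j i] that by (cases "i < j") auto
  qed
  have IJ: "(LINT y:{0<..}|lborel. F y) = (\<Sum>k. J k)"
    unfolding J_def un[symmetric]
    by (rule lebesgue_integral_countable_add) (auto simp: disj un int, simp add: A_def)
  have J0: "0 \<le> J k" for k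
    unfolding J_def set_lebesgue_integral_def using nonneg by (intro integral_nonneg_AE) auto
  have const: "set_integrable lborel (A k) (\<lambda>_. c)" "(LINT y:A k|lborel. c) = h * c" for k and c :: real
  proof -
    have le: "real k * h \<le> real (Suc k) * h" using h by (intro mult_right_mono) auto
    then show "set_integrable lborel (A k) (\<lambda>_. c)"
      unfolding A_def set_integrable_def by simp
    have "(LINT y:A k|lborel. c) = measure lborel (A k) * c"
      unfolding set_lebesgue_integral_def by simp
    also have "measure lborel (A k) = h"
      using le by (simp add: A_def algebra_simps)
    finally show "(LINT y:A k|lborel. c) = h * c" .
  qed
  have low: "h * F (real (Suc k) * h) \<le> J k" for k
    unfolding const(2)[of k, symmetric] J_def
  proof (rule set_integral_mono[OF const(1) intA])
    fix y assume "y \<in> A k"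
    moreover from this have "0 < y" using A0 by auto
    ultimately show "F (real (Suc k) * h) \<le> F y" by (intro decr) (auto simp: A_def)
  qed
  \<comment> \<open>The index shift pairs a cell with its left endpoint, which is the right endpoint
    of the preceding cell.\<close>
  have up: "J (Suc k) \<le> h * F (real (Suc k) * h)" for k
    unfolding const(2)[of "Suc k", symmetric] J_def
  proof (rule set_integral_mono[OF intA const(1)])
    fix y assume "y \<in> A (Suc k)"
    then show "F y \<le> F (real (Suc k) * h)" using h by (intro decr) (auto simp: A_def)
  qed
  have partial: "(\<Sum>k<n. J k) = (LINT y:{0<..real n * h}|lborel. F y)" for n
  proof (induction n)
    case (Suc n)
    have eq: "{0<..real (Suc n) * h} = {0<..real n * h} \<union> A n"
    proof -
      have "0 \<le> real n * h" "real n * h \<le> real (Suc n) * h"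
        using h by (auto intro: mult_right_mono)
      then show ?thesis by (auto simp: A_def simp del: of_nat_Suc)
    qed
    have "(LINT y:{0<..real (Suc n) * h}|lborel. F y) = (LINT y:{0<..real n * h}|lborel. F y) + J n"
      unfolding eq J_def
      by (rule set_integral_Un[OF _ set_integrable_subset[OF int] intA]) (auto simp: A_def)
    then show ?case using Suc by simp
  qed (simp add: set_lebesgue_integral_def)
  have sumJ: "summable J"
  proof (rule summableI_nonneg_bounded[OF J0])
    fix n
    have "set_integrable lborel {0<..real n * h} F"
      by (rule set_integrable_subset[OF int]) auto
    then show "(\<Sum>k<n. J k) \<le> (LINT y:{0<..}|lborel. F y)"
      unfolding partial set_lebesgue_integral_def
      by (intro integral_mono)
         (use int nonneg in \<open>auto simp: set_integrable_def split: split_indicator\<close>)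
  qed
  have "summable (\<lambda>k. h * F (real (Suc k) * h))"
    by (rule summable_comparison_test'[OF sumJ]) (use low h nonneg in simp)
  then show sumF: "summable (\<lambda>k. F (real (Suc k) * h))"
    using h by (subst (asm) summable_cmult_iff) simp
  have eqF: "h * (\<Sum>k. F (real (Suc k) * h)) = (\<Sum>k. h * F (real (Suc k) * h))"
    by (rule suminf_mult[OF sumF, symmetric])
  show "h * (\<Sum>k. F (real (Suc k) * h)) \<le> (LINT y:{0<..}|lborel. F y)"
    unfolding IJ eqF by (rule suminf_le[OF low summable_mult[OF sumF] sumJ])
  have J_head: "J 0 = (LINT y:{0<..h}|lborel. F y)"
    by (simp add: J_def A_def)
  have "(\<Sum>k. J k) - J 0 = (\<Sum>k. J (Suc k))"
    using suminf_split_head[OF sumJ] by simp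
  also have "\<dots> \<le> (\<Sum>k. h * F (real (Suc k) * h))"
    by (rule suminf_le[OF up _ summable_mult[OF sumF]]) (use sumJ in \<open>simp add: summable_Suc_iff\<close>)
  finally show "(LINT y:{0<..}|lborel. F y) - (LINT y:{0<..h}|lborel. F y) \<le> h * (\<Sum>k. F (real (Suc k) * h))"
    unfolding IJ eqF by (simp only: J_head)
qed

context
  fixes \<tau> :: real
  assumes \<tau>: "3 < \<tau>" "\<tau> < 5"
begin

text \<open>The integrand of the constant on the positive half-line. Written through
  \<open>phi\<close> it is nonnegative on all reals, as the Riemann sum comparison requires.\<close>

private definition F where "F y = phi (y powr (- 1 / (\<tau> - 1)))"

private lemma F_nonneg: "0 \<le> F y"
  by (simp add: F_def)

private lemma F_decr: "0 < x \<Longrightarrow> x \<le> y \<Longrightarrow> F y \<le> F x"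
  unfolding F_def using \<tau> by (intro phi_mono powr_mono2') (auto simp: divide_le_0_iff)

private lemma F_le_small: "0 < y \<Longrightarrow> F y \<le> y powr (- 2 / (\<tau> - 1)) / 2"
  using phi_le_square[of "y powr (- 1 / (\<tau> - 1))"] by (simp add: F_def powr_power)

private lemma F_le_large: "0 < y \<Longrightarrow> F y \<le> y powr (- 4 / (\<tau> - 1)) / 12"
  using phi_le_quartic[of "y powr (- 1 / (\<tau> - 1))"] by (simp add: F_def powr_power)

private lemma C_case2_integrand_eq: "0 < y \<Longrightarrow> C_case2_integrand \<tau> y = F y"
  by (simp add: C_case2_integrand_def F_def phi_def powr_power)

private lemma F_measurable [measurable]: "F \<in> borel_measurable borel"
  unfolding F_def by measurable

text \<open>Near 0 the quadratic bound for \<open>phi\<close> gives the exponent -2/(\<tau>-1) > -1,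
  by \<tau> > 3; at infinity the quartic one gives -4/(\<tau>-1) < -1, by \<tau> < 5.\<close>

private lemma set_integrable_F: "set_integrable lborel {0<..} F"
proof -
  \<comment> \<open>The two pieces overlap on (1, 2), so every positive y lies inside one of the
    open intervals.\<close>
  let ?g = "\<lambda>y. indicator {0<..<2} y *\<^sub>R (y powr (- 2 / (\<tau> - 1)) / 2) +
    indicator {1<..} y *\<^sub>R (y powr (- 4 / (\<tau> - 1)) / 12) :: real"
  have "set_integrable lborel {0<..<2} (\<lambda>y. y powr (- 2 / (\<tau> - 1)))"
    using \<tau> by (intro powr_integral_near_0) (auto simp: field_simps)
  moreover have "set_integrable lborel {1<..} (\<lambda>y. y powr (- 4 / (\<tau> - 1)))"
    using \<tau> by (intro set_integrable_powr_at_top) (auto simp: field_simps)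
  ultimately have "integrable lborel ?g"
    unfolding set_integrable_def by simp
  then show ?thesis
    unfolding set_integrable_def
  proof (rule Bochner_Integration.integrable_bound)
    show "AE y in lborel. norm (indicator {0<..} y *\<^sub>R F y) \<le> norm (?g y)"
    proof (intro AE_I2)
      fix y :: real
      consider "y \<le> 0" | "0 < y" "y < 2" | "2 \<le> y" by linarith
      then show "norm (indicator {0<..} y *\<^sub>R F y) \<le> norm (?g y)"
      proof cases
        case 2
        have "F y \<le> y powr (- 2 / (\<tau> - 1)) / 2" by (rule F_le_small[OF 2(1)])
        also have "\<dots> \<le> ?g y" using 2 by simp
        finally show ?thesis using 2 F_nonneg[of y] by (simp only: real_norm_def) simp
      next
        case 3
        then show ?thesis using F_le_large[of y] F_nonneg[of y] by (simp add: indicator_def)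
      qed simp
    qed
  qed measurable
qed

lemma set_integrable_C_case2_integrand: "set_integrable lborel {0<..} (C_case2_integrand \<tau>)"
  using set_integrable_F
  by (rule set_integrable_cong[THEN iffD1, rotated -1]) (auto simp: C_case2_integrand_eq)

private lemma C_case2_eq: "C_case2 \<tau> = ((\<tau> - 2) / (\<tau> - 1)) powr (\<tau> - 1) * (LINT y:{0<..}|lborel. F y)"
  unfolding C_case2_def
  by (intro arg_cong2[where f = "(*)"] refl set_lebesgue_integral_cong) (auto simp: C_case2_integrand_eq)

text \<open>The Riemann sum of mesh 1 lies below the integral and has positive terms.\<close>

lemma C_case2_pos: "0 < C_case2 \<tau>"
proof -
  note R = decreasing_riemann_sum[OF F_nonneg F_decr set_integrable_F zero_less_one]
  have "0 < F (real (Suc k) * 1)" for k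
    unfolding F_def by (intro phi_pos) simp
  then have "0 < (\<Sum>k. F (real (Suc k) * 1))"
    by (intro suminf_pos R(1)) auto
  also have "\<dots> \<le> (LINT y:{0<..}|lborel. F y)"
    using R(2) by simp
  finally show ?thesis
    unfolding C_case2_eq using \<tau> by simp
qed

private lemma F_integral_near_0:
  "((\<lambda>h. LINT y:{0<..h}|lborel. F y) \<longlongrightarrow> 0) (at_right 0)"
proof (rule tendsto_sandwich[OF _ _ tendsto_const])
  define r where "r = - 2 / (\<tau> - 1)"
  have r: "- 1 < r" using \<tau> by (simp add: r_def field_simps)
  show "eventually (\<lambda>h. 0 \<le> (LINT y:{0<..h}|lborel. F y)) (at_right 0)"
    unfolding set_lebesgue_integral_def
    by (intro always_eventually allI integral_nonneg_AE) (simp add: F_nonneg)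
  show "eventually (\<lambda>h. (LINT y:{0<..h}|lborel. F y) \<le> (2 * h) powr (r + 1) / (r + 1) / 2) (at_right 0)"
    using eventually_at_right_less
  proof eventually_elim
    case (elim h)
    \<comment> \<open>Power integrals were computed on open intervals; doubling the length covers
      the endpoint h.\<close>
    have "(LINT y:{0<..h}|lborel. F y) \<le> (LINT y:{0<..<2 * h}|lborel. y powr r / 2)"
      unfolding set_lebesgue_integral_def
    proof (rule integral_mono)
      have "set_integrable lborel {0<..h} F"
        by (rule set_integrable_subset[OF set_integrable_F]) auto
      then show "integrable lborel (\<lambda>y. indicator {0<..h} y *\<^sub>R F y)"
        by (simp add: set_integrable_def)
      show "integrable lborel (\<lambda>y. indicator {0<..<2 * h} y *\<^sub>R (y powr r / 2))"
        using powr_integral_near_0(1)[OF r, of "2 * h"] elim by (simp add: set_integrable_def)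
      show "indicator {0<..h} y *\<^sub>R F y \<le> indicator {0<..<2 * h} y *\<^sub>R (y powr r / 2)" for y
        using F_le_small[of y] elim by (auto simp: indicator_def r_def)
    qed
    also have "\<dots> = (2 * h) powr (r + 1) / (r + 1) / 2"
      using powr_integral_near_0(2)[OF r, of "2 * h"] elim by simp
    finally show ?case .
  qed
  show "((\<lambda>h. (2 * h) powr (r + 1) / (r + 1) / 2) \<longlongrightarrow> 0) (at_right 0)"
    using tendsto_divide[OF tendsto_divide[OF powr_tendsto_0_at_right[of "r + 1" 2] tendsto_const[of "r + 1"]]
        tendsto_const[of 2]] r by simp
qed

text \<open>With h = (\<kappa> x)^(-(\<tau>-1)) the i-th argument of \<open>phi\<close> becomes (i
  h)^(-1/(\<tau>-1)). The series is thus a Riemann sum of \<open>F\<close> lacking its factor h, and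
  dividing by x^(\<tau>-1) supplies \<kappa>^(\<tau>-1) h. As x grows the mesh tends to 0, and with
  it the integral over the first cell.\<close>

lemma f_case2_asymptotics:
  "((\<lambda>x. f_case2 \<tau> x / x powr (1 + (\<tau> - 2))) \<longlongrightarrow> C_case2 \<tau>) at_top"
proof -
  define \<kappa> where "\<kappa> = (\<tau> - 2) / (\<tau> - 1)"
  have \<kappa>: "0 < \<kappa>" using \<tau> by (simp add: \<kappa>_def)
  define h where "h x = (\<kappa> * x) powr (- (\<tau> - 1))" for x
  let ?I = "LINT y:{0<..}|lborel. F y" and ?S = "\<lambda>x. \<Sum>k. F (real (Suc k) * h x)"
  have h_pos: "0 < h x" if "0 < x" for x using that \<kappa> by (simp add: h_def)
  have f: "f_case2 \<tau> x / x powr (1 + (\<tau> - 2)) = \<kappa> powr (\<tau> - 1) * (h x * ?S x)" if x: "0 < x" for x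
  proof -
    have "f_case2_term \<tau> x (Suc k) = F (real (Suc k) * h x)" for k
    proof -
      have "h x powr (- 1 / (\<tau> - 1)) = \<kappa> * x"
      proof -
        have e: "- (\<tau> - 1) * (- 1 / (\<tau> - 1)) = 1" using \<tau> by (simp add: field_simps)
        show ?thesis unfolding h_def powr_powr e using x \<kappa> by simp
      qed
      then have "(real (Suc k) * h x) powr (- 1 / (\<tau> - 1)) = \<kappa> * x * real (Suc k) powr (- 1 / (\<tau> - 1))"
        using h_pos[OF x] by (simp add: powr_mult)
      then show ?thesis unfolding f_case2_term_eq F_def \<kappa>_def by simp
    qed
    then have "f_case2 \<tau> x = ?S x" unfolding f_case2_def by simp
    moreover have "1 / x powr (1 + (\<tau> - 2)) = \<kappa> powr (\<tau> - 1) * h x"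
      using x \<kappa> by (simp only: h_def powr_minus powr_mult) (simp add: field_simps)
    ultimately show ?thesis by (metis divide_inverse inverse_eq_divide mult.assoc mult.commute)
  qed
  have h0: "filterlim h (at_right 0) at_top"
  proof -
    have "(h \<longlongrightarrow> 0) at_top"
      unfolding h_def using \<kappa> \<tau>
      by (intro tendsto_neg_powr filterlim_tendsto_pos_mult_at_top[OF tendsto_const] filterlim_ident) auto
    moreover have "eventually (\<lambda>x. h x \<in> {0<..} \<and> h x \<noteq> 0) at_top"
      using eventually_gt_at_top[of 0] by eventually_elim (use h_pos in force)
    ultimately show ?thesis by (simp add: filterlim_at)
  qed
  have "((\<lambda>x. LINT y:{0<..h x}|lborel. F y) \<longlongrightarrow> 0) at_top"
    by (rule filterlim_compose[OF F_integral_near_0 h0])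
  from tendsto_mult[OF tendsto_const[of "\<kappa> powr (\<tau> - 1)"] tendsto_diff[OF tendsto_const[of ?I] this]]
  have low: "((\<lambda>x. \<kappa> powr (\<tau> - 1) * (?I - (LINT y:{0<..h x}|lborel. F y))) \<longlongrightarrow> C_case2 \<tau>) at_top"
    by (simp add: C_case2_eq \<kappa>_def)
  show ?thesis
  proof (rule tendsto_sandwich[OF _ _ low tendsto_const])
    show "eventually (\<lambda>x. \<kappa> powr (\<tau> - 1) * (?I - (LINT y:{0<..h x}|lborel. F y)) \<le>
        f_case2 \<tau> x / x powr (1 + (\<tau> - 2))) at_top"
      using eventually_gt_at_top[of 0]
    proof eventually_elim
      case (elim x)
      show ?case unfolding f[OF elim]
        by (intro mult_left_mono decreasing_riemann_sum(3) F_nonneg F_decr set_integrable_F h_pos elim powr_ge_zero)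
    qed
    show "eventually (\<lambda>x. f_case2 \<tau> x / x powr (1 + (\<tau> - 2)) \<le> C_case2 \<tau>) at_top"
      using eventually_gt_at_top[of 0]
    proof eventually_elim
      case (elim x)
      show ?case unfolding f[OF elim] C_case2_eq \<kappa>_def[symmetric]
        by (intro mult_left_mono decreasing_riemann_sum(2) F_nonneg F_decr set_integrable_F h_pos elim powr_ge_zero)
    qed
  qed
qed

end

theorem mainTheorem3:
  fixes w :: "nat \<Rightarrow> nat \<Rightarrow> real" and \<mu> :: "real measure"
  assumes pos: "\<forall>N i. 1 \<le> i \<and> i \<le> N \<longrightarrow> 0 < w N i"
    and reg: "weight_regular w \<mu>"
  shows
    "(integrable \<mu> (\<lambda>x. x ^ 4) \<and> (\<lambda>N. moment w N 4) \<longlonglongrightarrow> (\<integral>x. x ^ 4 \<partial>\<mu>) \<longrightarrow>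
       scaling_limit (\<lambda>N. annealed_ising w N (arsinh (1 / nu w N)) 0) 3 (f_case1 \<mu>) \<and>
       scaling_limit (\<lambda>N. cw_measure w N (1 / nu w N) 0) 3 (f_case1 \<mu>) \<and>
       ((\<lambda>x. f_case1 \<mu> x / x powr (1 + 3)) \<longlongrightarrow>
          1/12 * (\<integral>y. y ^ 4 \<partial>\<mu>) / (\<integral>y. y \<partial>\<mu>) ^ 4) at_top)
     \<and>
     (\<forall>c\<^sub>w \<tau>. 0 < c\<^sub>w \<and> 3 < \<tau> \<and> \<tau> < 5 \<and>
        (\<forall>N i. 1 \<le> i \<and> i \<le> N \<longrightarrow> w N i = c\<^sub>w * (real N / real i) powr (1 / (\<tau> - 1))) \<longrightarrow>
       scaling_limit (\<lambda>N. annealed_ising w N (arsinh (1 / nu w N)) 0) (\<tau> - 2) (f_case2 \<tau>) \<and>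
       scaling_limit (\<lambda>N. cw_measure w N (1 / nu w N) 0) (\<tau> - 2) (f_case2 \<tau>) \<and>
       set_integrable lborel {0<..} (C_case2_integrand \<tau>) \<and>
       0 < C_case2 \<tau> \<and>
       ((\<lambda>x. f_case2 \<tau> x / x powr (1 + (\<tau> - 2))) \<longlongrightarrow> C_case2 \<tau>) at_top)"
proof (intro conjI impI allI)
  have pos': "\<And>N i. i \<in> {1..N} \<Longrightarrow> 0 < w N i" using pos by auto
  {
    assume "integrable \<mu> (\<lambda>x. x ^ 4) \<and> (\<lambda>N. moment w N 4) \<longlonglongrightarrow> (\<integral>x. x ^ 4 \<partial>\<mu>)"
    then interpret critical_scaling w \<mu> "3/4" "f_case1 \<mu>"
      using pos' reg by (intro critical_scaling_case1) auto
    show "scaling_limit (\<lambda>N. annealed_ising w N (arsinh (1 / nu w N)) 0) 3 (f_case1 \<mu>)"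
      by (rule scaling_limit_annealed) simp
    show "scaling_limit (\<lambda>N. cw_measure w N (1 / nu w N) 0) 3 (f_case1 \<mu>)"
      by (rule scaling_limit_cw) simp
    show "((\<lambda>x. f_case1 \<mu> x / x powr (1 + 3)) \<longlongrightarrow>
        1/12 * (\<integral>y. y ^ 4 \<partial>\<mu>) / (\<integral>y. y \<partial>\<mu>) ^ 4) at_top"
      by (rule f_case1_asymptotics)
  }
  fix c\<^sub>w \<tau> :: real
  assume *: "0 < c\<^sub>w \<and> 3 < \<tau> \<and> \<tau> < 5 \<and>
    (\<forall>N i. 1 \<le> i \<and> i \<le> N \<longrightarrow> w N i = c\<^sub>w * (real N / real i) powr (1 / (\<tau> - 1)))"
  then have \<tau>: "3 < \<tau>" "\<tau> < 5" by auto
  have exponent: "(\<tau> - 2) / (\<tau> - 1) = (\<tau> - 2) / (\<tau> - 2 + 1)" by simp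
  interpret critical_scaling w \<mu> "(\<tau> - 2) / (\<tau> - 1)" "f_case2 \<tau>"
    by (rule critical_scaling_case2[OF pos' reg, of c\<^sub>w]) (use * in auto)
  show "scaling_limit (\<lambda>N. annealed_ising w N (arsinh (1 / nu w N)) 0) (\<tau> - 2) (f_case2 \<tau>)"
    using exponent by (rule scaling_limit_annealed)
  show "scaling_limit (\<lambda>N. cw_measure w N (1 / nu w N) 0) (\<tau> - 2) (f_case2 \<tau>)"
    using exponent by (rule scaling_limit_cw)
  show "set_integrable lborel {0<..} (C_case2_integrand \<tau>)"
    using \<tau> by (rule set_integrable_C_case2_integrand)
  show "0 < C_case2 \<tau>"
    using \<tau> by (rule C_case2_pos)
  show "((\<lambda>x. f_case2 \<tau> x / x powr (1 + (\<tau> - 2))) \<longlongrightarrow> C_case2 \<tau>) at_top"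
    using \<tau> by (rule f_case2_asymptotics)
qed

end
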